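(* Let $p,q\ge3$ be odd integers with $\gcd(p,q)=1$, and let $K_{p,q}=\mathrm{Th}(p,q)$ be the closure of the braid $A_p^q$. Then $K_{p,q}$ is Klein amphichiral. More precisely, there exist smooth ambient involutions $\rho,\tau:S^3\to S^3$ which generate a subgroup $\langle\rho,\tau\rangle\cong\mathbb Z_2\oplus\mathbb Z_2$ and satisfy the following properties: (i) $\rho$ is orientation-preserving and satisfies $\rho(K_{p,q})=-K_{p,q}$, $\mathrm{Fix}(\rho)\cong S^1$, and $\#\bigl(K_{p,q}\cap\mathrm{Fix}(\rho)\bigr)=2$; (ii) $\tau$ is orientation-reversing and satisfies $\tau(K_{p,q})=-K_{p,q}$, $\mathrm{Fix}(\tau)\cong S^0$, and $K_{p,q}\cap\mathrm{Fix}(\tau)=\mathrm{Fix}(\tau)$; (iii) $\rho\tau=\tau\rho$.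
   Context: For $p\ge2$ let $B_p$ be the braid group on $p$ strands with standard generators $\sigma_1,\dots,\sigma_{p-1}$, and set $A_p=\prod_{i=1}^{p-1}\sigma_i^{(-1)^{i-1}}=\sigma_1\sigma_2^{-1}\sigma_3\sigma_4^{-1}\cdots\in B_p$ (factors in increasing order of $i$). The Turk's head link $\mathrm{Th}(p,q)\subset S^3$ is the closure of $A_p^q$; it is a knot when $\gcd(p,q)=1$, considered up to isotopy. For an oriented knot $K$, $-K$ denotes $K$ with reversed orientation. A strong inversion of $K\subset S^3$ is an orientation-preserving involution $\rho$ of $S^3$ with $\rho(K)=-K$; a strongly negative amphichiral involution for $K$ is an orientation-reversing involution $\tau$ of $S^3$ with $\tau(K)=-K$. A knot is Klein amphichiral if it admits a strong inversion and a strongly negative amphichiral involution which commute. *)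

theory Defs
  imports "HOL-Analysis.Analysis" "HOL-Algebra.Bij" "HOL-Algebra.Elementary_Groups"
begin

section \<open>Smooth maps\<close>

text \<open>\<open>Ck_on k f U\<close> is meant for open \<open>U\<close>: all iterated directional derivatives
  of order at most \<open>k\<close> exist and are continuous on \<open>U\<close>.\<close>

primrec Ck_on :: "nat \<Rightarrow> ('a::euclidean_space \<Rightarrow> 'b::euclidean_space) \<Rightarrow> 'a set \<Rightarrow> bool" where
  "Ck_on 0 f U \<longleftrightarrow> continuous_on U f"
| "Ck_on (Suc k) f U \<longleftrightarrow>
     (\<forall>x\<in>U. f differentiable (at x)) \<and> (\<forall>v. Ck_on k (\<lambda>x. frechet_derivative f (at x) v) U)"

text \<open>A map on an arbitrary subset of a Euclidean space is smooth if it extends to a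
  \<open>C\<^sup>\<infinity>\<close> map on an open neighbourhood.\<close>

definition smooth_on :: "'a::euclidean_space set \<Rightarrow> ('a \<Rightarrow> 'b::euclidean_space) \<Rightarrow> bool" where
  "smooth_on S f \<longleftrightarrow>
     (\<exists>U g. open U \<and> S \<subseteq> U \<and> (\<forall>k. Ck_on k g U) \<and> (\<forall>x\<in>S. g x = f x))"

abbreviation S3 :: "(real^4) set" where
  "S3 \<equiv> sphere 0 1"

definition S3_diffeo :: "(real^4 \<Rightarrow> real^4) \<Rightarrow> bool" where
  "S3_diffeo f \<longleftrightarrow> bij_betw f S3 S3 \<and> smooth_on S3 f \<and> smooth_on S3 (inv_into S3 f)"

definition S3_involution :: "(real^4 \<Rightarrow> real^4) \<Rightarrow> bool" where
  "S3_involution f \<longleftrightarrow> smooth_on S3 f \<and> f ` S3 \<subseteq> S3 \<and> (\<forall>x\<in>S3. f (f x) = x)"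

definition fixed_set :: "(real^4 \<Rightarrow> real^4) \<Rightarrow> (real^4) set" where
  "fixed_set f = {x \<in> S3. f x = x}"

text \<open>\<open>S\<^sup>3\<close> is oriented as the boundary of the ball: a basis of the tangent space at \<open>x\<close>
  is positive iff it becomes a positive basis of \<open>\<real>\<^sup>4\<close> when the outward normal \<open>x\<close> is put in
  front. At \<open>x \<in> S\<^sup>3\<close> the derivative of the radial extension restricts to the differential of
  \<open>f\<close> on the tangent space and sends the normal \<open>x\<close> to the normal \<open>f x\<close>, so the sign of its
  determinant tells whether \<open>f\<close> preserves this orientation at \<open>x\<close>.\<close>

definition radial_ext :: "(real^4 \<Rightarrow> real^4) \<Rightarrow> real^4 \<Rightarrow> real^4" where
  "radial_ext f x = norm x *\<^sub>R f (x /\<^sub>R norm x)"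

definition orientation_preserving :: "(real^4 \<Rightarrow> real^4) \<Rightarrow> bool" where
  "orientation_preserving f \<longleftrightarrow> (\<forall>x\<in>S3. det (jacobian (radial_ext f) (at x)) > 0)"

definition orientation_reversing :: "(real^4 \<Rightarrow> real^4) \<Rightarrow> bool" where
  "orientation_reversing f \<longleftrightarrow> (\<forall>x\<in>S3. det (jacobian (radial_ext f) (at x)) < 0)"

section \<open>Oriented knots\<close>

text \<open>An oriented knot is given by a regular 1-periodic parametrization \<open>K\<close> that is injective
  on a period; two parametrizations describe the same oriented knot iff they differ by a lift of
  an orientation-preserving diffeomorphism of the circle \<open>\<real>/\<int>\<close>. The underlying set of the
  knot is \<open>range K\<close>.\<close>

definition oriented_knot :: "(real \<Rightarrow> real^4) \<Rightarrow> bool" where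
  "oriented_knot K \<longleftrightarrow>
     smooth_on UNIV K \<and> range K \<subseteq> S3 \<and> (\<forall>t. K (t + 1) = K t) \<and> inj_on K {0..<1} \<and>
     (\<forall>t. vector_derivative K (at t) \<noteq> 0)"

definition same_oriented_knot :: "(real \<Rightarrow> real^4) \<Rightarrow> (real \<Rightarrow> real^4) \<Rightarrow> bool" where
  "same_oriented_knot K L \<longleftrightarrow>
     (\<exists>h::real \<Rightarrow> real. smooth_on UNIV h \<and> (\<forall>t. deriv h t > 0) \<and> (\<forall>t. h (t + 1) = h t + 1) \<and>
        (\<forall>t. L t = K (h t)))"

definition reverse_knot :: "(real \<Rightarrow> real^4) \<Rightarrow> real \<Rightarrow> real^4" where
  "reverse_knot K t = K (- t)"

definition reverses_knot :: "(real^4 \<Rightarrow> real^4) \<Rightarrow> (real \<Rightarrow> real^4) \<Rightarrow> bool" where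
  "reverses_knot f K \<longleftrightarrow> same_oriented_knot (f \<circ> K) (reverse_knot K)"

definition isotopic_knots :: "(real \<Rightarrow> real^4) \<Rightarrow> (real \<Rightarrow> real^4) \<Rightarrow> bool" where
  "isotopic_knots K L \<longleftrightarrow>
     (\<exists>H :: real \<Rightarrow> real^4 \<Rightarrow> real^4.
        smooth_on ({0..1} \<times> S3) (\<lambda>(s, x). H s x) \<and> (\<forall>s\<in>{0..1}. S3_diffeo (H s)) \<and>
        (\<forall>x\<in>S3. H 0 x = x) \<and> same_oriented_knot (H 1 \<circ> K) L)"

section \<open>Braids and their closures\<close>

text \<open>A letter \<open>(i, e)\<close> with \<open>e = \<plusminus>1\<close> stands for \<open>\<sigma>\<^sub>i\<^sup>e\<close>, and a word for the product of its letters
  in the braid group.\<close>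

type_synonym braid_word = "(nat \<times> int) list"

definition braid_power :: "braid_word \<Rightarrow> nat \<Rightarrow> braid_word" where
  "braid_power w q = concat (replicate q w)"

text \<open>\<open>smooth_step\<close> is a smooth function, constant 0 on \<open>t \<le> 0\<close> and constant 1 on \<open>t \<ge> 1\<close>; it makes
  consecutive elementary braids fit together smoothly.\<close>

definition flat_exp :: "real \<Rightarrow> real" where
  "flat_exp t = (if t > 0 then exp (- 1 / t) else 0)"

definition smooth_step :: "real \<Rightarrow> real" where
  "smooth_step t = flat_exp t / (flat_exp t + flat_exp (1 - t))"

text \<open>The strands of a geometric braid start and end at the points \<open>1, \<dots>, p\<close> of the complex
  plane. In the elementary braid \<open>\<sigma>\<^sub>i\<^sup>e\<close> the strands at \<open>i\<close> and \<open>i + 1\<close> change places by a half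
  turn (counterclockwise for \<open>e = 1\<close>) about their midpoint, and the other strands stay put.\<close>

definition generator_positions :: "nat \<Rightarrow> nat \<times> int \<Rightarrow> real \<Rightarrow> complex set" where
  "generator_positions p l s =
     (case l of (i, e) \<Rightarrow>
        of_nat ` ({1..p} - {i, i + 1}) \<union>
        {of_nat i + 1 / 2 + cis (pi * of_int e * smooth_step s) / 2,
         of_nat i + 1 / 2 - cis (pi * of_int e * smooth_step s) / 2})"

text \<open>A geometric braid is a subset of \<open>\<complex> \<times> [0, 1]\<close>; the elementary braids of a word of length \<open>n\<close>
  are stacked in its \<open>n\<close> slabs of height \<open>1 / n\<close>.\<close>

definition geometric_braid :: "nat \<Rightarrow> braid_word \<Rightarrow> (complex \<times> real) set" where
  "geometric_braid p w =
     (if w = [] then of_nat ` {1..p} \<times> {0..1}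
      else {(z, (real k + s) / real (length w)) | z k s.
              k < length w \<and> s \<in> {0..1} \<and> z \<in> generator_positions p (w ! k) s})"

text \<open>The standard open solid torus in \<open>S\<^sup>3\<close>, the complement of the braid axis
  (the circle on which the last two coordinates vanish), as the image of \<open>\<complex> \<times> \<real>/\<int>\<close>.\<close>

definition solid_torus :: "complex \<times> real \<Rightarrow> real^4" where
  "solid_torus = (\<lambda>(z, t).
     vector [Re z, Im z, cos (2 * pi * t), sin (2 * pi * t)] /\<^sub>R sqrt (1 + (cmod z)\<^sup>2))"

definition braid_closure :: "(complex \<times> real) set \<Rightarrow> (real^4) set" where
  "braid_closure B = solid_torus ` B"

text \<open>\<open>K\<close> parametrizes the closure of \<open>B\<close>, oriented as usual by the direction of the braid. (In
  particular the closure has one component.)\<close>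

definition closure_knot :: "(complex \<times> real) set \<Rightarrow> (real \<Rightarrow> real^4) \<Rightarrow> bool" where
  "closure_knot B K \<longleftrightarrow>
     oriented_knot K \<and> range K = braid_closure B \<and>
     (\<exists>z \<theta>. continuous_on UNIV \<theta> \<and> strict_mono \<theta> \<and> (\<forall>t. K t = solid_torus (z t, \<theta> t)))"

definition turks_head_braid :: "nat \<Rightarrow> braid_word" where
  "turks_head_braid p = map (\<lambda>i. (i, (- 1) ^ (i - 1))) [1..<p]"

text \<open>Knots are considered up to isotopy, so every knot isotopic to the closure of
  \<open>A\<^sub>p\<^sup>q\<close> is a Turk's head knot.\<close>

definition turks_head_knot :: "nat \<Rightarrow> nat \<Rightarrow> (real \<Rightarrow> real^4) \<Rightarrow> bool" where
  "turks_head_knot p q K \<longleftrightarrow>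
     oriented_knot K \<and>
     (\<exists>K0. closure_knot (geometric_braid p (braid_power (turks_head_braid p) q)) K0 \<and>
           isotopic_knots K0 K)"

section \<open>Symmetries of knots\<close>

definition strong_inversion :: "(real \<Rightarrow> real^4) \<Rightarrow> (real^4 \<Rightarrow> real^4) \<Rightarrow> bool" where
  "strong_inversion K \<rho> \<longleftrightarrow> S3_involution \<rho> \<and> orientation_preserving \<rho> \<and> reverses_knot \<rho> K"

definition strongly_negative_amphichiral :: "(real \<Rightarrow> real^4) \<Rightarrow> (real^4 \<Rightarrow> real^4) \<Rightarrow> bool" where
  "strongly_negative_amphichiral K \<tau> \<longleftrightarrow>
     S3_involution \<tau> \<and> orientation_reversing \<tau> \<and> reverses_knot \<tau> K"

definition klein_amphichiral :: "(real \<Rightarrow> real^4) \<Rightarrow> bool" where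
  "klein_amphichiral K \<longleftrightarrow>
     (\<exists>\<rho> \<tau>. strong_inversion K \<rho> \<and> strongly_negative_amphichiral K \<tau> \<and>
            (\<forall>x\<in>S3. \<rho> (\<tau> x) = \<tau> (\<rho> x)))"

text \<open>The restrictions make the maps elements of \<^const>\<open>BijGroup\<close>, whose elements are
  undefined outside of \<open>S\<^sup>3\<close>.\<close>

definition S3_group_generated :: "(real^4 \<Rightarrow> real^4) set \<Rightarrow> (real^4 \<Rightarrow> real^4) monoid" where
  "S3_group_generated F = subgroup_generated (BijGroup S3) ((\<lambda>f. restrict f S3) ` F)"

end

theory Submission
  imports Defs
begin

text \<open>A single diffeomorphism of \<open>S\<^sup>3\<close> carries the closed braid to a curve that is invariant under
  the linear involutions \<open>diag(1, -1, 1, -1)\<close> and \<open>diag(-1, -1, -1, 1)\<close>, and \<open>\<rho>\<close> and \<open>\<tau>\<close> are their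
  conjugates. In the cyclic sequence of letters of \<open>A\<^sub>p\<^sup>q\<close>, occurrences of \<open>\<sigma>\<^sub>i\<close> and \<open>\<sigma>\<^sub>i\<^sub>+\<^sub>1\<close>
  alternate, so the word can be rearranged such that all \<open>\<sigma>\<^sub>i\<close> with \<open>i\<close> odd occur at the integral times
  and all \<open>\<sigma>\<^sub>i\<^sup>-\<^sup>1\<close> with \<open>i\<close> even at the half-integral times. Geometrically this is a map
  of the solid torus of the form \<open>(z, t) \<mapsto> (z, g (z, t))\<close> that only moves the crossings
  in time; a preliminary twist in the discs of the crossings makes room for it, and a final shear in the
  direction of \<open>Re z\<close> centres the strands. In this position \<open>(z, t) \<mapsto> (cnj z, - t)\<close> and
  \<open>(z, t) \<mapsto> (- z, q / 2 - t)\<close> preserve the closed braid, the latter because \<open>p\<close> and \<open>q\<close> are odd.\<close>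

section \<open>Calculus of smooth maps\<close>

text \<open>That the involutions reverse the knot is not read off from a parametrization: an
  involution that preserves a knot as a set, fixes a point of it but not all of it, acts on the
  circle as a reflection. So only the point set of the braid has to be followed through the
  deformations; a finite non-empty intersection with the fixed set does the rest. Every deformation
  has to extend smoothly over the braid axis, so it is the identity for large \<open>cmod z\<close>
  and commutes with the unit time shift. Cutting off can destroy injectivity. Therefore times and
  positions are changed by shears with a positive lower bound on their slope, whose inverses come
  from the implicit function theorem, and the centring includes a contraction. The conjugating
  diffeomorphism may reverse orientation: its determinant and that of its inverse have the same sign
  and cancel. The parities enter as follows. For \<open>p\<close> odd, \<open>i\<close> and
  \<open>p - i\<close> have opposite parity, which changes the sign of the crossing; for
  \<open>q\<close> odd, the reflection \<open>q / 2 - t\<close> exchanges integral and half-integral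
  times.\<close>

lemma Ck_on_cong:
  assumes "open U" "\<And>x. x \<in> U \<Longrightarrow> f x = g x" "Ck_on k f U"
  shows "Ck_on k g U"
  using assms(2,3)
proof (induction k arbitrary: f g)
  case 0
  then show ?case by (simp cong: continuous_on_cong)
next
  case (Suc k)
  have *: "(g has_derivative frechet_derivative f (at x)) (at x)" if "x \<in> U" for x
  proof (rule has_derivative_transform_within_open[OF _ \<open>open U\<close> that])
    show "(f has_derivative frechet_derivative f (at x)) (at x)"
      using Suc.prems(2) that by (auto simp: frechet_derivative_works)
  qed (use Suc.prems in auto)
  then have eq: "frechet_derivative g (at x) = frechet_derivative f (at x)" if "x \<in> U" for x
    using that by (metis frechet_derivative_at)
  have "Ck_on k (\<lambda>x. frechet_derivative g (at x) v) U" for v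
    by (rule Suc.IH[of "\<lambda>x. frechet_derivative f (at x) v"]) (use Suc.prems eq in auto)
  then show ?case
    using * by (auto simp: differentiable_def)
qed

lemma Ck_on_subset: "Ck_on k f U \<Longrightarrow> V \<subseteq> U \<Longrightarrow> Ck_on k f V"
  by (induction k arbitrary: f) (auto intro: continuous_on_subset)

lemma Ck_on_SucD: "Ck_on (Suc k) f U \<Longrightarrow> Ck_on k f U"
proof (induction k arbitrary: f)
  case 0
  then show ?case
    by (auto intro!: continuous_at_imp_continuous_on differentiable_imp_continuous_within)
next
  case (Suc k)
  then show ?case by auto
qed

text \<open>\<open>frechet_derivative\<close> is a choice operator, so smoothness proofs need a way
  to work with explicit derivatives instead; on an open set the derivative is unique and the two
  agree.\<close>

lemma Ck_on_SucI:
  assumes "open U" "\<And>x. x \<in> U \<Longrightarrow> (f has_derivative f' x) (at x)" "\<And>v. Ck_on k (\<lambda>x. f' x v) U"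
  shows "Ck_on (Suc k) f U"
proof -
  have eq: "frechet_derivative f (at x) = f' x" if "x \<in> U" for x
    using assms(2)[OF that] by (metis frechet_derivative_at)
  have "Ck_on k (\<lambda>x. frechet_derivative f (at x) v) U" for v
    by (rule Ck_on_cong[OF assms(1) _ assms(3)[of v]]) (simp add: eq)
  then show ?thesis
    using assms(2) by (auto simp: differentiable_def)
qed

lemma Ck_on_local:
  assumes "\<And>x. x \<in> U \<Longrightarrow> \<exists>V. open V \<and> x \<in> V \<and> Ck_on k f V"
  shows "Ck_on k f U"
  using assms
proof (induction k arbitrary: f)
  case 0
  have "continuous (at x) f" if "x \<in> U" for x
    using 0[OF that] continuous_on_eq_continuous_at by auto
  then show ?case by (simp add: continuous_at_imp_continuous_on)
next
  case (Suc k)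
  have "f differentiable at x" if "x \<in> U" for x
    using Suc.prems[OF that] by auto
  moreover have "Ck_on k (\<lambda>x. frechet_derivative f (at x) v) U" for v
    using Suc.prems by (intro Suc.IH) fastforce
  ultimately show ?case by auto
qed

lemma Ck_on_const: "open U \<Longrightarrow> Ck_on k (\<lambda>x. c) U"
proof (induction k arbitrary: c)
  case (Suc k)
  show ?case
    by (rule Ck_on_SucI[where f'="\<lambda>x v. 0"]) (use Suc in auto)
qed auto

lemma Ck_on_bounded_linear: "bounded_linear f \<Longrightarrow> open U \<Longrightarrow> Ck_on k f U"
proof (cases k)
  case 0
  assume "bounded_linear f"
  then show ?thesis using 0 by (simp add: linear_continuous_on)
next
  case (Suc j)
  assume "bounded_linear f" "open U"
  then show ?thesis unfolding Suc
    by (intro Ck_on_SucI[where f'="\<lambda>x. f"] Ck_on_const bounded_linear_imp_has_derivative)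
qed

lemma Ck_on_add: "open U \<Longrightarrow> Ck_on k f U \<Longrightarrow> Ck_on k g U \<Longrightarrow> Ck_on k (\<lambda>x. f x + g x) U"
proof (induction k arbitrary: f g)
  case 0
  then show ?case by (simp add: continuous_on_add)
next
  case (Suc k)
  show ?case
    by (rule Ck_on_SucI[where f'="\<lambda>x v. frechet_derivative f (at x) v + frechet_derivative g (at x) v"])
      (use Suc in \<open>auto intro!: has_derivative_add simp: frechet_derivative_works[symmetric]\<close>)
qed

lemma Ck_on_bilinear:
  assumes "bounded_bilinear h"
  shows "open U \<Longrightarrow> Ck_on k f U \<Longrightarrow> Ck_on k g U \<Longrightarrow> Ck_on k (\<lambda>x. h (f x) (g x)) U"
proof (induction k arbitrary: f g)
  case 0
  then show ?case using bounded_bilinear.continuous_on[OF assms] by simp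
next
  case (Suc k)
  show ?case
  proof (rule Ck_on_SucI[OF Suc.prems(1)])
    show "((\<lambda>x. h (f x) (g x)) has_derivative
        (\<lambda>v. h (f x) (frechet_derivative g (at x) v) + h (frechet_derivative f (at x) v) (g x))) (at x)"
      if "x \<in> U" for x
      using Suc.prems that
      by (intro bounded_bilinear.FDERIV[OF assms]) (auto simp: frechet_derivative_works[symmetric])
    show "Ck_on k (\<lambda>x. h (f x) (frechet_derivative g (at x) v) + h (frechet_derivative f (at x) v) (g x)) U"
      for v
      using Suc.prems
      by (intro Ck_on_add Suc.IH Ck_on_SucD[OF Suc.prems(2)] Ck_on_SucD[OF Suc.prems(3)]) auto
  qed
qed

lemma Ck_on_sum:
  "open U \<Longrightarrow> (\<And>i. i \<in> I \<Longrightarrow> Ck_on k (f i) U) \<Longrightarrow> Ck_on k (\<lambda>x. \<Sum>i\<in>I. f i x) U"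
  by (induction I rule: infinite_finite_induct) (auto intro: Ck_on_const Ck_on_add)

text \<open>In the chain rule the direction \<open>?f' x v\<close> varies with \<open>x\<close>,
  whereas \<open>Ck_on\<close> only speaks of fixed directions. Expanding it in the basis gives
  products of derivatives in fixed directions, to which the product rule and the induction
  hypothesis apply.\<close>

lemma Ck_on_compose:
  fixes f :: "'a::euclidean_space \<Rightarrow> 'b::euclidean_space" and g :: "'b \<Rightarrow> 'c::euclidean_space"
  shows "open U \<Longrightarrow> open V \<Longrightarrow> f ` U \<subseteq> V \<Longrightarrow> Ck_on k f U \<Longrightarrow> Ck_on k g V \<Longrightarrow> Ck_on k (\<lambda>x. g (f x)) U"
proof (induction k arbitrary: g)
  case 0
  then show ?case by (simp add: continuous_on_compose2)
next
  case (Suc k)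
  let ?f' = "\<lambda>x. frechet_derivative f (at x)" and ?g' = "\<lambda>y. frechet_derivative g (at y)"
  show ?case
  proof (rule Ck_on_SucI[OF Suc.prems(1)])
    show "((\<lambda>x. g (f x)) has_derivative (\<lambda>v. \<Sum>b\<in>Basis. (?f' x v \<bullet> b) *\<^sub>R ?g' (f x) b)) (at x)"
      if "x \<in> U" for x
    proof -
      have f: "(f has_derivative ?f' x) (at x)" and g: "(g has_derivative ?g' (f x)) (at (f x))"
        using Suc.prems that by (auto simp: frechet_derivative_works[symmetric])
      have "?g' (f x) (?f' x v) = (\<Sum>b\<in>Basis. (?f' x v \<bullet> b) *\<^sub>R ?g' (f x) b)" for v
      proof -
        have l: "linear (?g' (f x))" using g has_derivative_linear by blast
        have "?g' (f x) (?f' x v) = ?g' (f x) (\<Sum>b\<in>Basis. (?f' x v \<bullet> b) *\<^sub>R b)"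
          by (simp add: euclidean_representation)
        then show ?thesis
          by (simp add: linear_sum[OF l] linear_cmul[OF l])
      qed
      then show ?thesis
        using diff_chain_at[OF f g] by (simp add: o_def)
    qed
    show "Ck_on k (\<lambda>x. \<Sum>b\<in>Basis. (?f' x v \<bullet> b) *\<^sub>R ?g' (f x) b) U" for v
    proof (intro Ck_on_sum Suc.prems(1) Ck_on_bilinear[OF bounded_bilinear_scaleR])
      fix b :: 'b
      have "Ck_on k (\<lambda>x. ?f' x v) U" using Suc.prems by simp
      then show "Ck_on k (\<lambda>x. ?f' x v \<bullet> b) U"
        by (intro Ck_on_bilinear[OF bounded_bilinear_inner] Ck_on_const Suc.prems(1))
      show "Ck_on k (\<lambda>x. ?g' (f x) b) U"
        using Suc.prems(5) by (intro Suc.IH Suc.prems Ck_on_SucD[OF Suc.prems(4)]) auto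
    qed
  qed
qed

text \<open>Openness is built in, so that most closure rules need not carry it as a side
  condition.\<close>

definition Cinf_on :: "('a::euclidean_space \<Rightarrow> 'b::euclidean_space) \<Rightarrow> 'a set \<Rightarrow> bool" where
  "Cinf_on f U \<longleftrightarrow> open U \<and> (\<forall>k. Ck_on k f U)"

lemma Cinf_on_open: "Cinf_on f U \<Longrightarrow> open U"
  by (simp add: Cinf_on_def)

lemma Cinf_on_cong: "Cinf_on f U \<Longrightarrow> (\<And>x. x \<in> U \<Longrightarrow> f x = g x) \<Longrightarrow> Cinf_on g U"
  by (auto simp: Cinf_on_def intro: Ck_on_cong)

lemma Cinf_on_subset: "Cinf_on f U \<Longrightarrow> open V \<Longrightarrow> V \<subseteq> U \<Longrightarrow> Cinf_on f V"
  by (auto simp: Cinf_on_def intro: Ck_on_subset)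

lemma Cinf_on_local:
  assumes "open U" "\<And>x. x \<in> U \<Longrightarrow> \<exists>V. x \<in> V \<and> Cinf_on f V"
  shows "Cinf_on f U"
  unfolding Cinf_on_def
proof (intro conjI allI Ck_on_local)
  show "\<exists>V. open V \<and> x \<in> V \<and> Ck_on k f V" if "x \<in> U" for k x
    using assms(2)[OF that] by (auto simp: Cinf_on_def)
qed fact

lemma Cinf_on_const: "open U \<Longrightarrow> Cinf_on (\<lambda>x. c) U"
  by (simp add: Cinf_on_def Ck_on_const)

lemma Cinf_on_bounded_linear: "bounded_linear f \<Longrightarrow> open U \<Longrightarrow> Cinf_on f U"
  by (simp add: Cinf_on_def Ck_on_bounded_linear)

lemma Cinf_on_ident: "open U \<Longrightarrow> Cinf_on (\<lambda>x. x) U"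
  by (simp add: Cinf_on_bounded_linear bounded_linear_ident)

lemma Cinf_on_bilinear:
  "bounded_bilinear h \<Longrightarrow> Cinf_on f U \<Longrightarrow> Cinf_on g U \<Longrightarrow> Cinf_on (\<lambda>x. h (f x) (g x)) U"
  by (simp add: Cinf_on_def Ck_on_bilinear)

lemmas Cinf_on_mult = Cinf_on_bilinear[OF bounded_bilinear_mult]
lemmas Cinf_on_scaleR = Cinf_on_bilinear[OF bounded_bilinear_scaleR]
lemmas Cinf_on_inner = Cinf_on_bilinear[OF bounded_bilinear_inner]

lemma Cinf_on_add: "Cinf_on f U \<Longrightarrow> Cinf_on g U \<Longrightarrow> Cinf_on (\<lambda>x. f x + g x) U"
  by (simp add: Cinf_on_def Ck_on_add)

lemma Cinf_on_sum:
  "open U \<Longrightarrow> (\<And>i. i \<in> I \<Longrightarrow> Cinf_on (f i) U) \<Longrightarrow> Cinf_on (\<lambda>x. \<Sum>i\<in>I. f i x) U"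
  by (simp add: Cinf_on_def Ck_on_sum)

lemma Cinf_on_compose:
  "Cinf_on f U \<Longrightarrow> Cinf_on g V \<Longrightarrow> f ` U \<subseteq> V \<Longrightarrow> Cinf_on (\<lambda>x. g (f x)) U"
  by (auto simp: Cinf_on_def intro: Ck_on_compose)

lemma Cinf_on_linear_image:
  "bounded_linear h \<Longrightarrow> Cinf_on f U \<Longrightarrow> Cinf_on (\<lambda>x. h (f x)) U"
  by (rule Cinf_on_compose[where V=UNIV]) (auto intro: Cinf_on_bounded_linear)

lemma Cinf_on_minus: "Cinf_on f U \<Longrightarrow> Cinf_on (\<lambda>x. - f x) U"
  by (rule Cinf_on_linear_image[OF bounded_linear_minus[OF bounded_linear_ident]])

lemma Cinf_on_diff: "Cinf_on f U \<Longrightarrow> Cinf_on g U \<Longrightarrow> Cinf_on (\<lambda>x. f x - g x) U"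
  using Cinf_on_add[of f U "\<lambda>x. - g x"] Cinf_on_minus[of g U] by simp

lemma Cinf_on_Pair:
  fixes f :: "'a::euclidean_space \<Rightarrow> 'b::euclidean_space" and g :: "'a \<Rightarrow> 'c::euclidean_space"
  assumes "Cinf_on f U" "Cinf_on g U"
  shows "Cinf_on (\<lambda>x. (f x, g x)) U"
proof -
  have l: "bounded_linear (\<lambda>a::'b. (a, 0::'c))" "bounded_linear (\<lambda>b::'c. (0::'b, b))"
    by (auto intro!: bounded_linear_Pair bounded_linear_ident bounded_linear_zero)
  have "Cinf_on (\<lambda>x. (f x, 0::'c) + (0::'b, g x)) U"
    by (intro Cinf_on_add Cinf_on_linear_image[OF l(1)] Cinf_on_linear_image[OF l(2)] assms)
  then show ?thesis by simp
qed

lemmas Cinf_on_fst = Cinf_on_linear_image[OF bounded_linear_fst]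
lemmas Cinf_on_snd = Cinf_on_linear_image[OF bounded_linear_snd]
lemmas Cinf_on_Re = Cinf_on_linear_image[OF bounded_linear_Re]
lemmas Cinf_on_Im = Cinf_on_linear_image[OF bounded_linear_Im]
lemmas Cinf_on_of_real = Cinf_on_linear_image[OF bounded_linear_of_real]

lemma Cinf_on_Complex:
  assumes "Cinf_on f U" "Cinf_on g U"
  shows "Cinf_on (\<lambda>x. Complex (f x) (g x)) U"
proof -
  have "Cinf_on (\<lambda>x. of_real (f x) + \<i> * of_real (g x)) U"
    by (intro Cinf_on_add Cinf_on_mult Cinf_on_of_real Cinf_on_const assms Cinf_on_open[OF assms(1)])
  then show ?thesis by (simp add: Complex_eq)
qed

lemma Cinf_on_vec_nth:
  "Cinf_on f U \<Longrightarrow> Cinf_on (\<lambda>x. (f x :: real^'n) $ i) U"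
  by (rule Cinf_on_linear_image[OF bounded_linear_vec_nth])

lemma Cinf_on_vec_lambda:
  fixes f :: "'n::finite \<Rightarrow> 'a::euclidean_space \<Rightarrow> real"
  assumes "open U" "\<And>i. Cinf_on (f i) U"
  shows "Cinf_on (\<lambda>x. \<chi> i. f i x) U"
proof -
  have "(\<chi> i. f i x) = (\<Sum>i\<in>UNIV. f i x *\<^sub>R axis i 1)" for x
    by (simp add: vec_eq_iff axis_def if_distrib cong: if_cong)
  then show ?thesis
    by (auto intro!: Cinf_on_sum Cinf_on_scaleR Cinf_on_const assms)
qed

lemma Cinf_on_power: "Cinf_on (f :: 'a::euclidean_space \<Rightarrow> real) U \<Longrightarrow> Cinf_on (\<lambda>x. f x ^ n) U"
  by (induction n) (auto intro: Cinf_on_mult Cinf_on_const Cinf_on_open)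

lemma Cinf_on_imp_differentiable: "Cinf_on f U \<Longrightarrow> x \<in> U \<Longrightarrow> f differentiable at x"
  unfolding Cinf_on_def by (metis Ck_on.simps(2))

lemma Cinf_on_imp_continuous_on: "Cinf_on f U \<Longrightarrow> continuous_on U f"
  unfolding Cinf_on_def by (metis Ck_on.simps(1))

lemma Cinf_on_frechet_derivative:
  "Cinf_on f U \<Longrightarrow> Cinf_on (\<lambda>x. frechet_derivative f (at x) v) U"
  unfolding Cinf_on_def by (metis Ck_on.simps(2))

subsection \<open>Functions of one variable\<close>

lemma Ck_on_SucI_field:
  fixes f :: "'a::{real_normed_field,euclidean_space} \<Rightarrow> 'a"
  assumes "open U" "\<And>x. x \<in> U \<Longrightarrow> (f has_field_derivative f' x) (at x)" "Ck_on k f' U"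
  shows "Ck_on (Suc k) f U"
proof (rule Ck_on_SucI[OF assms(1)])
  show "(f has_derivative (\<lambda>v. f' x * v)) (at x)" if "x \<in> U" for x
    using assms(2)[OF that] by (simp add: has_field_derivative_def)
qed (intro Ck_on_bilinear[OF bounded_bilinear_mult] assms Ck_on_const)

lemma Cinf_on_field_inverse: "Cinf_on (inverse :: 'a::{real_normed_field,euclidean_space} \<Rightarrow> 'a) (- {0})"
proof -
  have "Ck_on k (inverse :: 'a \<Rightarrow> 'a) (- {0})" for k
  proof (induction k)
    case 0
    show ?case by (auto intro!: continuous_intros)
  next
    case (Suc k)
    have "Ck_on k (\<lambda>x::'a. (- 1) * (inverse x * inverse x)) (- {0})"
      by (intro Ck_on_bilinear[OF bounded_bilinear_mult] Ck_on_const Suc) auto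
    then show ?case
      by (rule Ck_on_SucI_field[rotated 2])
        (auto intro!: derivative_eq_intros simp: power2_eq_square)
  qed
  then show ?thesis by (simp add: Cinf_on_def open_delete Compl_eq_Diff_UNIV)
qed

lemma Cinf_on_inverse:
  fixes f :: "'b::euclidean_space \<Rightarrow> 'a::{real_normed_field,euclidean_space}"
  shows "Cinf_on f U \<Longrightarrow> (\<And>x. x \<in> U \<Longrightarrow> f x \<noteq> 0) \<Longrightarrow> Cinf_on (\<lambda>x. inverse (f x)) U"
  by (rule Cinf_on_compose[OF _ Cinf_on_field_inverse]) auto

lemma Cinf_on_divide:
  fixes f :: "'b::euclidean_space \<Rightarrow> 'a::{real_normed_field,euclidean_space}"
  shows "Cinf_on f U \<Longrightarrow> Cinf_on g U \<Longrightarrow> (\<And>x. x \<in> U \<Longrightarrow> g x \<noteq> 0) \<Longrightarrow> Cinf_on (\<lambda>x. f x / g x) U"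
  unfolding divide_inverse by (intro Cinf_on_mult Cinf_on_inverse)

lemma Cinf_on_cos_sin: "Cinf_on (cos :: real \<Rightarrow> real) UNIV" "Cinf_on (sin :: real \<Rightarrow> real) UNIV"
proof -
  have "Ck_on k (cos :: real \<Rightarrow> real) UNIV \<and> Ck_on k (sin :: real \<Rightarrow> real) UNIV" for k
  proof (induction k)
    case 0
    show ?case by (auto intro!: continuous_intros)
  next
    case (Suc k)
    have "Ck_on k (\<lambda>x::real. (- 1) * sin x) UNIV"
      using Suc by (intro Ck_on_bilinear[OF bounded_bilinear_mult] Ck_on_const) auto
    then have "Ck_on (Suc k) (cos :: real \<Rightarrow> real) UNIV"
      by (rule Ck_on_SucI_field[rotated 2]) (auto intro!: derivative_eq_intros)
    moreover have "Ck_on (Suc k) (sin :: real \<Rightarrow> real) UNIV"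
      by (rule Ck_on_SucI_field[where f'=cos])
        (use Suc in \<open>auto intro!: derivative_eq_intros\<close>)
    ultimately show ?case ..
  qed
  then show "Cinf_on (cos :: real \<Rightarrow> real) UNIV" "Cinf_on (sin :: real \<Rightarrow> real) UNIV"
    by (auto simp: Cinf_on_def)
qed

lemma Cinf_on_cos: "Cinf_on f U \<Longrightarrow> Cinf_on (\<lambda>x. cos (f x :: real)) U"
  and Cinf_on_sin: "Cinf_on f U \<Longrightarrow> Cinf_on (\<lambda>x. sin (f x :: real)) U"
  using Cinf_on_compose[OF _ Cinf_on_cos_sin(1)] Cinf_on_compose[OF _ Cinf_on_cos_sin(2)] by auto

lemma Cinf_on_cis: "Cinf_on f U \<Longrightarrow> Cinf_on (\<lambda>x. cis (f x)) U"
  unfolding cis.code by (intro Cinf_on_Complex Cinf_on_cos Cinf_on_sin)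

lemma Cinf_on_real_sqrt: "Cinf_on sqrt {0<..}"
proof -
  have "Ck_on k sqrt {0<..}" for k
  proof (induction k)
    case 0
    show ?case by (auto intro!: continuous_intros)
  next
    case (Suc k)
    have inv: "Ck_on k (\<lambda>x. inverse (sqrt x)) {0<..}"
      by (rule Ck_on_compose[where V="- {0}"])
        (use Suc Cinf_on_field_inverse[where 'a=real] in \<open>auto simp: Cinf_on_def\<close>)
    then have "Ck_on k (\<lambda>x. inverse (sqrt x) * (1 / 2)) {0<..}"
      by (intro Ck_on_bilinear[OF bounded_bilinear_mult] Ck_on_const) auto
    then show ?case
      by (rule Ck_on_SucI_field[rotated 2]) (auto intro!: derivative_eq_intros simp: field_simps)
  qed
  then show ?thesis by (simp add: Cinf_on_def)
qed

lemma Cinf_on_sqrt: "Cinf_on f U \<Longrightarrow> (\<And>x. x \<in> U \<Longrightarrow> f x > 0) \<Longrightarrow> Cinf_on (\<lambda>x. sqrt (f x)) U"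
  by (rule Cinf_on_compose[OF _ Cinf_on_real_sqrt]) auto

lemma Cinf_on_norm:
  fixes f :: "'a::euclidean_space \<Rightarrow> 'b::euclidean_space"
  shows "Cinf_on f U \<Longrightarrow> (\<And>x. x \<in> U \<Longrightarrow> f x \<noteq> 0) \<Longrightarrow> Cinf_on (\<lambda>x. norm (f x)) U"
  unfolding norm_eq_sqrt_inner by (intro Cinf_on_sqrt Cinf_on_inner) auto

text \<open>Branches of \<open>Ln\<close> provide the smooth local angle coordinates on the solid
  torus.\<close>

lemma Cinf_on_complex_Ln: "Cinf_on Ln (- \<real>\<^sub>\<le>\<^sub>0)"
proof -
  have op: "open (- \<real>\<^sub>\<le>\<^sub>0 :: complex set)" by auto
  have "Ck_on k Ln (- \<real>\<^sub>\<le>\<^sub>0)" for k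
  proof (cases k)
    case 0
    then show ?thesis by (auto intro!: continuous_intros)
  next
    case (Suc j)
    show ?thesis unfolding Suc
    proof (rule Ck_on_SucI_field[where f'=inverse, OF op])
      show "Ck_on j inverse (- \<real>\<^sub>\<le>\<^sub>0 :: complex set)"
        by (rule Ck_on_subset[of _ _ "- {0}"])
          (use Cinf_on_field_inverse[where 'a=complex] in \<open>auto simp: Cinf_on_def\<close>)
      show "(Ln has_field_derivative inverse x) (at x)" if "x \<in> - \<real>\<^sub>\<le>\<^sub>0" for x
        using that by (intro has_field_derivative_Ln) auto
    qed
  qed
  then show ?thesis using op by (simp add: Cinf_on_def)
qed

text \<open>With \<open>y = 1 / t\<close>, the functions \<open>poly P y * exp (- y)\<close> are
  closed under differentiation, since \<open>P\<close> becomes \<open>y\<^sup>2 * (P - P')\<close>;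
  their decay for large \<open>y\<close> supplies the derivative at 0. Induction over all
  \<open>P\<close> at once then gives the smoothness of \<open>flat_exp\<close>.\<close>

lemma flat_exp_derivative_family:
  "((\<lambda>t::real. if t > 0 then poly P (1 / t) * exp (- 1 / t) else 0) has_field_derivative
     (if t > 0 then poly (monom 1 2 * (P - pderiv P)) (1 / t) * exp (- 1 / t) else 0)) (at t)"
  (is "(?F P has_field_derivative ?F ?Q t) (at t)")
proof -
  consider "t > 0" | "t < 0" | "t = 0" by linarith
  then show ?thesis
  proof cases
    case 1
    have "((\<lambda>t. poly P (1 / t) * exp (- 1 / t)) has_field_derivative
        poly ?Q (1 / t) * exp (- 1 / t)) (at t)"
      using 1
      by (auto intro!: derivative_eq_intros poly_DERIV[THEN DERIV_chain2]
          simp: poly_monom power2_eq_square field_simps)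
    then have "(?F P has_field_derivative poly ?Q (1 / t) * exp (- 1 / t)) (at t)"
      by (rule has_field_derivative_transform_within_open[where S="{0<..}"]) (use 1 in auto)
    then show ?thesis using 1 by simp
  next
    case 2
    have "(?F P has_field_derivative 0) (at t)"
      by (rule has_field_derivative_transform_within_open[where S="{..<0}" and f="\<lambda>t. 0"]) (use 2 in auto)
    then show ?thesis using 2 by simp
  next
    case 3
    have lim: "((\<lambda>y. poly R y * exp (- y)) \<longlongrightarrow> 0) at_top" for R :: "real poly"
    proof -
      have "((\<lambda>y. \<Sum>i\<le>degree R. coeff R i * (y ^ i / exp y)) \<longlongrightarrow> (\<Sum>i\<le>degree R. coeff R i * 0)) at_top"
        by (intro tendsto_sum tendsto_mult tendsto_const tendsto_power_div_exp_0)
      then show ?thesis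
        by (simp add: poly_altdef sum_distrib_right exp_minus divide_inverse mult.assoc)
    qed
    \<comment> \<open>\<open>pCons 0 P\<close> is \<open>y * P\<close>: the factor
      \<open>1 / h\<close> of the difference quotient is absorbed into the polynomial.\<close>
    have r: "((\<lambda>h. poly (pCons 0 P) (1 / h) * exp (- (1 / h))) \<longlongrightarrow> 0) (at_right 0)"
      by (rule filterlim_compose[OF lim]) (simp add: divide_inverse filterlim_inverse_at_top_right)
    have "((\<lambda>h. (?F P (0 + h) - ?F P 0) / h) \<longlongrightarrow> 0) (at 0)"
    proof (rule filterlim_split_at)
      show "((\<lambda>h. (?F P (0 + h) - ?F P 0) / h) \<longlongrightarrow> 0) (at_left 0)"
        by (rule Lim_transform_eventually[OF tendsto_const])
          (auto simp: eventually_at_filter)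
      show "((\<lambda>h. (?F P (0 + h) - ?F P 0) / h) \<longlongrightarrow> 0) (at_right 0)"
        by (rule Lim_transform_eventually[OF r]) (auto simp: eventually_at_filter field_simps)
    qed
    then show ?thesis using 3 by (simp add: DERIV_def)
  qed
qed

lemma Cinf_on_flat_exp: "Cinf_on flat_exp UNIV"
proof -
  let ?F = "\<lambda>P t::real. if t > 0 then poly P (1 / t) * exp (- 1 / t) else 0"
  have "Ck_on k (?F P) UNIV" for k P
  proof (induction k arbitrary: P)
    case 0
    have "isCont (?F P) t" for t
      using flat_exp_derivative_family DERIV_isCont by blast
    then show ?case
      by (simp only: Ck_on.simps) (auto intro: continuous_at_imp_continuous_on)
  next
    case (Suc k)
    show ?case
      by (rule Ck_on_SucI_field[OF open_UNIV flat_exp_derivative_family]) (rule Suc)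
  qed
  from this[of _ "[:1:]"] have "Cinf_on (?F [:1:]) UNIV"
    by (simp add: Cinf_on_def)
  then show ?thesis
    by (rule Cinf_on_cong) (simp add: flat_exp_def)
qed

lemma flat_exp_nonneg: "0 \<le> flat_exp t"
  by (simp add: flat_exp_def)

lemma flat_exp_pos_iff: "0 < flat_exp t \<longleftrightarrow> 0 < t"
  by (simp add: flat_exp_def)

lemma flat_exp_mono: "s \<le> t \<Longrightarrow> flat_exp s \<le> flat_exp t"
  by (auto simp: flat_exp_def field_simps)

lemma smooth_step_denominator_pos: "flat_exp t + flat_exp (1 - t) > 0"
  using flat_exp_nonneg[of t] flat_exp_nonneg[of "1 - t"] flat_exp_pos_iff[of t] flat_exp_pos_iff[of "1 - t"]
  by linarith

lemma smooth_step_eq_0: "t \<le> 0 \<Longrightarrow> smooth_step t = 0"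
  by (simp add: smooth_step_def flat_exp_def)

lemma smooth_step_eq_1: "t \<ge> 1 \<Longrightarrow> smooth_step t = 1"
  by (simp add: smooth_step_def flat_exp_def)

lemma smooth_step_nonneg: "0 \<le> smooth_step t"
  using smooth_step_denominator_pos[of t] flat_exp_nonneg[of t] by (simp add: smooth_step_def)

lemma smooth_step_le_1: "smooth_step t \<le> 1"
  using smooth_step_denominator_pos[of t] flat_exp_nonneg[of "1 - t"] by (simp add: smooth_step_def)

text \<open>The two summands of the denominator change places. This is the source of every time
  reversal symmetry below: a crossing run backwards has the same profile.\<close>

lemma smooth_step_reflect: "smooth_step (1 - t) = 1 - smooth_step t"
  using smooth_step_denominator_pos[of t] by (simp add: smooth_step_def field_simps)

lemma smooth_step_mono:
  assumes "s \<le> t" shows "smooth_step s \<le> smooth_step t"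
proof -
  have "flat_exp s * flat_exp (1 - t) \<le> flat_exp t * flat_exp (1 - s)"
    using assms by (intro mult_mono flat_exp_mono flat_exp_nonneg) auto
  then show ?thesis
    using smooth_step_denominator_pos[of s] smooth_step_denominator_pos[of t]
    by (simp add: smooth_step_def frac_le_eq divide_le_0_iff) (simp add: field_simps)
qed

lemma Cinf_on_smooth_step_UNIV: "Cinf_on smooth_step UNIV"
proof -
  have f: "Cinf_on (\<lambda>t. flat_exp t) UNIV" by (rule Cinf_on_flat_exp)
  have g: "Cinf_on (\<lambda>t. flat_exp (1 - t)) UNIV"
    by (rule Cinf_on_compose[OF _ Cinf_on_flat_exp])
      (auto intro!: Cinf_on_diff Cinf_on_const Cinf_on_ident)
  show ?thesis
    unfolding smooth_step_def[abs_def]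
    by (intro Cinf_on_divide Cinf_on_add f g) (metis less_irrefl smooth_step_denominator_pos)
qed

lemma Cinf_on_smooth_step: "Cinf_on f U \<Longrightarrow> Cinf_on (\<lambda>x. smooth_step (f x)) U"
  using Cinf_on_compose[OF _ Cinf_on_smooth_step_UNIV] by auto

lemmas Cinf_on_intros = Cinf_on_const Cinf_on_ident Cinf_on_mult Cinf_on_scaleR Cinf_on_inner
  Cinf_on_add Cinf_on_sum Cinf_on_minus Cinf_on_diff Cinf_on_Pair Cinf_on_fst Cinf_on_snd
  Cinf_on_Re Cinf_on_Im Cinf_on_of_real Cinf_on_Complex Cinf_on_vec_nth Cinf_on_vec_lambda
  Cinf_on_power Cinf_on_inverse Cinf_on_divide Cinf_on_cos Cinf_on_sin Cinf_on_cis Cinf_on_sqrt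
  Cinf_on_norm Cinf_on_smooth_step

subsection \<open>Implicit functions and shears\<close>

text \<open>The linear approximation of \<open>F\<close> along the graph reads
  \<open>s * a + D (0, v) = o(s, v)\<close>. A crude use of it bounds \<open>s\<close> by a multiple
  of \<open>v\<close>; a second use then turns the error into \<open>o(v)\<close>.\<close>

lemma implicit_has_derivative:
  fixes F :: "real \<times> 'a::euclidean_space \<Rightarrow> real"
  assumes F: "(F has_derivative D) (at (\<psi> w, w))" and a: "D (1, 0) \<noteq> 0"
    and V: "open V" "w \<in> V" and cont: "continuous_on V \<psi>"
    and eq: "\<And>w'. w' \<in> V \<Longrightarrow> F (\<psi> w', w') = 0"
  shows "(\<psi> has_derivative (\<lambda>v. - D (0, v) / D (1, 0))) (at w)"
  unfolding has_derivative_at_alt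
proof (intro conjI allI impI)
  have bl: "bounded_linear D" using F has_derivative_bounded_linear by blast
  have "bounded_linear (\<lambda>v. D (0, v))"
    by (intro bounded_linear_compose[OF bl] bounded_linear_Pair bounded_linear_zero bounded_linear_ident)
  then have "bounded_linear (\<lambda>v. (- 1 / D (1, 0)) * D (0, v))"
    by (rule bounded_linear_const_mult)
  then show "bounded_linear (\<lambda>v. - D (0, v) / D (1, 0))" by simp
  have D0: "bounded_linear (\<lambda>v. D (0, v))" by fact
  obtain M where M: "M > 0" "\<And>v. norm (D (0, v)) \<le> norm v * M"
    using bounded_linear.pos_bounded[OF D0] by blast
  define a where "a = D (1, 0)"
  have a0: "a \<noteq> 0" using a by (simp add: a_def)
  have Ds: "D (s, v) = s * a + D (0, v)" for s v
  proof -
    have "D (s, v) = D (s *\<^sub>R (1, 0) + (0, v))" by simp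
    also have "\<dots> = s *\<^sub>R D (1, 0) + D (0, v)"
      using bl by (simp only: linear_simps)
    finally show ?thesis by (simp add: a_def)
  qed
  fix e :: real assume e: "e > 0"
  \<comment> \<open>\<open>C\<close> is the crude Lipschitz constant. The first bound in
    \<open>\<eta>\<close> lets half of |s| * |a| be absorbed on the left; the second leaves the
    error \<open>e\<close> once |s| is replaced by \<open>C * norm v\<close>.\<close>
  define C where "C = 2 * (M + \<bar>a\<bar>) / \<bar>a\<bar>"
  have C: "C > 0" using M a0 by (auto simp: C_def intro!: divide_pos_pos)
  define \<eta> where "\<eta> = min (\<bar>a\<bar> / 2) (e * \<bar>a\<bar> / (C + 1))"
  have \<eta>: "\<eta> > 0" using a0 C e by (auto simp: \<eta>_def)
  have \<eta>2: "\<eta> \<le> \<bar>a\<bar> / 2" unfolding \<eta>_def by (rule min.cobounded1)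
  obtain d where d: "d > 0" and dF: "\<And>y. norm (y - (\<psi> w, w)) < d \<Longrightarrow>
      norm (F y - F (\<psi> w, w) - D (y - (\<psi> w, w))) \<le> \<eta> * norm (y - (\<psi> w, w))"
    using F \<eta> unfolding has_derivative_at_alt by blast
  have "continuous (at w) \<psi>"
    using cont V continuous_on_eq_continuous_at by blast
  then obtain d1 where d1: "d1 > 0" "\<And>w'. dist w' w < d1 \<Longrightarrow> dist (\<psi> w') (\<psi> w) < d / 2"
    using d unfolding continuous_at_eps_delta by (metis half_gt_zero)
  obtain d2 where d2: "d2 > 0" "\<And>w'. dist w' w < d2 \<Longrightarrow> w' \<in> V"
    using V open_dist by metis
  show "\<exists>d>0. \<forall>y. norm (y - w) < d \<longrightarrow>
      norm (\<psi> y - \<psi> w - - D (0, y - w) / D (1, 0)) \<le> e * norm (y - w)"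
  proof (intro exI[of _ "min d1 (min d2 (d / 2))"] conjI allI impI)
    show "0 < min d1 (min d2 (d / 2))" using d d1 d2 by simp
    fix y assume y: "norm (y - w) < min d1 (min d2 (d / 2))"
    define s where "s = \<psi> y - \<psi> w"
    define v where "v = y - w"
    have s: "\<bar>s\<bar> < d / 2" using d1(2)[of y] y by (simp add: dist_norm s_def)
    have n: "norm (s, v) \<le> \<bar>s\<bar> + norm v" using norm_Pair_le[of s v] by simp
    have "norm ((\<psi> y, y) - (\<psi> w, w)) < d"
      using n s y by (simp add: s_def[symmetric] v_def[symmetric])
    from dF[OF this] have "norm (s * a + D (0, v)) \<le> \<eta> * norm (s, v)"
      using eq[of y] eq[OF V(2)] d2(2)[of y] y
      by (simp add: s_def[symmetric] v_def[symmetric] dist_norm Ds[of s v])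
    also have "\<dots> \<le> \<eta> * (\<bar>s\<bar> + norm v)" using n \<eta> by (simp add: mult_left_mono)
    finally have main: "\<bar>s * a + D (0, v)\<bar> \<le> \<eta> * (\<bar>s\<bar> + norm v)" by simp
    have av: "\<bar>a\<bar> * norm v \<ge> 0" by simp
    have "\<bar>s\<bar> * \<bar>a\<bar> \<le> \<bar>s * a + D (0, v)\<bar> + \<bar>D (0, v)\<bar>"
      by (simp add: abs_mult[symmetric])
    also have "\<dots> \<le> (\<bar>a\<bar> / 2) * (\<bar>s\<bar> + norm v) + norm v * M"
      using M(2)[of v] \<eta>2 by (intro add_mono order_trans[OF main] mult_right_mono) auto
    also have "\<dots> = (\<bar>s\<bar> * \<bar>a\<bar>) / 2 + (\<bar>a\<bar> * norm v) / 2 + M * norm v"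
      by (simp add: field_simps)
    finally have "\<bar>s\<bar> * \<bar>a\<bar> \<le> 2 * (M * norm v) + 2 * (\<bar>a\<bar> * norm v)"
      using av by linarith
    then have "\<bar>s\<bar> * \<bar>a\<bar> \<le> 2 * (M + \<bar>a\<bar>) * norm v"
      by (simp add: algebra_simps)
    then have sC: "\<bar>s\<bar> \<le> C * norm v" using a0 by (simp add: C_def field_simps)
    have "\<bar>s + D (0, v) / a\<bar> * \<bar>a\<bar> = \<bar>s * a + D (0, v)\<bar>"
      using a0 by (simp add: abs_mult[symmetric] algebra_simps)
    also have "\<dots> \<le> \<eta> * ((C + 1) * norm v)"
      using sC \<eta> by (intro order_trans[OF main] mult_left_mono) (auto simp: distrib_right)
    also have "\<dots> \<le> (e * \<bar>a\<bar> / (C + 1)) * ((C + 1) * norm v)"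
      using C by (intro mult_right_mono) (auto simp: \<eta>_def)
    also have "\<dots> = e * norm v * \<bar>a\<bar>" using C by simp
    finally have "\<bar>s + D (0, v) / a\<bar> \<le> e * norm v" using a0 by simp
    then show "norm (\<psi> y - \<psi> w - - D (0, y - w) / D (1, 0)) \<le> e * norm (y - w)"
      by (simp add: s_def v_def a_def)
  qed
qed

text \<open>Bootstrapping: the derivative of \<open>\<psi>\<close> is expressed through
  \<open>\<psi>\<close> itself and derivatives of \<open>F\<close>, so each order of
  differentiability gives the next. A continuous solution is left to the applications, which obtain
  it from monotonicity or from lifting to a covering.\<close>

lemma Cinf_on_implicit:
  fixes F :: "real \<times> 'a::euclidean_space \<Rightarrow> real"
  assumes F: "Cinf_on F W" and V: "open V" and cont: "continuous_on V \<psi>"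
    and W: "\<And>w. w \<in> V \<Longrightarrow> (\<psi> w, w) \<in> W"
    and eq: "\<And>w. w \<in> V \<Longrightarrow> F (\<psi> w, w) = 0"
    and nz: "\<And>w. w \<in> V \<Longrightarrow> frechet_derivative F (at (\<psi> w, w)) (1, 0) \<noteq> 0"
  shows "Cinf_on \<psi> V"
proof -
  let ?D = "\<lambda>x. frechet_derivative F (at x)"
  have "Ck_on k \<psi> V" for k
  proof (induction k)
    case 0
    show ?case using cont by simp
  next
    case (Suc k)
    have graph: "Ck_on k (\<lambda>w. (\<psi> w, w)) V"
    proof -
      have l: "bounded_linear (\<lambda>a::real. (a, 0::'a))" "bounded_linear (\<lambda>b::'a. (0::real, b))"
        by (auto intro!: bounded_linear_Pair bounded_linear_ident bounded_linear_zero)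
      have "Ck_on k (\<lambda>w. (\<psi> w, 0::'a) + (0::real, w)) V"
        by (intro Ck_on_add V Ck_on_bounded_linear l
            Ck_on_compose[where V=UNIV and g="\<lambda>a. (a, 0)"] Suc) auto
      then show ?thesis by simp
    qed
    have D: "Ck_on k (\<lambda>w. ?D (\<psi> w, w) u) V" for u
      by (rule Ck_on_compose[where g="\<lambda>x. ?D x u", OF V Cinf_on_open[OF F] _ graph])
        (use W Cinf_on_frechet_derivative[OF F] in \<open>auto simp: Cinf_on_def\<close>)
    have inv: "Ck_on k (\<lambda>w. inverse (?D (\<psi> w, w) (1, 0))) V"
      by (rule Ck_on_compose[where g=inverse and V="- {0}", OF V _ _ D])
        (use nz Cinf_on_field_inverse[where 'a=real] in \<open>auto simp: Cinf_on_def\<close>)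
    have "Ck_on k (\<lambda>w. - 1 * (?D (\<psi> w, w) (0, v) * inverse (?D (\<psi> w, w) (1, 0)))) V" for v
      by (intro Ck_on_bilinear[OF bounded_bilinear_mult] D inv V Ck_on_const)
    then have D': "Ck_on k (\<lambda>w. - ?D (\<psi> w, w) (0, v) / ?D (\<psi> w, w) (1, 0)) V" for v
      by (simp add: divide_inverse)
    show ?case
    proof (rule Ck_on_SucI[OF V _ D'])
      fix w assume w: "w \<in> V"
      have F': "(F has_derivative ?D (\<psi> w, w)) (at (\<psi> w, w))"
        using Cinf_on_imp_differentiable[OF F W[OF w]] by (simp add: frechet_derivative_works)
      show "(\<psi> has_derivative (\<lambda>v. - ?D (\<psi> w, w) (0, v) / ?D (\<psi> w, w) (1, 0))) (at w)"
        by (rule implicit_has_derivative[of F "?D (\<psi> w, w)" \<psi> w V]) (use F' nz w V cont eq in auto)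
    qed
  qed
  then show ?thesis by (simp add: Cinf_on_def V)
qed

text \<open>On every line in direction \<open>e\<close> the shear is strictly increasing at rate at
  least \<open>c\<close>, so its inverse is a shear along \<open>e\<close> as well, with
  \<open>\<psi> w\<close> the root of \<open>h w\<close>. Bounding increments instead of derivatives
  suits functions assembled from cut-offs and monotone pieces.\<close>

lemma shear_inverse:
  fixes \<phi> :: "'a::euclidean_space \<Rightarrow> real"
  assumes \<phi>: "Cinf_on \<phi> UNIV" and c: "c > 0"
    and slope: "\<And>w s. s \<ge> 0 \<Longrightarrow> \<phi> (w + s *\<^sub>R e) - \<phi> w \<ge> (c - 1) * s"
  obtains \<psi> where "Cinf_on \<psi> UNIV"
    "\<And>w. (w + \<psi> w *\<^sub>R e) + \<phi> (w + \<psi> w *\<^sub>R e) *\<^sub>R e = w"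
    "\<And>w. (w + \<phi> w *\<^sub>R e) + \<psi> (w + \<phi> w *\<^sub>R e) *\<^sub>R e = w"
proof -
  define h where "h w s = s + \<phi> (w + s *\<^sub>R e)" for w s
  have inc: "h w s' - h w s \<ge> c * (s' - s)" if "s \<le> s'" for w s s'
    using slope[of "s' - s" "w + s *\<^sub>R e"] that by (simp add: h_def algebra_simps)
  have strict: "h w s < h w s'" if "s < s'" for w s s'
    using inc[of s s' w] that c mult_pos_pos[of c "s' - s"] by linarith
  have cont\<phi>: "continuous_on UNIV \<phi>" by (rule Cinf_on_imp_continuous_on[OF \<phi>])
  have conth: "continuous_on UNIV (h w)" for w
    unfolding h_def by (intro continuous_intros continuous_on_compose2[OF cont\<phi>]) auto
  have conth': "continuous_on UNIV (\<lambda>w. h w s)" for s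
    unfolding h_def by (intro continuous_intros continuous_on_compose2[OF cont\<phi>]) auto
  have ex: "\<exists>s. h w s = 0" for w
  proof -
    \<comment> \<open>A slope of at least \<open>c\<close> forces a change of sign between
      \<open>- m\<close> and \<open>m\<close>.\<close>
    define m where "m = \<bar>h w 0\<bar> / c"
    have m: "m \<ge> 0" "c * m = \<bar>h w 0\<bar>" using c by (auto simp: m_def)
    have "h w (- m) \<le> 0" "0 \<le> h w m"
      using inc[of "- m" 0 w] inc[of 0 m w] m by auto
    then show ?thesis
      using IVT'[of "h w" "- m" 0 m] m conth[of w] continuous_on_subset by fastforce
  qed
  define \<psi> where "\<psi> w = (SOME s. h w s = 0)" for w
  have \<psi>: "h w (\<psi> w) = 0" for w unfolding \<psi>_def using ex by (rule someI_ex)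
  have uniq: "s = \<psi> w" if "h w s = 0" for s w
    using strict[of s "\<psi> w" w] strict[of "\<psi> w" s w] \<psi>[of w] that by force
  \<comment> \<open>As \<open>h w\<close> is increasing, comparing \<open>\<psi> w\<close> with
    \<open>a\<close> amounts to the sign of \<open>h w a\<close>, which is stable under small
    changes of \<open>w\<close>.\<close>
  have cont: "continuous_on UNIV \<psi>"
    unfolding continuous_on_def
  proof (intro ballI, rule order_tendstoI)
    fix w a assume "a < \<psi> w"
    then have "h w a < 0" using strict[of a "\<psi> w" w] \<psi> by simp
    then have "\<forall>\<^sub>F w' in at w. h w' a < 0"
      using conth'[of a] by (auto simp: continuous_on_def intro: order_tendstoD)
    then show "\<forall>\<^sub>F w' in at w. a < \<psi> w'"
      by eventually_elim (metis \<psi> strict linorder_neqE less_asym less_irrefl)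
  next
    fix w a assume "\<psi> w < a"
    then have "h w a > 0" using strict[of "\<psi> w" a w] \<psi> by simp
    then have "\<forall>\<^sub>F w' in at w. h w' a > 0"
      using conth'[of a] by (auto simp: continuous_on_def intro: order_tendstoD)
    then show "\<forall>\<^sub>F w' in at w. a > \<psi> w'"
      by eventually_elim (metis \<psi> strict linorder_neqE less_asym less_irrefl)
  qed
  define F where "F = (\<lambda>(s, w). h w s)"
  have F: "Cinf_on F UNIV"
    unfolding F_def h_def case_prod_beta
    by (intro Cinf_on_intros Cinf_on_compose[OF _ \<phi>]) auto
  \<comment> \<open>The increment bound becomes a bound on the partial derivative, because
    \<open>h w s - c * s\<close> is nondecreasing in \<open>s\<close>.\<close>
  have Dpos: "frechet_derivative F (at (s, w)) (1, 0) \<ge> c" for s w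
  proof -
    have "(F has_derivative frechet_derivative F (at (s, w))) (at (s, w))"
      using Cinf_on_imp_differentiable[OF F] by (simp add: frechet_derivative_works)
    moreover have "((\<lambda>s. (s, w)) has_derivative (\<lambda>v. (v, 0))) (at s)"
      by (auto intro!: derivative_eq_intros)
    ultimately have d: "(h w has_derivative (\<lambda>v. frechet_derivative F (at (s, w)) (v, 0))) (at s)"
      using diff_chain_at[of "\<lambda>s. (s, w)" "\<lambda>v. (v, 0)" s F] by (simp add: o_def F_def)
    then have lin: "linear (\<lambda>v. frechet_derivative F (at (s, w)) (v, 0))"
      using has_derivative_linear by blast
    have "(\<lambda>v. frechet_derivative F (at (s, w)) (v, 0)) = (*) (frechet_derivative F (at (s, w)) (1, 0))"
    proof
      fix v :: real
      show "frechet_derivative F (at (s, w)) (v, 0) = frechet_derivative F (at (s, w)) (1, 0) * v"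
        using linear_cmul[OF lin, of v 1] by simp
    qed
    with d have der: "(h w has_real_derivative frechet_derivative F (at (s, w)) (1, 0)) (at s)"
      by (simp only: has_field_derivative_def)
    have "((\<lambda>s. h w s - c * s) has_real_derivative frechet_derivative F (at (s, w)) (1, 0) - c) (at s)"
      by (rule derivative_eq_intros der refl | simp)+
    moreover have "mono_on UNIV (\<lambda>s. h w s - c * s)"
      using inc[of _ _ w] by (intro mono_onI) (fastforce simp: right_diff_distrib)
    ultimately have "frechet_derivative F (at (s, w)) (1, 0) - c \<ge> 0"
      by (intro mono_on_imp_deriv_nonneg) auto
    then show ?thesis by simp
  qed
  show ?thesis
  proof
    show "Cinf_on \<psi> UNIV"
    proof (rule Cinf_on_implicit[OF F open_UNIV cont])
      show "F (\<psi> w, w) = 0" for w using \<psi> by (simp add: F_def)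
      show "frechet_derivative F (at (\<psi> w, w)) (1, 0) \<noteq> 0" for w
        using Dpos[of "\<psi> w" w] c by linarith
    qed auto
    show "(w + \<psi> w *\<^sub>R e) + \<phi> (w + \<psi> w *\<^sub>R e) *\<^sub>R e = w" for w
    proof -
      have "\<psi> w + \<phi> (w + \<psi> w *\<^sub>R e) = 0" using \<psi>[of w] by (simp add: h_def)
      then show ?thesis by (metis add.assoc add.right_neutral scaleR_add_left scaleR_zero_left)
    qed
    show "(w + \<phi> w *\<^sub>R e) + \<psi> (w + \<phi> w *\<^sub>R e) *\<^sub>R e = w" for w
    proof -
      have "h (w + \<phi> w *\<^sub>R e) (- \<phi> w) = 0" by (simp add: h_def)
      then have "- \<phi> w = \<psi> (w + \<phi> w *\<^sub>R e)" by (rule uniq)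
      then show ?thesis by (simp add: algebra_simps flip: scaleR_add_left)
    qed
  qed
qed

section \<open>Diffeomorphisms of the three-sphere\<close>

lemma smooth_on_iff: "smooth_on S f \<longleftrightarrow> (\<exists>U g. S \<subseteq> U \<and> Cinf_on g U \<and> (\<forall>x\<in>S. g x = f x))"
  by (auto simp: smooth_on_def Cinf_on_def)

lemma smooth_onE:
  assumes "smooth_on S f"
  obtains U g where "S \<subseteq> U" "Cinf_on g U" "\<And>x. x \<in> S \<Longrightarrow> g x = f x"
  using assms by (auto simp: smooth_on_iff)

lemma smooth_on_UNIV: "smooth_on UNIV f \<longleftrightarrow> Cinf_on f UNIV"
proof
  assume "smooth_on UNIV f"
  then obtain g U where "UNIV \<subseteq> U" "Cinf_on g U" "\<And>x. g x = f x"
    by (auto simp: smooth_on_iff)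
  moreover from this have "g = f" "U = UNIV" by auto
  ultimately show "Cinf_on f UNIV" by simp
qed (auto simp: smooth_on_iff)

lemma smooth_on_compose:
  assumes "smooth_on S f" "smooth_on T g" "f ` S \<subseteq> T"
  shows "smooth_on S (g \<circ> f)"
proof -
  obtain U f1 where U: "S \<subseteq> U" "Cinf_on f1 U" "\<And>x. x \<in> S \<Longrightarrow> f1 x = f x"
    using smooth_onE[OF assms(1)] by metis
  obtain V g1 where V: "T \<subseteq> V" "Cinf_on g1 V" "\<And>x. x \<in> T \<Longrightarrow> g1 x = g x"
    using smooth_onE[OF assms(2)] by metis
  let ?W = "U \<inter> f1 -` V"
  have "open ?W"
    by (intro continuous_open_preimage Cinf_on_imp_continuous_on[OF U(2)] Cinf_on_open[OF U(2)]
        Cinf_on_open[OF V(2)])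
  then have "Cinf_on f1 ?W" by (rule Cinf_on_subset[OF U(2)]) auto
  then have "Cinf_on (\<lambda>x. g1 (f1 x)) ?W" by (rule Cinf_on_compose[OF _ V(2)]) auto
  moreover have "S \<subseteq> ?W" using U V assms(3) by (auto simp: image_subset_iff subset_iff)
  moreover have "g1 (f1 x) = (g \<circ> f) x" if "x \<in> S" for x
    using that U(3) V(3) assms(3) by auto
  ultimately show ?thesis unfolding smooth_on_iff by blast
qed

lemma smooth_on_cong: "smooth_on S f \<Longrightarrow> (\<And>x. x \<in> S \<Longrightarrow> f x = g x) \<Longrightarrow> smooth_on S g"
  by (fastforce simp: smooth_on_iff)

lemma smooth_on_imp_continuous_on:
  assumes "smooth_on S f" shows "continuous_on S f"
proof -
  obtain U g where U: "S \<subseteq> U" "Cinf_on g U" "\<And>x. x \<in> S \<Longrightarrow> g x = f x"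
    using smooth_onE[OF assms] by metis
  then have "continuous_on S g"
    using Cinf_on_imp_continuous_on continuous_on_subset by blast
  then show ?thesis using U(3) by (simp cong: continuous_on_cong)
qed

lemma S3_diffeoD:
  assumes "S3_diffeo f"
  shows "bij_betw f S3 S3" "smooth_on S3 f" "smooth_on S3 (inv_into S3 f)"
    "x \<in> S3 \<Longrightarrow> f x \<in> S3" "x \<in> S3 \<Longrightarrow> inv_into S3 f x \<in> S3"
    "x \<in> S3 \<Longrightarrow> inv_into S3 f (f x) = x" "x \<in> S3 \<Longrightarrow> f (inv_into S3 f x) = x"
proof -
  show b: "bij_betw f S3 S3" and "smooth_on S3 f" "smooth_on S3 (inv_into S3 f)"
    using assms by (auto simp: S3_diffeo_def)
  show "x \<in> S3 \<Longrightarrow> f x \<in> S3" using b bij_betwE by blast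
  show "x \<in> S3 \<Longrightarrow> inv_into S3 f x \<in> S3" using bij_betw_inv_into[OF b] bij_betwE by blast
  show "x \<in> S3 \<Longrightarrow> inv_into S3 f (f x) = x" by (rule bij_betw_inv_into_left[OF b])
  show "x \<in> S3 \<Longrightarrow> f (inv_into S3 f x) = x" by (rule bij_betw_inv_into_right[OF b])
qed

lemma S3_diffeoI:
  assumes "smooth_on S3 f" "smooth_on S3 g" "\<And>x. x \<in> S3 \<Longrightarrow> f x \<in> S3" "\<And>x. x \<in> S3 \<Longrightarrow> g x \<in> S3"
    and "\<And>x. x \<in> S3 \<Longrightarrow> g (f x) = x" "\<And>x. x \<in> S3 \<Longrightarrow> f (g x) = x"
  shows "S3_diffeo f"
proof -
  have b: "bij_betw f S3 S3" by (rule bij_betw_byWitness[where f'=g]) (use assms in auto)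
  have "inv_into S3 f x = g x" if "x \<in> S3" for x
    using bij_betw_inv_into_left[OF b, of "g x"] assms(4,6)[OF that] by simp
  then have "smooth_on S3 (inv_into S3 f)"
    using smooth_on_cong[OF assms(2)] by simp
  then show ?thesis using b assms(1) by (simp add: S3_diffeo_def)
qed

lemma S3_diffeo_inv_into:
  assumes "S3_diffeo f" shows "S3_diffeo (inv_into S3 f)"
  by (rule S3_diffeoI[where g=f]) (use S3_diffeoD[OF assms] in auto)

lemma S3_diffeo_compose:
  assumes "S3_diffeo f" "S3_diffeo g" shows "S3_diffeo (g \<circ> f)"
proof (rule S3_diffeoI[where g="inv_into S3 f \<circ> inv_into S3 g"])
  note f = S3_diffeoD[OF assms(1)] and g = S3_diffeoD[OF assms(2)]
  show "smooth_on S3 (g \<circ> f)"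
    by (rule smooth_on_compose[OF f(2) g(2)]) (use f in blast)
  show "smooth_on S3 (inv_into S3 f \<circ> inv_into S3 g)"
    by (rule smooth_on_compose[OF g(3) f(3)]) (use g in blast)
qed (use S3_diffeoD[OF assms(1)] S3_diffeoD[OF assms(2)] in auto)

subsection \<open>Orientation behaviour of conjugated linear maps\<close>

text \<open>Radial extension is homogeneous of degree one and so respects composition; this yields
  the chain rule for \<open>radial_det\<close>.\<close>

lemma radial_ext_compose:
  assumes "\<And>x. x \<in> S3 \<Longrightarrow> f x \<in> S3"
  shows "radial_ext (g \<circ> f) y = radial_ext g (radial_ext f y)"
proof (cases "y = 0")
  case False
  then have "f (y /\<^sub>R norm y) \<in> S3" by (intro assms) simp
  then show ?thesis using False
    by (simp add: radial_ext_def)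
qed (simp add: radial_ext_def)

lemma Cinf_on_radial_ext:
  assumes "smooth_on S3 f"
  shows "Cinf_on (radial_ext f) (- {0})"
proof -
  obtain U g where U: "S3 \<subseteq> U" "Cinf_on g U" "\<And>x. x \<in> S3 \<Longrightarrow> g x = f x"
    using smooth_onE[OF assms] by metis
  define W where "W = (- {0}) \<inter> (\<lambda>y::real^4. y /\<^sub>R norm y) -` U"
  have op: "open (- {0::real^4})" by auto
  have c: "Cinf_on (\<lambda>y::real^4. y /\<^sub>R norm y) (- {0})"
    by (intro Cinf_on_intros op) auto
  have "open W" unfolding W_def
    by (rule continuous_open_preimage[OF Cinf_on_imp_continuous_on[OF c] op Cinf_on_open[OF U(2)]])
  have "Cinf_on (\<lambda>y. norm y *\<^sub>R g (y /\<^sub>R norm y)) W"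
    by (intro Cinf_on_scaleR Cinf_on_norm Cinf_on_ident \<open>open W\<close>
        Cinf_on_compose[OF Cinf_on_subset[OF c \<open>open W\<close>] U(2)]) (auto simp: W_def)
  then have "Cinf_on (radial_ext f) W"
    by (rule Cinf_on_cong) (use U(3) in \<open>auto simp: W_def radial_ext_def\<close>)
  moreover have "y /\<^sub>R norm y \<in> U" if "y \<noteq> 0" for y :: "real^4"
    by (rule subsetD[OF U(1)]) (use that in simp)
  then have "W = - {0}" by (auto simp: W_def)
  ultimately show ?thesis by simp
qed

definition radial_det :: "(real^4 \<Rightarrow> real^4) \<Rightarrow> real^4 \<Rightarrow> real" where
  "radial_det f x = det (jacobian (radial_ext f) (at x))"

lemma radial_det_compose:
  assumes f: "smooth_on S3 f" "\<And>x. x \<in> S3 \<Longrightarrow> f x \<in> S3" and g: "smooth_on S3 g" and x: "x \<in> S3"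
  shows "radial_det (g \<circ> f) x = radial_det g (f x) * radial_det f x"
proof -
  have fx: "radial_ext f x = f x" using x by (simp add: radial_ext_def)
  have x0: "x \<noteq> 0" "f x \<noteq> 0" using x f(2)[OF x] by auto
  have df: "(radial_ext f has_derivative (*v) (jacobian (radial_ext f) (at x))) (at x)"
    using Cinf_on_imp_differentiable[OF Cinf_on_radial_ext[OF f(1)]] x0 jacobian_works by blast
  have dg: "(radial_ext g has_derivative (*v) (jacobian (radial_ext g) (at (f x)))) (at (radial_ext f x))"
    unfolding fx
    using Cinf_on_imp_differentiable[OF Cinf_on_radial_ext[OF g(1)]] x0 jacobian_works by blast
  have "(radial_ext (g \<circ> f) has_derivative
      (*v) (jacobian (radial_ext g) (at (f x)) ** jacobian (radial_ext f) (at x))) (at x)"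
  proof -
    have "radial_ext (g \<circ> f) = radial_ext g \<circ> radial_ext f"
      using radial_ext_compose[OF f(2)] by auto
    moreover have "(*v) (A ** B) = (*v) A \<circ> (*v) B" for A B :: "real^4^4"
      by (simp add: fun_eq_iff matrix_vector_mul_assoc)
    ultimately show ?thesis using diff_chain_at[OF df dg] by simp
  qed
  then have "frechet_derivative (radial_ext (g \<circ> f)) (at x) =
      (*v) (jacobian (radial_ext g) (at (f x)) ** jacobian (radial_ext f) (at x))"
    using frechet_derivative_at by metis
  then have "jacobian (radial_ext (g \<circ> f)) (at x) =
      jacobian (radial_ext g) (at (f x)) ** jacobian (radial_ext f) (at x)"
    by (simp add: jacobian_def)
  then show ?thesis by (simp add: radial_det_def det_mul)
qed

lemma radial_ext_linear:
  assumes "linear f" shows "radial_ext f = f"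
proof
  show "radial_ext f y = f y" for y
    by (cases "y = 0") (auto simp: radial_ext_def linear_cmul[OF assms] linear_0[OF assms])
qed

lemma radial_det_linear:
  assumes "linear f" shows "radial_det f x = det (matrix f)"
proof -
  have "(f has_derivative f) (at x)"
    using assms by (simp add: bounded_linear_imp_has_derivative linear_linear)
  then have "frechet_derivative f (at x) = f" using frechet_derivative_at by metis
  then show ?thesis by (simp add: radial_det_def radial_ext_linear[OF assms] jacobian_def)
qed

lemma radial_det_cong:
  assumes "\<And>x. x \<in> S3 \<Longrightarrow> f x = g x" shows "radial_det f = radial_det g"
proof -
  have "radial_ext f = radial_ext g"
  proof
    fix y show "radial_ext f y = radial_ext g y"
      using assms[of "y /\<^sub>R norm y"] by (cases "y = 0") (auto simp: radial_ext_def)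
  qed
  then show ?thesis by (intro ext) (simp add: radial_det_def)
qed

lemma continuous_on_radial_det:
  assumes "smooth_on S3 f" shows "continuous_on S3 (radial_det f)"
proof -
  have "continuous_on (- {0}) (\<lambda>x. frechet_derivative (radial_ext f) (at x) v $ i)" for v i
    by (rule Cinf_on_imp_continuous_on)
      (intro Cinf_on_vec_nth Cinf_on_frechet_derivative Cinf_on_radial_ext assms)
  then have c: "continuous_on S3 (\<lambda>x. frechet_derivative (radial_ext f) (at x) v $ i)" for v i
    by (rule continuous_on_subset) auto
  have "radial_det f = (\<lambda>x. \<Sum>p | p permutes (UNIV::4 set). of_int (sign p) *
      (\<Prod>i\<in>UNIV. frechet_derivative (radial_ext f) (at x) (axis (p i) 1) $ i))"
    by (intro ext) (simp add: radial_det_def jacobian_def matrix_def det_def)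
  then show ?thesis
    by (simp only:) (intro continuous_on_sum continuous_on_mult continuous_on_prod continuous_on_const c)
qed

text \<open>\<open>h\<close> may reverse the orientation, so only the product has a definite sign.
  The determinant of a diffeomorphism never vanishes and \<open>S3\<close> is connected, so its sign
  is the same at \<open>x\<close> and \<open>y\<close>; the inverse has the reciprocal determinant
  at \<open>h y\<close>.\<close>

lemma radial_det_diffeo_sign:
  assumes h: "S3_diffeo h" and xy: "x \<in> S3" "y \<in> S3"
  shows "radial_det h x * radial_det (inv_into S3 h) (h y) > 0"
proof -
  note hD = S3_diffeoD[OF h]
  have inv: "radial_det (inv_into S3 h) (h x) * radial_det h x = 1" if x: "x \<in> S3" for x
  proof -
    have "radial_det (inv_into S3 h \<circ> h) x = radial_det (inv_into S3 h) (h x) * radial_det h x"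
      by (rule radial_det_compose) (use hD x in auto)
    moreover have "radial_det (inv_into S3 h \<circ> h) = radial_det id"
      by (rule radial_det_cong) (use hD in auto)
    moreover have "radial_det id x = 1"
      using radial_det_linear[of id x] by (simp add: linear_id matrix_id)
    ultimately show ?thesis by simp
  qed
  have nz: "radial_det h z \<noteq> 0" if "z \<in> S3" for z using inv[OF that] by auto
  have conn: "connected (radial_det h ` S3)"
    by (intro connected_continuous_image continuous_on_radial_det hD connected_sphere) auto
  have same: "radial_det h x * radial_det h y > 0"
  proof (rule ccontr)
    assume "\<not> ?thesis"
    with nz[OF xy(1)] nz[OF xy(2)]
    have "radial_det h x < 0 \<and> radial_det h y > 0 \<or> radial_det h x > 0 \<and> radial_det h y < 0"
      by (auto simp: not_less mult_le_0_iff)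
    then have "0 \<in> radial_det h ` S3"
      using connectedD_interval[OF conn imageI[OF xy(1)] imageI[OF xy(2)], of 0]
        connectedD_interval[OF conn imageI[OF xy(2)] imageI[OF xy(1)], of 0] by linarith
    then show False using nz by auto
  qed
  have "radial_det (inv_into S3 h) (h y) = inverse (radial_det h y)"
    using inv[OF xy(2)] nz[OF xy(2)] by (simp add: field_simps)
  then show ?thesis
    using same by (auto simp: zero_less_mult_iff)
qed

text \<open>The chain rule leaves the determinants of \<open>h\<close> and of its inverse at
  unrelated points; by \<open>radial_det_diffeo_sign\<close> their product is still positive, so the
  sign of \<open>det (matrix l)\<close> decides.\<close>

lemma radial_det_conjugate:
  assumes h: "S3_diffeo h" and l: "linear l" "\<And>x. x \<in> S3 \<Longrightarrow> l x \<in> S3" and x: "x \<in> S3"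
  shows "\<exists>c>0. radial_det (h \<circ> l \<circ> inv_into S3 h) x = c * det (matrix l)"
proof -
  note hD = S3_diffeoD[OF h]
  let ?k = "inv_into S3 h"
  have sl: "smooth_on S3 l"
    using Cinf_on_bounded_linear[of l UNIV] l(1) by (auto simp: smooth_on_iff linear_linear)
  have lk: "smooth_on S3 (l \<circ> ?k)"
    by (rule smooth_on_compose[OF hD(3) sl]) (use hD in blast)
  have 1: "radial_det (h \<circ> (l \<circ> ?k)) x = radial_det h ((l \<circ> ?k) x) * radial_det (l \<circ> ?k) x"
    by (rule radial_det_compose) (use hD lk l x in auto)
  have 2: "radial_det (l \<circ> ?k) x = radial_det l (?k x) * radial_det ?k x"
    by (rule radial_det_compose) (use hD sl l x in auto)
  have "radial_det (h \<circ> l \<circ> ?k) x =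
      (radial_det h (l (?k x)) * radial_det ?k x) * det (matrix l)"
    unfolding o_assoc[symmetric] 1 2 radial_det_linear[OF l(1)] by (simp only: o_apply mult_ac)
  moreover have "radial_det h (l (?k x)) * radial_det ?k x > 0"
    using radial_det_diffeo_sign[OF h, of "l (?k x)" "?k x"] hD l x by auto
  ultimately show ?thesis by blast
qed

lemma conjugate_orientation:
  assumes h: "S3_diffeo h" and l: "linear l" "\<And>x. x \<in> S3 \<Longrightarrow> l x \<in> S3"
  shows "det (matrix l) > 0 \<Longrightarrow> orientation_preserving (h \<circ> l \<circ> inv_into S3 h)"
    and "det (matrix l) < 0 \<Longrightarrow> orientation_reversing (h \<circ> l \<circ> inv_into S3 h)"
proof -
  assume d: "det (matrix l) > 0"
  show "orientation_preserving (h \<circ> l \<circ> inv_into S3 h)"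
    unfolding orientation_preserving_def radial_det_def[symmetric]
  proof
    fix x :: "real^4" assume "x \<in> S3"
    then show "radial_det (h \<circ> l \<circ> inv_into S3 h) x > 0"
      using radial_det_conjugate[OF h l, of x] d by auto
  qed
next
  assume d: "det (matrix l) < 0"
  show "orientation_reversing (h \<circ> l \<circ> inv_into S3 h)"
    unfolding orientation_reversing_def radial_det_def[symmetric]
  proof
    fix x :: "real^4" assume "x \<in> S3"
    then show "radial_det (h \<circ> l \<circ> inv_into S3 h) x < 0"
      using radial_det_conjugate[OF h l, of x] d by (auto simp: mult_pos_neg)
  qed
qed

lemma conjugate_involution:
  assumes h: "S3_diffeo h" and l: "linear l" "\<And>x. x \<in> S3 \<Longrightarrow> l x \<in> S3" "\<And>x. l (l x) = x"
  shows "S3_involution (h \<circ> l \<circ> inv_into S3 h)"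
proof -
  note hD = S3_diffeoD[OF h]
  have sl: "smooth_on S3 l"
    using Cinf_on_bounded_linear[of l UNIV] l(1) by (auto simp: smooth_on_iff linear_linear)
  have hl: "smooth_on S3 (h \<circ> l)" by (rule smooth_on_compose[OF sl hD(2)]) (use l in blast)
  have "smooth_on S3 (h \<circ> l \<circ> inv_into S3 h)"
    by (rule smooth_on_compose[OF hD(3) hl]) (use hD in blast)
  then show ?thesis unfolding S3_involution_def using hD l by auto
qed

lemma fixed_set_conjugate:
  assumes h: "S3_diffeo h" and l: "\<And>x. x \<in> S3 \<Longrightarrow> l x \<in> S3"
  shows "fixed_set (h \<circ> l \<circ> inv_into S3 h) = h ` fixed_set l"
proof -
  note hD = S3_diffeoD[OF h]
  have "h (l (inv_into S3 h x)) = x \<longleftrightarrow> l (inv_into S3 h x) = inv_into S3 h x" if "x \<in> S3" for x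
    using hD that l by metis
  note iff = this
  show ?thesis
  proof (intro equalityI subsetI)
    fix x assume "x \<in> fixed_set (h \<circ> l \<circ> inv_into S3 h)"
    then have "x \<in> S3" "h (inv_into S3 h x) = x" "inv_into S3 h x \<in> fixed_set l"
      using iff[of x] hD(5,7)[of x] by (auto simp: fixed_set_def)
    then show "x \<in> h ` fixed_set l" by (metis image_eqI)
  next
    fix x assume "x \<in> h ` fixed_set l"
    then obtain y where y: "y \<in> S3" "l y = y" "x = h y" by (auto simp: fixed_set_def)
    then show "x \<in> fixed_set (h \<circ> l \<circ> inv_into S3 h)"
      using hD(4,6)[of y] by (simp add: fixed_set_def)
  qed
qed

lemma S3_diffeo_image_homeomorphic:
  assumes h: "S3_diffeo h" and A: "A \<subseteq> S3"
  shows "h ` A homeomorphic A"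
proof -
  note hD = S3_diffeoD[OF h]
  have "homeomorphism A (h ` A) h (inv_into S3 h)"
  proof (rule homeomorphismI)
    show "continuous_on A h"
      using smooth_on_imp_continuous_on[OF hD(2)] A continuous_on_subset by blast
    have "h ` A \<subseteq> S3" using hD(4) A by blast
    then show "continuous_on (h ` A) (inv_into S3 h)"
      using smooth_on_imp_continuous_on[OF hD(3)] continuous_on_subset by blast
  qed (use A hD(6) in auto)
  then show ?thesis by (metis homeomorphic_def homeomorphic_sym)
qed

subsection \<open>Maps of the solid torus that are trivial near the braid axis\<close>

lemma vector_4:
  "(vector [x, y, z, w] :: real^4) $ 1 = x" "(vector [x, y, z, w] :: real^4) $ 2 = y"
  "(vector [x, y, z, w] :: real^4) $ 3 = z" "(vector [x, y, z, w] :: real^4) $ 4 = w"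
  unfolding vector_def by simp_all

definition head :: "real^4 \<Rightarrow> complex" where
  "head y = Complex (y $ 1) (y $ 2)"

text \<open>With \<open>head\<close> and \<open>tail\<close> as coordinates \<open>S3\<close> lies
  in the complex plane squared; the braid axis is where \<open>tail\<close> vanishes.\<close>

definition tail :: "real^4 \<Rightarrow> complex" where
  "tail y = Complex (y $ 3) (y $ 4)"

lemma head_tail_eqI: "head x = head y \<Longrightarrow> tail x = tail y \<Longrightarrow> x = y"
  by (simp add: head_def tail_def vec_eq_iff forall_4)

lemma norm_head_tail: "(norm y)\<^sup>2 = (cmod (head y))\<^sup>2 + (cmod (tail y))\<^sup>2"
  by (simp add: norm_vec_def L2_set_def sum_4 head_def tail_def cmod_power2)

lemma head_scaleR: "head (c *\<^sub>R y) = c *\<^sub>R head y" and tail_scaleR: "tail (c *\<^sub>R y) = c *\<^sub>R tail y"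
  by (simp_all add: head_def tail_def complex_eq_iff)

lemma Cinf_on_head: "Cinf_on f U \<Longrightarrow> Cinf_on (\<lambda>x. head (f x)) U"
  and Cinf_on_tail: "Cinf_on f U \<Longrightarrow> Cinf_on (\<lambda>x. tail (f x)) U"
  unfolding head_def tail_def by (intro Cinf_on_Complex Cinf_on_vec_nth; assumption)+

lemma head_solid_torus: "head (solid_torus (z, t)) = z /\<^sub>R sqrt (1 + (cmod z)\<^sup>2)"
  and tail_solid_torus: "tail (solid_torus (z, t)) = cis (2 * pi * t) /\<^sub>R sqrt (1 + (cmod z)\<^sup>2)"
  by (simp_all add: head_def tail_def solid_torus_def vector_4 complex_eq_iff)

lemma sqrt_one_plus_pos: "sqrt (1 + (cmod z)\<^sup>2) > 0"
  by (simp add: add_pos_nonneg)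

lemma one_plus_cmod_nonzero: "1 + (cmod z)\<^sup>2 \<noteq> 0"
  using zero_le_power2[of "cmod z"] by linarith

lemma tail_solid_torus_nonzero: "tail (solid_torus w) \<noteq> 0"
  by (cases w) (simp add: tail_solid_torus one_plus_cmod_nonzero)

lemma solid_torus_in_S3: "solid_torus w \<in> S3"
proof -
  obtain z t where w: "w = (z, t)" by fastforce
  have p: "1 + (cmod z)\<^sup>2 > 0" by (simp add: add_pos_nonneg)
  let ?r = "sqrt (1 + (cmod z)\<^sup>2)"
  have r: "?r\<^sup>2 = 1 + (cmod z)\<^sup>2" "?r > 0" using p by simp_all
  have "(norm (solid_torus w))\<^sup>2 = (cmod z / ?r)\<^sup>2 + (1 / ?r)\<^sup>2"
    unfolding norm_head_tail w head_solid_torus tail_solid_torus using r(2)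
    by (simp add: divide_inverse mult.commute)
  also have "\<dots> = ((cmod z)\<^sup>2 + 1) / (1 + (cmod z)\<^sup>2)"
    unfolding power_divide r(1) by (simp add: add_divide_distrib)
  finally have "(norm (solid_torus w))\<^sup>2 = ((cmod z)\<^sup>2 + 1) / (1 + (cmod z)\<^sup>2)" .
  then have "(norm (solid_torus w))\<^sup>2 = 1" using p by (simp add: add.commute)
  then show ?thesis by (simp add: abs_square_eq_1)
qed

lemma cis_eq_cis_iff: "cis a = cis b \<longleftrightarrow> (\<exists>k::int. b = a + 2 * pi * of_int k)"
proof
  assume "cis a = cis b"
  then have "cis (b - a) = 1" by (simp add: cis_divide[symmetric])
  then have "cos (b - a) = 1" by (simp add: complex_eq_iff)
  then obtain k :: int where "b - a = of_int k * 2 * pi" using cos_one_2pi_int by auto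
  then show "\<exists>k::int. b = a + 2 * pi * of_int k" by (intro exI[of _ k]) (simp add: algebra_simps)
next
  assume "\<exists>k::int. b = a + 2 * pi * of_int k"
  then show "cis a = cis b" by (auto simp: cis_mult[symmetric])
qed

text \<open>The modulus of \<open>tail\<close> recovers the normalising factor; after that
  \<open>head\<close> gives \<open>z\<close> and the angle gives \<open>t\<close> modulo 1.\<close>

lemma solid_torus_eq_iff:
  "solid_torus (z, t) = solid_torus (z', t') \<longleftrightarrow> z = z' \<and> (\<exists>k::int. t' = t + of_int k)"
proof
  assume eq: "solid_torus (z, t) = solid_torus (z', t')"
  let ?r = "sqrt (1 + (cmod z)\<^sup>2)" and ?r' = "sqrt (1 + (cmod z')\<^sup>2)"
  have r: "?r > 0" "?r' > 0" by (rule sqrt_one_plus_pos)+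
  have h: "z /\<^sub>R ?r = z' /\<^sub>R ?r'" and tl: "cis (2 * pi * t) /\<^sub>R ?r = cis (2 * pi * t') /\<^sub>R ?r'"
    using arg_cong[OF eq, of head] arg_cong[OF eq, of tail]
    by (simp_all only: head_solid_torus tail_solid_torus)
  have "cmod (cis (2 * pi * t) /\<^sub>R ?r) = cmod (cis (2 * pi * t') /\<^sub>R ?r')" using tl by simp
  then have rr: "inverse ?r = inverse ?r'"
    using r by (simp del: real_sqrt_gt_0_iff inverse_eq_iff_eq)
  have "z = z'" using h unfolding rr by (simp add: one_plus_cmod_nonzero)
  moreover have "cis (2 * pi * t) = cis (2 * pi * t')"
    using tl unfolding rr by (simp add: one_plus_cmod_nonzero)
  then obtain k :: int where "2 * pi * t' = 2 * pi * t + 2 * pi * of_int k"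
    by (auto simp: cis_eq_cis_iff)
  then have "2 * pi * t' = 2 * pi * (t + of_int k)" by (simp add: algebra_simps)
  then have "t' = t + of_int k" by simp
  ultimately show "z = z' \<and> (\<exists>k::int. t' = t + of_int k)" by blast
next
  assume "z = z' \<and> (\<exists>k::int. t' = t + of_int k)"
  then obtain k :: int where k: "z = z'" "t' = t + of_int k" by blast
  have "cis (2 * pi * t) = cis (2 * pi * t')"
    unfolding cis_eq_cis_iff by (rule exI[of _ k]) (simp add: k algebra_simps)
  then show "solid_torus (z, t) = solid_torus (z', t')"
    by (intro head_tail_eqI) (simp_all add: head_solid_torus tail_solid_torus k(1))
qed

lemma solid_torus_section:
  assumes "tail y \<noteq> 0" "z = head y /\<^sub>R cmod (tail y)" "cis (2 * pi * t) = tail y /\<^sub>R cmod (tail y)"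
  shows "solid_torus (z, t) = y /\<^sub>R norm y"
proof -
  let ?n = "cmod (tail y)"
  have n: "?n > 0" using assms(1) by simp
  have "(norm y)\<^sup>2 = ?n\<^sup>2 * (1 + (cmod z)\<^sup>2)"
    using n by (simp add: norm_head_tail assms(2) power_mult_distrib field_simps)
  then have "sqrt ((norm y)\<^sup>2) = sqrt (?n\<^sup>2 * (1 + (cmod z)\<^sup>2))" by simp
  then have r: "norm y = ?n * sqrt (1 + (cmod z)\<^sup>2)" by (simp add: real_sqrt_mult)
  have s: "inverse (norm y) = inverse (sqrt (1 + (cmod z)\<^sup>2)) * inverse ?n"
    unfolding r by simp
  show ?thesis
    by (intro head_tail_eqI; simp only: head_solid_torus tail_solid_torus head_scaleR tail_scaleR assms(2,3) s
        scaleR_scaleR)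
qed

text \<open>\<open>Arg\<close> jumps across the negative reals, so this section is not continuous.
  That is harmless, because it is only followed by maps that commute with the unit time shift and
  then by \<open>solid_torus\<close>.\<close>

definition torus_section :: "real^4 \<Rightarrow> complex \<times> real" where
  "torus_section y = (head y /\<^sub>R cmod (tail y), Arg (tail y) / (2 * pi))"

lemma solid_torus_torus_section: "tail y \<noteq> 0 \<Longrightarrow> solid_torus (torus_section y) = y /\<^sub>R norm y"
  unfolding torus_section_def
  by (rule solid_torus_section) (auto simp: cis_Arg sgn_div_norm)

lemma Cinf_on_solid_torus: "Cinf_on solid_torus UNIV"
proof -
  have c: "(cmod z)\<^sup>2 = (Re z)\<^sup>2 + (Im z)\<^sup>2" for z by (simp add: cmod_power2)
  have v: "(vector [a, b, c, d] :: real^4) = (\<chi> i. if i = 1 then a else if i = 2 then b else if i = 3 then c else d)"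
    for a b c d :: real
    by (simp add: vec_eq_iff forall_4 vector_4)
  have eq: "solid_torus = (\<lambda>w. (\<chi> i. if i = 1 then Re (fst w) else if i = 2 then Im (fst w)
      else if i = 3 then cos (2 * pi * snd w) else sin (2 * pi * snd w)) /\<^sub>R
      sqrt (1 + ((Re (fst w))\<^sup>2 + (Im (fst w))\<^sup>2)))"
    by (intro ext) (simp add: solid_torus_def v c case_prod_beta)
  have pos: "1 + ((Re (fst w))\<^sup>2 + (Im (fst w))\<^sup>2) > 0" for w :: "complex \<times> real"
    by (simp add: add_pos_nonneg)
  have nz: "sqrt (1 + ((Re (fst w))\<^sup>2 + (Im (fst w))\<^sup>2)) \<noteq> 0" for w :: "complex \<times> real"
    using pos[of w] by simp
  have comp: "Cinf_on (\<lambda>w. if i = 1 then Re (fst w) else if i = 2 then Im (fst w)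
      else if i = 3 then cos (2 * pi * snd w) else sin (2 * pi * snd w)) UNIV" for i :: 4
    by (cases "i = 1"; cases "i = 2"; cases "i = 3") (auto intro!: Cinf_on_intros)
  show ?thesis unfolding eq
    by (intro Cinf_on_scaleR Cinf_on_inverse Cinf_on_sqrt Cinf_on_add Cinf_on_power Cinf_on_Re
        Cinf_on_Im Cinf_on_fst Cinf_on_const Cinf_on_ident open_UNIV Cinf_on_vec_lambda comp pos nz)
qed

text \<open>Maps of the universal cover of the open solid torus. Commuting with the unit time shift
  makes \<open>F\<close> descend, triviality for large \<open>cmod z\<close> makes it extend by the
  identity over the axis. \<open>G\<close> inherits both properties, see
  \<open>torus_diffeo_sym\<close>.\<close>

definition torus_diffeo :: "(complex \<times> real \<Rightarrow> complex \<times> real) \<Rightarrow> (complex \<times> real \<Rightarrow> complex \<times> real) \<Rightarrow> bool" where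
  "torus_diffeo F G \<longleftrightarrow> Cinf_on F UNIV \<and> Cinf_on G UNIV \<and>
     (\<forall>w. G (F w) = w) \<and> (\<forall>w. F (G w) = w) \<and>
     (\<forall>z t. F (z, t + 1) = F (z, t) + (0, 1)) \<and> (\<exists>R. \<forall>z t. cmod z \<ge> R \<longrightarrow> F (z, t) = (z, t))"

lemma torus_diffeoD:
  assumes "torus_diffeo F G"
  shows "Cinf_on F UNIV" "Cinf_on G UNIV" "G (F w) = w" "F (G w) = w" "F (z, t + 1) = F (z, t) + (0, 1)"
  using assms unfolding torus_diffeo_def by blast+

lemma torus_diffeo_trivial:
  assumes "torus_diffeo F G" obtains R where "\<And>z t. cmod z \<ge> R \<Longrightarrow> F (z, t) = (z, t)"
  using assms unfolding torus_diffeo_def by blast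

lemma torus_diffeo_compose:
  assumes "torus_diffeo F G" "torus_diffeo F' G'"
  shows "torus_diffeo (F' \<circ> F) (G \<circ> G')"
proof -
  have per: "F' (w + (0, 1)) = F' w + (0, 1)" for w
    using torus_diffeoD(5)[OF assms(2)] by (cases w) simp
  obtain R where R: "\<And>z t. cmod z \<ge> R \<Longrightarrow> F (z, t) = (z, t)"
    using torus_diffeo_trivial[OF assms(1)] by metis
  obtain R' where R': "\<And>z t. cmod z \<ge> R' \<Longrightarrow> F' (z, t) = (z, t)"
    using torus_diffeo_trivial[OF assms(2)] by metis
  have "Cinf_on (\<lambda>w. F' (F w)) UNIV" "Cinf_on (\<lambda>w. G (G' w)) UNIV"
    using Cinf_on_compose[OF torus_diffeoD(1)[OF assms(1)] torus_diffeoD(1)[OF assms(2)]]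
      Cinf_on_compose[OF torus_diffeoD(2)[OF assms(2)] torus_diffeoD(2)[OF assms(1)]] by simp_all
  moreover have "\<forall>z t. cmod z \<ge> max R R' \<longrightarrow> (F' \<circ> F) (z, t) = (z, t)"
    using R R' by auto
  ultimately show ?thesis
    using torus_diffeoD(3-5)[OF assms(1)] torus_diffeoD(3-5)[OF assms(2)] per
    unfolding torus_diffeo_def o_def by (intro conjI exI[of _ "max R R'"]) (simp_all only:, simp_all)
qed

lemma torus_diffeo_sym:
  assumes "torus_diffeo F G" shows "torus_diffeo G F"
proof -
  have "G (z, t + 1) = G (z, t) + (0, 1)" for z t
  proof -
    obtain z' t' where G: "G (z, t) = (z', t')" by fastforce
    then have "F (z', t') = (z, t)" using torus_diffeoD(4)[OF assms, of "(z, t)"] by simp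
    then have "F (z', t' + 1) = (z, t + 1)" using torus_diffeoD(5)[OF assms, of z' t'] by simp
    then have "G (z, t + 1) = (z', t' + 1)" using torus_diffeoD(3)[OF assms, of "(z', t' + 1)"] by simp
    then show ?thesis using G by simp
  qed
  moreover obtain R where R: "\<And>z t. cmod z \<ge> R \<Longrightarrow> F (z, t) = (z, t)"
    using torus_diffeo_trivial[OF assms] by metis
  have "\<forall>z t. cmod z \<ge> R \<longrightarrow> G (z, t) = (z, t)"
    using R torus_diffeoD(3)[OF assms] by metis
  ultimately show ?thesis
    using torus_diffeoD(1-4)[OF assms] unfolding torus_diffeo_def by blast
qed

lemma quasi_periodic_int:
  assumes "\<And>z t. F (z, t + 1) = F (z, t) + (0, 1 :: real)"
  shows "F (z :: complex, t + of_int k) = F (z, t) + (0 :: complex, of_int k)"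
proof (induction k rule: int_induct[where k=0])
  case base
  then show ?case by (simp add: zero_prod_def[symmetric])
next
  case step: (step1 i)
  have "F (z, t + of_int (i + 1)) = F (z, (t + of_int i) + 1)" by (simp add: add_ac)
  also have "\<dots> = F (z, t) + (0, of_int (i + 1))" unfolding assms step(2) by simp
  finally show ?case .
next
  case step: (step2 i)
  have "F (z, t) + (0, of_int i) = F (z, (t + of_int (i - 1)) + 1)" unfolding step(2)[symmetric] by simp
  also have "\<dots> = F (z, t + of_int (i - 1)) + (0, 1)" by (rule assms)
  finally have "F (z, t + of_int (i - 1)) = F (z, t) + (0, of_int i) - (0, 1)" by simp
  then show ?case by (cases "F (z, t)") simp
qed

definition torus_lift :: "(complex \<times> real \<Rightarrow> complex \<times> real) \<Rightarrow> real^4 \<Rightarrow> real^4" where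
  "torus_lift F y = (if tail y = 0 then y else solid_torus (F (torus_section y)))"

lemma solid_torus_quasi_periodic:
  assumes "torus_diffeo F G" "solid_torus w = solid_torus w'"
  shows "solid_torus (F w) = solid_torus (F w')"
proof -
  obtain z t z' t' where w: "w = (z, t)" "w' = (z', t')" by fastforce
  from assms(2) obtain k :: int where k: "z' = z" "t' = t + of_int k"
    unfolding w solid_torus_eq_iff by auto
  have "F w' = F w + (0, of_int k)"
    unfolding w k by (intro quasi_periodic_int torus_diffeoD(5)[OF assms(1)])
  moreover obtain a b where ab: "F w = (a, b)" by fastforce
  ultimately show ?thesis by (auto simp: solid_torus_eq_iff)
qed

lemma torus_lift_solid_torus:
  assumes "torus_diffeo F G"
  shows "torus_lift F (solid_torus w) = solid_torus (F w)"
proof -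
  have "solid_torus (torus_section (solid_torus w)) = solid_torus w"
    using solid_torus_torus_section[OF tail_solid_torus_nonzero, of w] solid_torus_in_S3[of w] by simp
  from solid_torus_quasi_periodic[OF assms this] show ?thesis
    using tail_solid_torus_nonzero[of w] by (simp add: torus_lift_def)
qed

text \<open>Smoothness is checked in three charts: two branches of the angle, cut along opposite
  rays, and a neighbourhood of the axis on which the lift is the identity.\<close>

lemma smooth_on_torus_lift:
  assumes F: "torus_diffeo F G"
  shows "smooth_on S3 (torus_lift F)"
proof -
  \<comment> \<open>\<open>g\<close> extends the lift to a neighbourhood of the sphere and is
    constant on rays; hence the division by \<open>norm y\<close> on the axis.\<close>
  define g where "g y = (if tail y = 0 then y /\<^sub>R norm y else solid_torus (F (torus_section y)))" for y
  have SF: "Cinf_on (\<lambda>w. solid_torus (F w)) UNIV"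
    using Cinf_on_compose[OF torus_diffeoD(1)[OF F] Cinf_on_solid_torus] by simp
  obtain R where R: "\<And>z t. cmod z \<ge> R \<Longrightarrow> F (z, t) = (z, t)"
    using torus_diffeo_trivial[OF F] by metis
  have tl: "Cinf_on (\<lambda>y. tail y) U" and hd: "Cinf_on (\<lambda>y. head y) U" if "open U" for U
    using that by (auto intro: Cinf_on_tail Cinf_on_head Cinf_on_ident)
  have ctl: "continuous_on UNIV tail" and chd: "continuous_on UNIV head"
    using Cinf_on_imp_continuous_on[OF tl] Cinf_on_imp_continuous_on[OF hd] by auto
  have local: "Cinf_on g V" if V: "open V" "\<And>y. y \<in> V \<Longrightarrow> tail y \<noteq> 0" and \<theta>: "Cinf_on \<theta> V"
    and \<theta>_cis: "\<And>y. y \<in> V \<Longrightarrow> cis (2 * pi * \<theta> y) = tail y /\<^sub>R cmod (tail y)" for V and \<theta> :: "real^4 \<Rightarrow> real"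
  proof -
    have "Cinf_on (\<lambda>y. (head y /\<^sub>R cmod (tail y), \<theta> y)) V"
      by (intro Cinf_on_Pair Cinf_on_scaleR Cinf_on_inverse Cinf_on_norm tl hd \<theta> V) (use V in auto)
    then have "Cinf_on (\<lambda>y. solid_torus (F (head y /\<^sub>R cmod (tail y), \<theta> y))) V"
      by (rule Cinf_on_compose[OF _ SF]) auto
    then show ?thesis
    proof (rule Cinf_on_cong)
      fix y assume y: "y \<in> V"
      have "solid_torus (head y /\<^sub>R cmod (tail y), \<theta> y) = solid_torus (torus_section y)"
        using solid_torus_section[OF V(2)[OF y] refl \<theta>_cis[OF y]]
          solid_torus_torus_section[OF V(2)[OF y]] by simp
      from solid_torus_quasi_periodic[OF F this]
      show "solid_torus (F (head y /\<^sub>R cmod (tail y), \<theta> y)) = g y"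
        using V(2)[OF y] by (simp add: g_def)
    qed
  qed
  have cis_Ln: "cis (Im (Ln z)) = z /\<^sub>R cmod z" if "z \<noteq> 0" for z
    using that by (simp add: Arg_eq_Im_Ln[symmetric] cis_Arg sgn_div_norm)
  have "Cinf_on g (- {0})"
  proof (rule Cinf_on_local)
    fix y :: "real^4" assume y: "y \<in> - {0}"
    consider "tail y \<notin> \<real>\<^sub>\<le>\<^sub>0" | "- tail y \<notin> \<real>\<^sub>\<le>\<^sub>0" | "tail y = 0"
      by (cases "Im (tail y) = 0"; cases "Re (tail y)" "0::real" rule: linorder_cases)
        (auto simp: complex_nonpos_Reals_iff complex_eq_iff)
    then show "\<exists>V. y \<in> V \<and> Cinf_on g V"
    proof cases
      case 1
      define V where "V = {y. tail y \<notin> \<real>\<^sub>\<le>\<^sub>0}"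
      have "V = tail -` (- \<real>\<^sub>\<le>\<^sub>0)" by (auto simp: V_def)
      then have V: "open V" using ctl by (auto intro!: open_vimage)
      have "Cinf_on g V"
      proof (rule local[OF V, of "\<lambda>y. Im (Ln (tail y)) / (2 * pi)"])
        show "Cinf_on (\<lambda>y. Im (Ln (tail y)) / (2 * pi)) V"
          by (intro Cinf_on_divide Cinf_on_const V Cinf_on_Im Cinf_on_compose[OF tl[OF V] Cinf_on_complex_Ln])
            (auto simp: V_def)
        show "tail y \<noteq> 0" if "y \<in> V" for y using that by (auto simp: V_def)
        then show "cis (2 * pi * (Im (Ln (tail y)) / (2 * pi))) = tail y /\<^sub>R cmod (tail y)" if "y \<in> V" for y
          using that cis_Ln by simp
      qed
      then show ?thesis using 1 by (auto simp: V_def)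
    next
      case 2
      define V where "V = {y. - tail y \<notin> \<real>\<^sub>\<le>\<^sub>0}"
      have "V = (\<lambda>y. - tail y) -` (- \<real>\<^sub>\<le>\<^sub>0)" by (auto simp: V_def)
      then have V: "open V" using ctl by (auto intro!: open_vimage continuous_on_minus)
      have "Cinf_on g V"
      proof (rule local[OF V, of "\<lambda>y. (Im (Ln (- tail y)) + pi) / (2 * pi)"])
        show "Cinf_on (\<lambda>y. (Im (Ln (- tail y)) + pi) / (2 * pi)) V"
          by (intro Cinf_on_divide Cinf_on_add Cinf_on_const V Cinf_on_Im
              Cinf_on_compose[OF Cinf_on_minus[OF tl[OF V]] Cinf_on_complex_Ln])
            (auto simp: V_def)
        show "tail y \<noteq> 0" if "y \<in> V" for y using that by (auto simp: V_def)
        then show "cis (2 * pi * ((Im (Ln (- tail y)) + pi) / (2 * pi))) = tail y /\<^sub>R cmod (tail y)"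
          if "y \<in> V" for y
          using that cis_Ln[of "- tail y"] by (simp add: cis_mult[symmetric])
      qed
      then show ?thesis using 2 by (auto simp: V_def)
    next
      case 3
      \<comment> \<open>A cone around the axis. Off the axis itself, the disc coordinate of its
        points has modulus larger than \<open>R\<close>, where \<open>F\<close> is trivial.\<close>
      define V where "V = {y. (\<bar>R\<bar> + 1) * cmod (tail y) < cmod (head y)}"
      have V: "open V"
        unfolding V_def by (intro open_Collect_less continuous_intros ctl chd)
      have "y \<in> V"
      proof -
        have "head y \<noteq> 0" using y 3 head_tail_eqI[of y 0] by (auto simp: head_def tail_def complex_eq_iff)
        then show ?thesis using 3 by (simp add: V_def)
      qed
      have V0: "z \<noteq> 0" if "z \<in> V" for z
        using that by (auto simp: V_def head_def tail_def simp flip: zero_complex.code)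
      have "Cinf_on (\<lambda>y. y /\<^sub>R norm y) V"
        by (intro Cinf_on_scaleR Cinf_on_inverse Cinf_on_norm Cinf_on_ident V) (use V0 in auto)
      then have "Cinf_on g V"
      proof (rule Cinf_on_cong)
        fix z assume z: "z \<in> V"
        show "z /\<^sub>R norm z = g z"
        proof (cases "tail z = 0")
          case False
          have "\<bar>R\<bar> * cmod (tail z) \<le> (\<bar>R\<bar> + 1) * cmod (tail z)" by (simp add: mult_right_mono)
          also have "\<dots> < cmod (head z)" using z by (simp add: V_def)
          finally have "\<bar>R\<bar> * cmod (tail z) < cmod (head z)" .
          moreover have "R * cmod (tail z) \<le> \<bar>R\<bar> * cmod (tail z)" by (simp add: mult_right_mono)
          ultimately have "R * cmod (tail z) \<le> cmod (head z)" by linarith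
          then have "R \<le> cmod (head z /\<^sub>R cmod (tail z))"
            using False by (simp add: field_simps)
          then have "F (torus_section z) = torus_section z"
            by (simp add: torus_section_def R)
          then show ?thesis using False by (simp add: g_def solid_torus_torus_section)
        qed (simp add: g_def)
      qed
      then show ?thesis using \<open>y \<in> V\<close> by blast
    qed
  qed auto
  moreover have "S3 \<subseteq> - {0}" by auto
  moreover have "g y = torus_lift F y" if "y \<in> S3" for y
    using that by (auto simp: g_def torus_lift_def)
  ultimately show ?thesis unfolding smooth_on_iff by blast
qed

lemma S3_diffeo_torus_lift:
  assumes F: "torus_diffeo F G" shows "S3_diffeo (torus_lift F)"
proof (rule S3_diffeoI)
  note G = torus_diffeo_sym[OF F]
  show "smooth_on S3 (torus_lift F)" "smooth_on S3 (torus_lift G)"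
    by (rule smooth_on_torus_lift[OF F] smooth_on_torus_lift[OF G])+
  fix x :: "real^4" assume x: "x \<in> S3"
  show "torus_lift F x \<in> S3" "torus_lift G x \<in> S3"
    using x solid_torus_in_S3 by (auto simp: torus_lift_def simp del: mem_sphere_0)
  have sec: "solid_torus (torus_section x) = x" if "tail x \<noteq> 0"
    using solid_torus_torus_section[OF that] x by simp
  have "torus_lift G (torus_lift F x) = x \<and> torus_lift F (torus_lift G x) = x"
  proof (cases "tail x = 0")
    case False
    have "torus_lift G (torus_lift F (solid_torus (torus_section x))) = solid_torus (torus_section x)"
      "torus_lift F (torus_lift G (solid_torus (torus_section x))) = solid_torus (torus_section x)"
      unfolding torus_lift_solid_torus[OF F] torus_lift_solid_torus[OF G]
      by (simp_all only: torus_diffeoD(3,4)[OF F])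
    then show ?thesis unfolding sec[OF False] ..
  qed (auto simp: torus_lift_def)
  then show "torus_lift G (torus_lift F x) = x" "torus_lift F (torus_lift G x) = x" by auto
qed

section \<open>Involutions acting on knots\<close>

lemma periodic_int:
  fixes K :: "real \<Rightarrow> 'a"
  assumes "\<And>t. K (t + 1) = K t"
  shows "K (t + of_int k) = K t"
proof (induction k rule: int_induct[where k=0])
  case step: (step1 i)
  have "K (t + of_int (i + 1)) = K ((t + of_int i) + 1)" by (simp add: add_ac)
  then show ?case using step assms by simp
next
  case step: (step2 i)
  have "K (t + of_int i) = K (t + of_int (i - 1))" using assms[of "t + of_int (i - 1)"] by simp
  then show ?case using step by simp
qed auto

lemma oriented_knotD:
  assumes "oriented_knot K"
  shows "Cinf_on K UNIV" "K t \<in> S3" "K (t + of_int k) = K t" "vector_derivative K (at t) \<noteq> 0"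
    "K s = K t \<longleftrightarrow> (\<exists>k::int. t = s + of_int k)"
proof -
  show "Cinf_on K UNIV" using assms by (simp add: oriented_knot_def smooth_on_UNIV)
  show "K t \<in> S3" "vector_derivative K (at t) \<noteq> 0"
    using assms unfolding oriented_knot_def by blast+
  have per: "K (t + of_int k) = K t" for t k
    by (rule periodic_int) (use assms in \<open>simp add: oriented_knot_def\<close>)
  then show "K (t + of_int k) = K t" .
  have inj: "inj_on K {0..<1}" using assms by (simp add: oriented_knot_def)
  show "K s = K t \<longleftrightarrow> (\<exists>k::int. t = s + of_int k)"
  proof
    assume eq: "K s = K t"
    have fr: "K (frac x) = K x" for x
      using per[of x "- \<lfloor>x\<rfloor>"] by (simp add: frac_def)
    have "frac s = frac t"
      by (rule inj_onD[OF inj]) (use fr eq frac_ge_0 frac_lt_1 in auto)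
    then have "t = s + of_int (\<lfloor>t\<rfloor> - \<lfloor>s\<rfloor>)" by (simp add: frac_def)
    then show "\<exists>k::int. t = s + of_int k" by blast
  qed (use per in auto)
qed

lemma continuous_int_valued_constant:
  fixes g :: "real \<Rightarrow> real"
  assumes "continuous_on UNIV g" "\<And>t. g t \<in> \<int>"
  shows "\<exists>m::int. \<forall>t. g t = of_int m"
proof -
  have "g constant_on UNIV"
  proof (rule continuous_discrete_range_constant[OF connected_UNIV assms(1)])
    show "\<exists>e>0. \<forall>y. y \<in> UNIV \<and> g y \<noteq> g x \<longrightarrow> e \<le> norm (g y - g x)" for x
    proof (intro exI[of _ 1] conjI allI impI)
      fix y assume "y \<in> UNIV \<and> g y \<noteq> g x"
      moreover obtain a b :: int where "g y = of_int a" "g x = of_int b"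
        using assms(2) by (metis Ints_cases)
      ultimately show "1 \<le> norm (g y - g x)" by (simp flip: of_int_diff of_int_abs)
    qed auto
  qed
  then show ?thesis
    using assms(2) unfolding constant_on_def by (metis Ints_cases UNIV_I)
qed

lemma lift_through_knot:
  assumes K: "oriented_knot K" and L: "continuous_on UNIV L" and r: "range L \<subseteq> range K"
  obtains h :: "real \<Rightarrow> real" where "continuous_on UNIV h" "\<And>t. L t = K (h t)"
proof -
  note KD = oriented_knotD[OF K]
  have cK: "continuous_on A K" for A
    using Cinf_on_imp_continuous_on[OF KD(1)] continuous_on_subset by blast
  \<comment> \<open>The choice determines the parameter only modulo 1, which \<open>cis\<close>
    forgets.\<close>
  define \<kappa> where "\<kappa> x = cis (2 * pi * (SOME t. K t = x))" for x
  have \<kappa>: "\<kappa> (K t) = cis (2 * pi * t)" for t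
  proof -
    have "K (SOME s. K s = K t) = K t" by (rule someI[of "\<lambda>s. K s = K t" t]) simp
    then obtain k :: int where "t = (SOME s. K s = K t) + of_int k" using KD(5) by blast
    then have "2 * pi * t = 2 * pi * (SOME s. K s = K t) + 2 * pi * of_int k"
      by (metis distrib_left)
    then show ?thesis by (simp add: \<kappa>_def cis_mult[symmetric])
  qed
  have rK: "range K = K ` {0..1}"
  proof -
    have "K t \<in> K ` {0..1}" for t
    proof -
      have "K (frac t) = K t" using KD(3)[of t "- \<lfloor>t\<rfloor>"] by (simp add: frac_def)
      then show ?thesis
        using frac_ge_0[of t] frac_lt_1[of t] by (metis atLeastAtMost_iff image_eqI less_imp_le)
    qed
    then show ?thesis by auto
  qed
  have "closed (range K)"
    unfolding rK by (intro compact_imp_closed compact_continuous_image cK compact_Icc)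
  moreover have "closed (\<kappa> -` B \<inter> range K)" if B: "closed B" for B
  proof -
    have "\<kappa> -` B \<inter> range K = K ` ({0..1} \<inter> (\<lambda>t. cis (2 * pi * t)) -` B)"
      unfolding rK using \<kappa> by auto
    moreover have "closed ((\<lambda>t. cis (2 * pi * t)) -` B)"
      by (intro closed_vimage B continuous_intros)
    then have "compact (K ` ({0..1} \<inter> (\<lambda>t. cis (2 * pi * t)) -` B))"
      by (intro compact_continuous_image cK compact_Int_closed compact_Icc)
    ultimately show ?thesis by (simp add: compact_imp_closed)
  qed
  ultimately have c\<kappa>: "continuous_on (range K) \<kappa>"
    by (simp add: continuous_on_closed_vimage)
  have cu: "continuous_on UNIV (\<lambda>t. \<kappa> (L t))"
    by (rule continuous_on_compose2[OF c\<kappa> L r])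
  have u1: "cmod (\<kappa> (L t)) = 1" for t by (simp add: \<kappa>_def)
  obtain g where g: "continuous_on UNIV g" "\<And>t. \<kappa> (L t) = exp (g t)"
  proof (rule continuous_logarithm_on_contractible[OF cu])
    show "\<kappa> (L t) \<noteq> 0" for t using u1[of t] by auto
  qed (auto simp: convex_imp_contractible)
  have "Re (g t) = 0" for t using u1[of t] by (simp add: g(2) norm_exp_eq_Re)
  then have eg: "\<kappa> (L t) = cis (Im (g t))" for t
    by (simp add: g(2) cis_conv_exp) (metis Re_complex_of_real complex_eq mult.commute of_real_0 add_0)
  show ?thesis
  proof
    show "continuous_on UNIV (\<lambda>t. Im (g t) / (2 * pi))" by (intro continuous_intros g) auto
    show "L t = K (Im (g t) / (2 * pi))" for t
    proof -
      obtain s where s: "L t = K s" using r by blast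
      then have "cis (2 * pi * s) = cis (2 * pi * (Im (g t) / (2 * pi)))"
        using eg[of t] \<kappa>[of s] by simp
      then have "cis (2 * pi * s - 2 * pi * (Im (g t) / (2 * pi))) = 1"
        by (simp add: cis_divide[symmetric])
      then have "cos (2 * pi * s - 2 * pi * (Im (g t) / (2 * pi))) = 1" by (simp add: complex_eq_iff)
      then obtain k :: int where "2 * pi * s - 2 * pi * (Im (g t) / (2 * pi)) = of_int k * 2 * pi"
        using cos_one_2pi_int by auto
      then have "2 * pi * s = 2 * pi * (Im (g t) / (2 * pi) + of_int k)"
        by (simp add: algebra_simps)
      then have "s = Im (g t) / (2 * pi) + of_int k" by (simp only: mult_cancel_left) simp
      then show ?thesis using s KD(3) by simp
    qed
  qed
qed

text \<open>Near \<open>t0\<close> some coordinate \<open>b\<close> of the velocity of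
  \<open>K\<close> along \<open>h\<close> is nonzero, and the corresponding coordinate of the
  equation \<open>K (h t) = L t\<close> determines \<open>h\<close> implicitly.\<close>

lemma Cinf_on_lift:
  fixes h :: "real \<Rightarrow> real"
  assumes K: "oriented_knot K" and L: "Cinf_on L UNIV" and h: "continuous_on UNIV h"
    and eq: "\<And>t. L t = K (h t)"
  shows "Cinf_on h UNIV"
proof (rule Cinf_on_local)
  note KD = oriented_knotD[OF K]
  fix t0 :: real
  let ?D = "\<lambda>s. vector_derivative K (at s)"
  have K': "(K has_vector_derivative ?D s) (at s)" for s
    using Cinf_on_imp_differentiable[OF KD(1)] differentiableI_vector vector_derivative_works
    by (metis UNIV_I frechet_derivative_works has_vector_derivative_def frechet_derivative_eq_vector_derivative
        differentiable_def)
  have "frechet_derivative K (at s) 1 = ?D s" for s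
    using fun_cong[OF frechet_derivative_at[OF K'[of s, unfolded has_vector_derivative_def]], of 1] by simp
  then have D: "Cinf_on ?D UNIV"
    by (rule Cinf_on_cong[OF Cinf_on_frechet_derivative[OF KD(1), of 1]])
  obtain b where b: "b \<in> Basis" "?D (h t0) \<bullet> b \<noteq> 0"
    using KD(4)[of "h t0"] by (metis euclidean_all_zero_iff)
  define V where "V = {t. ?D (h t) \<bullet> b \<noteq> 0}"
  have "continuous_on UNIV (\<lambda>t. ?D (h t) \<bullet> b)"
    by (intro continuous_intros continuous_on_compose2[OF Cinf_on_imp_continuous_on[OF D] h]) auto
  then have V: "open V" unfolding V_def by (intro open_Collect_neq continuous_on_const)
  define F where "F w = K (fst w) \<bullet> b - L (snd w) \<bullet> b" for w
  have "Cinf_on (\<lambda>w. K (fst w)) UNIV" "Cinf_on (\<lambda>w. L (snd w)) UNIV"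
    using Cinf_on_compose[OF Cinf_on_fst[OF Cinf_on_ident[OF open_UNIV]] KD(1)]
      Cinf_on_compose[OF Cinf_on_snd[OF Cinf_on_ident[OF open_UNIV]] L] by auto
  then have F: "Cinf_on F UNIV"
    unfolding F_def by (intro Cinf_on_intros) auto
  have dF: "frechet_derivative F (at (s, t)) (1, 0) = ?D s \<bullet> b" for s t
  proof -
    have "(F has_derivative frechet_derivative F (at (s, t))) (at (s, t))"
      using Cinf_on_imp_differentiable[OF F] by (simp add: frechet_derivative_works)
    moreover have "((\<lambda>s. (s, t)) has_derivative (\<lambda>v. (v, 0))) (at s)"
      by (auto intro!: derivative_eq_intros)
    ultimately have "((\<lambda>s. F (s, t)) has_derivative (\<lambda>v. frechet_derivative F (at (s, t)) (v, 0))) (at s)"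
      using diff_chain_at[of "\<lambda>s. (s, t)" "\<lambda>v. (v, 0)" s F] by (simp add: o_def)
    moreover have "((\<lambda>s. F (s, t)) has_derivative (\<lambda>v. (v *\<^sub>R ?D s) \<bullet> b)) (at s)"
      unfolding F_def using K'[of s] unfolding has_vector_derivative_def
      by (auto intro!: derivative_eq_intros)
    ultimately have "(\<lambda>v. frechet_derivative F (at (s, t)) (v, 0)) = (\<lambda>v. (v *\<^sub>R ?D s) \<bullet> b)"
      by (rule has_derivative_unique)
    from fun_cong[OF this, of 1] show ?thesis by simp
  qed
  have "Cinf_on h V"
  proof (rule Cinf_on_implicit[OF F V])
    show "continuous_on V h" using h continuous_on_subset by blast
    show "F (h w, w) = 0" for w by (simp add: F_def eq)
    show "frechet_derivative F (at (h w, w)) (1, 0) \<noteq> 0" if "w \<in> V" for w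
      using that unfolding dF V_def by simp
  qed auto
  then show "\<exists>V. t0 \<in> V \<and> Cinf_on h V" using b by (auto simp: V_def)
qed auto

text \<open>The induced involution of the circle has a fixed point and is not the identity; an
  orientation-preserving one with a fixed point would be the identity.\<close>

lemma involution_reverses_knot:
  assumes K: "oriented_knot K" and f: "S3_involution f" and inv: "f ` range K \<subseteq> range K"
    and fix_pt: "K a \<in> fixed_set f" and nonfix: "K b \<notin> fixed_set f"
  shows "reverses_knot f K"
proof -
  note KD = oriented_knotD[OF K]
  have ff: "f (f (K t)) = K t" for t using f KD(2) by (simp add: S3_involution_def)
  have fs: "smooth_on S3 f" using f by (simp add: S3_involution_def)
  have "smooth_on UNIV (f \<circ> K)"
    by (rule smooth_on_compose[OF _ fs]) (use KD in \<open>auto simp: smooth_on_UNIV simp del: mem_sphere_0\<close>)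
  then have L: "Cinf_on (\<lambda>t. f (K t)) UNIV" by (simp add: smooth_on_UNIV o_def)
  have "range (\<lambda>t. f (K t)) \<subseteq> range K" using inv by blast
  then obtain h where ch: "continuous_on UNIV h" and h: "\<And>t. f (K t) = K (h t)"
    using lift_through_knot[OF K Cinf_on_imp_continuous_on[OF L]] by metis
  have hs: "Cinf_on h UNIV" by (rule Cinf_on_lift[OF K L ch h])
  \<comment> \<open>\<open>h\<close> is a lift to the line of the involution induced on the circle:
    \<open>m\<close> is the translation that is its square, and \<open>d\<close> below is its
    degree.\<close>
  obtain m :: int where m: "\<And>t. h (h t) = t + of_int m"
  proof -
    have "\<exists>m::int. \<forall>t. h (h t) - t = of_int m"
    proof (rule continuous_int_valued_constant)
      show "continuous_on UNIV (\<lambda>t. h (h t) - t)"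
        by (intro continuous_intros continuous_on_compose2[OF ch ch]) auto
      fix t
      have "K t = K (h (h t))" using ff[of t] h by simp
      then obtain k :: int where "h (h t) = t + of_int k" using KD(5) by blast
      then show "h (h t) - t \<in> \<int>" by simp
    qed
    then show ?thesis using that by (metis add.commute diff_add_cancel)
  qed
  obtain d :: int where d1: "\<And>t. h (t + 1) = h t + of_int d"
  proof -
    have "\<exists>d::int. \<forall>t. h (t + 1) - h t = of_int d"
    proof (rule continuous_int_valued_constant)
      show "continuous_on UNIV (\<lambda>t. h (t + 1) - h t)"
        by (intro continuous_intros continuous_on_compose2[OF ch] ch) auto
      fix t
      have "K (h t) = K (h (t + 1))" using h KD(3)[of t 1] by (metis of_int_1)
      then obtain k :: int where "h (t + 1) = h t + of_int k" using KD(5) by blast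
      then show "h (t + 1) - h t \<in> \<int>" by simp
    qed
    then show ?thesis using that by (metis add.commute diff_add_cancel)
  qed
  have d: "h (t + of_int k) = h t + of_int (d * k)" for t k
  proof -
    have "(\<lambda>t. h t - of_int d * t) (t + of_int k) = (\<lambda>t. h t - of_int d * t) t"
      by (rule periodic_int) (simp add: d1 algebra_simps)
    then show ?thesis by (simp add: algebra_simps)
  qed
  have "h (h (0 + of_int 1)) = h (h 0) + of_int (d * d)" unfolding d by simp
  then have "of_int (d * d) = (1::real)" unfolding m by simp
  then have dd: "d * d = 1" by linarith
  have "inj h" by (rule injI) (metis m add_right_cancel)
  then have "strict_mono_on UNIV h \<or> strict_antimono_on UNIV h"
    using injective_eq_monotone_map[of UNIV h] ch by (simp add: is_interval_univ)
  moreover have "\<not> strict_mono_on UNIV h"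
  proof
    assume mono: "strict_mono_on UNIV h"
    then have "h 0 < h (0 + 1)" by (simp add: strict_mono_onD)
    then have "d = 1" using dd d1[of 0] by (auto simp: zmult_eq_1_iff)
    have "K (h a) = K a" using fix_pt h by (simp add: fixed_set_def)
    then obtain k :: int where k: "a = h a + of_int k" using KD(5) by blast
    have "h a = h (h a + of_int k)" using k by simp
    also have "\<dots> = a + of_int m + of_int k" unfolding d m \<open>d = 1\<close> by simp
    finally have mk: "m = - 2 * k" using k by linarith
    \<comment> \<open>\<open>h\<close> followed by the shift by \<open>k\<close> is an increasing
      involution of the line, hence the identity; then \<open>f\<close> would also fix
      \<open>K b\<close>.\<close>
    have "h t = t - of_int k" for t
    proof -
      have hh: "h (h t + of_int k) = t - of_int k" unfolding d m \<open>d = 1\<close> mk by simp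
      have "\<not> h t + of_int k < t"
        using strict_mono_onD[OF mono, of "h t + of_int k" t] hh by auto
      moreover have "\<not> t < h t + of_int k"
        using strict_mono_onD[OF mono, of t "h t + of_int k"] hh by auto
      ultimately show ?thesis by linarith
    qed
    then have "K (h b) = K b" using KD(3)[of b "- k"] by simp
    then show False using nonfix h KD(2) by (simp add: fixed_set_def del: mem_sphere_0)
  qed
  ultimately have anti: "strict_antimono_on UNIV h" by blast
  then have "h (0 + 1) < h 0" by (simp add: monotone_on_def)
  then have d_eq: "d = - 1" using dd d1[of 0] by (auto simp: zmult_eq_1_iff)
  have dh: "(h has_real_derivative deriv h t) (at t)" for t
    using Cinf_on_imp_differentiable[OF hs] by (simp add: DERIV_deriv_iff_real_differentiable)
  have neg: "deriv h t < 0" for t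
  proof -
    have "((\<lambda>t. h (h t)) has_real_derivative deriv h (h t) * deriv h t) (at t)"
      by (rule DERIV_chain2[OF dh dh])
    moreover have "((\<lambda>t. h (h t)) has_real_derivative 1) (at t)"
      unfolding m by (auto intro!: derivative_eq_intros)
    ultimately have "deriv h (h t) * deriv h t = 1" by (rule DERIV_unique)
    then have "deriv h t \<noteq> 0" by auto
    moreover have "((\<lambda>t. - h t) has_real_derivative - deriv h t) (at t)"
      by (intro DERIV_minus dh)
    then have "- deriv h t \<ge> 0"
    proof (rule mono_on_imp_deriv_nonneg[rotated])
      show "mono_on UNIV (\<lambda>t. - h t)"
        using anti by (auto simp: monotone_on_def le_less)
    qed auto
    ultimately show ?thesis by simp
  qed
  show ?thesis
    unfolding reverses_knot_def same_oriented_knot_def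
  \<comment> \<open>As \<open>f\<close> is an involution, \<open>f (K (h (- t)))\<close> equals
    \<open>f (f (K (- t)))\<close>, which is the reversed knot at \<open>t\<close>.\<close>
  proof (intro exI[of _ "\<lambda>t. h (- t)"] conjI allI)
    show "smooth_on UNIV (\<lambda>t. h (- t))"
      unfolding smooth_on_UNIV
      using Cinf_on_compose[OF Cinf_on_minus[OF Cinf_on_ident[OF open_UNIV]] hs] by simp
    show "deriv (\<lambda>t. h (- t)) t > 0" for t
    proof -
      have "((\<lambda>t. h (- t)) has_real_derivative deriv h (- t) * (- 1)) (at t)"
        by (rule DERIV_chain2[OF dh]) (auto intro!: derivative_eq_intros)
      then show ?thesis using neg[of "- t"] by (simp add: DERIV_imp_deriv)
    qed
    show "h (- (t + 1)) = h (- t) + 1" for t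
      using d1[of "- (t + 1)"] d_eq by simp
    show "reverse_knot K t = (f \<circ> K) (h (- t))" for t
      using ff[of "- t"] h by (simp add: reverse_knot_def)
  qed
qed

section \<open>Staircase functions\<close>

text \<open>Continues \<open>f\<close> from the unit interval to the line up to a constant gain per
  period: none for \<open>slab_delay\<close>, one unit for \<open>clock_jump\<close>.\<close>

definition staircase :: "(real \<Rightarrow> real) \<Rightarrow> real \<Rightarrow> real" where
  "staircase f t = of_int \<lfloor>t\<rfloor> * (f 1 - f 0) + f (frac t)"

lemma staircase_add_int: "staircase f (t + of_int k) = staircase f t + of_int k * (f 1 - f 0)"
  by (simp add: staircase_def frac_def algebra_simps)

lemma staircase_unit:
  assumes "0 \<le> x" "x \<le> 1" shows "staircase f (x + of_int k) = of_int k * (f 1 - f 0) + f x"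
proof (cases "x = 1")
  case True
  then show ?thesis using staircase_add_int[of f 1 k] by (simp add: staircase_def)
next
  case False
  then have "\<lfloor>x\<rfloor> = 0" using assms by (simp add: floor_eq_iff)
  then show ?thesis unfolding staircase_add_int by (simp add: staircase_def frac_def)
qed

lemma staircase_mono:
  assumes f: "mono f" and st: "s \<le> t" shows "staircase f s \<le> staircase f t"
proof (cases "\<lfloor>s\<rfloor> = \<lfloor>t\<rfloor>")
  case True
  then have "frac s \<le> frac t" using st by (simp add: frac_def)
  then show ?thesis using True monoD[OF f] by (simp add: staircase_def)
next
  case False
  then have fl: "of_int \<lfloor>s\<rfloor> + 1 \<le> (of_int \<lfloor>t\<rfloor> :: real)"
    using floor_mono[OF st] by linarith
  have f01: "f (frac s) \<le> f 1" "f 0 \<le> f (frac t)" "0 \<le> f 1 - f 0"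
    using monoD[OF f, of "frac s" 1] monoD[OF f, of 0 "frac t"] monoD[OF f, of 0 1]
      frac_lt_1[of s] frac_ge_0[of t] by auto
  have "(of_int \<lfloor>s\<rfloor> + 1) * (f 1 - f 0) \<le> of_int \<lfloor>t\<rfloor> * (f 1 - f 0)"
    using fl f01(3) by (rule mult_right_mono)
  then show ?thesis using f01(1,2) by (simp add: staircase_def algebra_simps)
qed

text \<open>Around an integer \<open>m\<close> the staircase is a constant plus two translates of
  \<open>f\<close>; on each side of \<open>m\<close> one of them is constant, because
  \<open>f\<close> is constant outside the unit interval.\<close>

lemma Cinf_on_staircase:
  assumes f: "Cinf_on f UNIV" and f0: "\<And>s. s \<le> 0 \<Longrightarrow> f s = f 0" and f1: "\<And>s. s \<ge> 1 \<Longrightarrow> f s = f 1"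
  shows "Cinf_on (staircase f) UNIV"
proof (rule Cinf_on_local)
  fix t :: real
  define m where "m = \<lfloor>t\<rfloor>"
  let ?V = "{of_int m - 1<..<of_int m + 1 :: real}"
  have op: "open ?V" by simp
  have "Cinf_on (\<lambda>x. f (x + c)) ?V" for c
    by (rule Cinf_on_compose[OF Cinf_on_add[OF Cinf_on_ident Cinf_on_const] f]) (auto simp: op)
  from Cinf_on_add[OF Cinf_on_const[OF op, of "(of_int m - 1) * (f 1 - f 0) - f 0"]
      Cinf_on_add[OF this[of "- of_int m"] this[of "1 - of_int m"]]]
  have "Cinf_on (staircase f) ?V"
  proof (rule Cinf_on_cong)
    fix x assume x: "x \<in> ?V"
    show "(of_int m - 1) * (f 1 - f 0) - f 0 + (f (x + - of_int m) + f (x + (1 - of_int m))) = staircase f x"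
    proof (cases "x \<ge> of_int m")
      case True
      then have "\<lfloor>x\<rfloor> = m" using x by (simp add: floor_eq_iff)
      then show ?thesis using True f1[of "x + (1 - of_int m)"]
        by (simp add: staircase_def frac_def algebra_simps)
    next
      case False
      then have fl: "\<lfloor>x\<rfloor> = m - 1" using x by (simp add: floor_eq_iff)
      show ?thesis unfolding staircase_def frac_def fl using False f0[of "x + - of_int m"]
        by (simp add: algebra_simps)
    qed
  qed
  moreover have "t \<in> ?V" using floor_correct[of t] by (simp add: m_def) linarith
  ultimately show "\<exists>V. t \<in> V \<and> Cinf_on (staircase f) V" by blast
qed auto

section \<open>The closed braid as a union of crossings\<close>

text \<open>\<open>\<sigma>\<close> is the completed fraction of the half turn, and the sign is the
  exponent of the \<open>i\<close>-th letter of the Turk's head braid. Being an unordered pair, the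
  crossing looks the same at 0 and at 1.\<close>

definition crossing :: "nat \<Rightarrow> real \<Rightarrow> complex set" where
  "crossing i \<sigma> = {of_nat i + 1 / 2 + cis (pi * (- 1) ^ (i - 1) * \<sigma>) / 2,
                  of_nat i + 1 / 2 - cis (pi * (- 1) ^ (i - 1) * \<sigma>) / 2}"

lemma crossing_0: "crossing i 0 = {of_nat i, of_nat (i + 1)}"
  by (auto simp: crossing_def)

lemma cis_sign_pi: "cis (pi * (- 1) ^ n) = - 1"
  by (cases "even n") (auto simp: cis_neq_zero complex_eq_iff)

lemma crossing_1: "crossing i 1 = {of_nat i, of_nat (i + 1)}"
  by (auto simp: crossing_def cis_sign_pi)

text \<open>Times are measured in units in which every factor \<open>A\<^sub>p\<close> takes time \<open>1\<close>, and
  \<open>N = p - 1\<close>. In \<open>model_braid\<close>, \<open>c i\<close> and \<open>d\<close> are the centre and the half-width of the time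
  window of the \<open>i\<close>-th crossing, modulo \<open>1\<close>.\<close>

definition slab_braid :: "nat \<Rightarrow> (real \<Rightarrow> real) \<Rightarrow> (complex \<times> real) set" where
  "slab_braid N \<sigma> = {(z, u). \<exists>i\<in>{1..N}. \<exists>k::int. \<exists>s\<in>{0..1}.
     u = (real i - 1 + s) / real N + of_int k \<and>
     z \<in> of_nat ` ({1..N + 1} - {i, i + 1}) \<union> crossing i (\<sigma> s)}"

definition model_braid :: "nat \<Rightarrow> (nat \<Rightarrow> real) \<Rightarrow> real \<Rightarrow> (complex \<times> real) set" where
  "model_braid N c d = {(z, u).
     (\<exists>j\<in>{1..N + 1}. z = of_nat j \<and>
        (\<forall>i\<in>{1..N}. \<forall>k::int. j = i \<or> j = i + 1 \<longrightarrow> d \<le> \<bar>u - c i - of_int k\<bar>)) \<or>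
     (\<exists>i\<in>{1..N}. \<exists>k::int. \<bar>u - c i - of_int k\<bar> \<le> d \<and>
        z \<in> crossing i (smooth_step ((u - c i - of_int k) / (2 * d) + 1 / 2)))}"

lemma nth_concat_replicate:
  "k < q * length w \<Longrightarrow> concat (replicate q w) ! k = w ! (k mod length w)"
proof (induction q arbitrary: k)
  case (Suc q)
  show ?case
  proof (cases "k < length w")
    case False
    then have "k - length w < q * length w" using Suc.prems by auto
    from Suc.IH[OF this] show ?thesis using False by (simp add: nth_append le_mod_geq)
  qed (simp add: nth_append)
qed simp

lemma braid_power_turks_head:
  "length (braid_power (turks_head_braid (N + 1)) q) = q * N"
  "k < q * N \<Longrightarrow> braid_power (turks_head_braid (N + 1)) q ! k = (k mod N + 1, (- 1) ^ (k mod N))"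
proof -
  have l: "length (turks_head_braid (N + 1)) = N" by (simp add: turks_head_braid_def)
  show "length (braid_power (turks_head_braid (N + 1)) q) = q * N"
    unfolding braid_power_def length_concat map_replicate sum_list_replicate l by simp
  assume k: "k < q * N"
  then have "k mod N < N" by (cases "N = 0") auto
  then have "turks_head_braid (N + 1) ! (k mod N) = (k mod N + 1, (- 1) ^ (k mod N))"
    by (simp add: turks_head_braid_def del: upt_Suc)
  then show "braid_power (turks_head_braid (N + 1)) q ! k = (k mod N + 1, (- 1) ^ (k mod N))"
    using nth_concat_replicate[of k q "turks_head_braid (N + 1)"] k unfolding braid_power_def l by simp
qed

lemma generator_positions_crossing:
  "generator_positions p (i, (- 1) ^ (i - 1)) s =
     of_nat ` ({1..p} - {i, i + 1}) \<union> crossing i (smooth_step s)"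
  by (simp add: generator_positions_def crossing_def)

text \<open>Multiplying the time by \<open>q\<close> unrolls the stack of \<open>q * N\<close> slabs
  into a braid of period 1, since the letters depend only on the slab number modulo
  \<open>N\<close>.\<close>

lemma braid_closure_turks_head:
  assumes N: "N \<ge> 1" and q: "q \<ge> 1"
  shows "braid_closure (geometric_braid (N + 1) (braid_power (turks_head_braid (N + 1)) q)) =
    solid_torus ` {(z, \<theta>). (z, real q * \<theta>) \<in> slab_braid N smooth_step}"
proof -
  let ?w = "braid_power (turks_head_braid (N + 1)) q"
  have len: "length ?w = q * N" and ne: "?w \<noteq> []"
    using braid_power_turks_head(1)[of N q] N q by (auto simp flip: length_greater_0_conv)
  have qN: "real q > 0" "real N > 0" using N q by auto
  have gb: "geometric_braid (N + 1) ?w = {(z, (real k + s) / real (q * N)) | z k s.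
      k < q * N \<and> s \<in> {0..1} \<and> z \<in> generator_positions (N + 1) (?w ! k) s}"
    unfolding geometric_braid_def len using ne by simp
  have pos: "generator_positions (N + 1) (?w ! k) s =
      of_nat ` ({1..N + 1} - {k mod N + 1, k mod N + 1 + 1}) \<union> crossing (k mod N + 1) (smooth_step s)"
    if "k < q * N" for k s
    using generator_positions_crossing[of "N + 1" "k mod N + 1" s] braid_power_turks_head(2)[OF that]
    by simp
  show ?thesis
    unfolding braid_closure_def
  proof (intro equalityI subsetI)
    fix x assume "x \<in> solid_torus ` geometric_braid (N + 1) ?w"
    then obtain z k s where x: "x = solid_torus (z, (real k + s) / real (q * N))"
      and k: "k < q * N" "s \<in> {0..1}" and z: "z \<in> generator_positions (N + 1) (?w ! k) s"
      unfolding gb by auto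
    have "real k = real (k div N) * real N + real (k mod N)"
      by (metis div_mult_mod_eq of_nat_add of_nat_mult)
    then have "real q * ((real k + s) / real (q * N)) =
        (real (k mod N + 1) - 1 + s) / real N + of_int (int (k div N))"
      using qN by (simp add: field_simps)
    moreover have "k mod N + 1 \<in> {1..N}" using N by (simp add: Suc_le_eq)
    ultimately have "(z, real q * ((real k + s) / real (q * N))) \<in> slab_braid N smooth_step"
      using z k(2) unfolding pos[OF k(1)] slab_braid_def by blast
    then show "x \<in> solid_torus ` {(z, \<theta>). (z, real q * \<theta>) \<in> slab_braid N smooth_step}"
      unfolding x by blast
  next
    fix x assume "x \<in> solid_torus ` {(z, \<theta>). (z, real q * \<theta>) \<in> slab_braid N smooth_step}"
    then obtain z \<theta> i s and k :: int where x: "x = solid_torus (z, \<theta>)" and i: "i \<in> {1..N}" "s \<in> {0..1}"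
      and \<theta>: "real q * \<theta> = (real i - 1 + s) / real N + of_int k"
      and z: "z \<in> of_nat ` ({1..N + 1} - {i, i + 1}) \<union> crossing i (smooth_step s)"
      unfolding slab_braid_def by blast
    \<comment> \<open>\<open>K\<close> numbers the slab in the bi-infinite periodic word, and
      \<open>K'\<close> is its residue among the \<open>q * N\<close> slabs of one turn; the
      quotient counts full turns, which \<open>solid_torus\<close> ignores.\<close>
    define K where "K = int (i - 1) + int N * k"
    define K' where "K' = nat (K mod int (q * N))"
    have pos_qN: "int (q * N) > 0" using N q by simp
    have K': "int K' = K mod int (q * N)" using pos_qN by (simp add: K'_def)
    have "int K' < int (q * N)" unfolding K' using pos_qN by (rule pos_mod_bound)
    then have K'lt: "K' < q * N" by (simp only: of_nat_less_iff)
    have "int (K' mod N) = K mod int N"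
      unfolding zmod_int K' by (simp add: mod_mod_cancel)
    also have "\<dots> = int (i - 1)" unfolding K_def using i by (simp add: mod_pos_pos_trivial)
    finally have Kmod: "K' mod N + 1 = i" using i by auto
    have "K = K' + int (q * N) * (K div int (q * N))" unfolding K' by simp
    then have "real_of_int K = real K' + (real q * real N) * of_int (K div int (q * N))"
      by (metis of_int_add of_int_mult of_int_of_nat_eq of_nat_mult)
    moreover have "real_of_int K = real i - 1 + real N * of_int k" using i by (simp add: K_def of_nat_diff)
    ultimately have "\<theta> = (real K' + s) / real (q * N) + of_int (K div int (q * N))"
      using \<theta> qN by (simp add: field_simps)
    then have "x = solid_torus (z, (real K' + s) / real (q * N))"
      unfolding x solid_torus_eq_iff
      by (intro conjI exI[of _ "- (K div int (q * N))"]) simp_all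
    moreover have "z \<in> generator_positions (N + 1) (?w ! K') s"
      using z unfolding pos[OF K'lt] Kmod .
    ultimately show "x \<in> solid_torus ` geometric_braid (N + 1) ?w"
      unfolding gb using K'lt i(2) by blast
  qed
qed

lemma exists_slab:
  assumes "N \<ge> 1"
  obtains i and k :: int and s where "i \<in> {1..N}" "s \<in> {0..1}" "u = (real i - 1 + s) / real N + of_int k"
proof -
  define a where "a = nat \<lfloor>real N * frac u\<rfloor>"
  have N: "real N > 0" using assms by simp
  have f: "0 \<le> real N * frac u" "real N * frac u < real N"
    using N frac_ge_0[of u] frac_lt_1[of u] by auto
  have a: "real a \<le> real N * frac u" "real N * frac u < real a + 1"
    using f(1) by (auto simp: a_def)
  then have "a < N" using f(2) by linarith
  show ?thesis
  proof
    show "a + 1 \<in> {1..N}" using \<open>a < N\<close> by simp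
    show "real N * frac u - real a \<in> {0..1}" using a by simp
    show "u = (real (a + 1) - 1 + (real N * frac u - real a)) / real N + of_int \<lfloor>u\<rfloor>"
      using N by (simp add: frac_def)
  qed
qed

text \<open>The slab centres form a lattice of spacing \<open>1 / N\<close>, and \<open>u\<close> is
  within half a spacing of its own centre.\<close>

lemma slab_separation:
  assumes i: "i \<in> {1..N}" "i' \<in> {1..N}" and s: "s \<in> {0..1}"
    and u: "u = (real i - 1 + s) / real N + of_int k" and ne: "i \<noteq> i' \<or> k \<noteq> k'"
  shows "1 / (2 * real N) \<le> \<bar>u - (real i' - 1 / 2) / real N - of_int k'\<bar>"
proof -
  define n where "n = int i - int i' + int N * (k - k')"
  have N: "real N > 0" using i by auto
  have "n \<noteq> 0"
  proof
    assume "n = 0"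
    then have "int N * (k' - k) = int i - int i'" by (simp add: n_def algebra_simps)
    moreover have "\<bar>int i - int i'\<bar> < int N" using i by auto
    ultimately have "\<bar>int N * (k' - k)\<bar> < int N" by simp
    then have "k' = k" using i
      by (metis abs_mult abs_of_nat mult_less_cancel_left2 of_nat_0_le_iff not_less abs_ge_zero
          zero_less_abs_iff eq_iff_diff_eq_0 zless_imp_add1_zle add.left_neutral)
    then show False using \<open>int N * (k' - k) = int i - int i'\<close> ne by simp
  qed
  then have "real_of_int n \<ge> 1 \<or> real_of_int n \<le> - 1" by linarith
  then have "1 / 2 \<le> \<bar>real_of_int n + (s - 1 / 2)\<bar>" using s by (auto simp: abs_if)
  moreover have "u - (real i' - 1 / 2) / real N - of_int k' = (real_of_int n + (s - 1 / 2)) / real N"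
    using N by (simp add: u n_def field_simps)
  ultimately show ?thesis using N by (simp add: abs_div_pos[symmetric] field_simps)
qed

text \<open>The profile \<open>smooth_step (2 * s - 1 / 2)\<close> moves only for \<open>s\<close>
  between 1/4 and 3/4, which gives the half-width \<open>1 / (4 * N)\<close>. Outside these windows
  all strands are at integers, so the slabs can be forgotten: a strand only has to know the windows
  of the crossings next to it. This freedom is what lets distant crossings become
  simultaneous.\<close>

lemma slab_braid_eq_model_braid:
  assumes N: "N \<ge> 1"
  shows "slab_braid N (\<lambda>s. smooth_step (2 * s - 1 / 2)) =
    model_braid N (\<lambda>i. (real i - 1 / 2) / real N) (1 / (4 * real N))"
proof -
  have Np: "real N > 0" using N by simp
  let ?m = "\<lambda>i::nat. (real i - 1 / 2) / real N" and ?d = "1 / (4 * real N)"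
  have diff: "u - ?m i - of_int k = (s - 1 / 2) / real N"
    if "u = (real i - 1 + s) / real N + of_int k" for u i s and k :: int
    using Np that by (simp add: field_simps)
  have arg: "(u - ?m i - of_int k) / (2 * ?d) + 1 / 2 = 2 * s - 1 / 2"
    if "u = (real i - 1 + s) / real N + of_int k" for u i s and k :: int
    unfolding diff[OF that] using Np by simp
  have half: "?d \<le> 1 / (2 * real N)" using Np by (simp add: field_simps)
  have ends: "crossing i (smooth_step (2 * s - 1 / 2)) = {of_nat i, of_nat (i + 1)}"
    if "\<bar>s - 1 / 2\<bar> \<ge> 1 / 4" for i s
  proof (cases "s \<le> 1 / 4")
    case True
    then show ?thesis using smooth_step_eq_0[of "2 * s - 1 / 2"] by (simp add: crossing_0)
  next
    case False
    then have "s \<ge> 3 / 4" using that by (auto simp: abs_if split: if_splits)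
    then show ?thesis using smooth_step_eq_1[of "2 * s - 1 / 2"] by (simp add: crossing_1)
  qed
  have near: "?d \<le> \<bar>(s - 1 / 2) / real N\<bar> \<longleftrightarrow> 1 / 4 \<le> \<bar>s - 1 / 2\<bar>" for s
    using Np by (simp add: abs_div_pos[symmetric] field_simps)
  show ?thesis
  proof (intro equalityI subrelI)
    fix z u assume "(z, u) \<in> slab_braid N (\<lambda>s. smooth_step (2 * s - 1 / 2))"
    then obtain i s and k :: int where i: "i \<in> {1..N}" "s \<in> {0..1}"
      and u: "u = (real i - 1 + s) / real N + of_int k"
      and z: "z \<in> of_nat ` ({1..N + 1} - {i, i + 1}) \<union> crossing i (smooth_step (2 * s - 1 / 2))"
      unfolding slab_braid_def by blast
    have sep: "?d \<le> \<bar>u - ?m i' - of_int k'\<bar>" if "i' \<in> {1..N}" "i \<noteq> i' \<or> k \<noteq> k'" for i' k'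
      using slab_separation[OF i(1) that(1) i(2) u that(2)] half by linarith
    show "(z, u) \<in> model_braid N ?m ?d"
    proof (cases "z \<in> of_nat ` ({1..N + 1} - {i, i + 1})")
      case True
      then obtain j where "j \<in> {1..N + 1} - {i, i + 1}" "z = of_nat j" by blast
      then have j: "j \<in> {1..N + 1}" "j \<noteq> i" "j \<noteq> i + 1" "z = of_nat j" by auto
      then have "\<forall>i'\<in>{1..N}. \<forall>k'::int. j = i' \<or> j = i' + 1 \<longrightarrow> ?d \<le> \<bar>u - ?m i' - of_int k'\<bar>"
        using sep by blast
      then show ?thesis unfolding model_braid_def using j by blast
    next
      case False
      then have zc: "z \<in> crossing i (smooth_step (2 * s - 1 / 2))" using z by blast
      show ?thesis
      proof (cases "\<bar>u - ?m i - of_int k\<bar> \<le> ?d")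
        case True
        moreover have "z \<in> crossing i (smooth_step ((u - ?m i - of_int k) / (2 * ?d) + 1 / 2))"
          using zc unfolding arg[OF u] .
        ultimately show ?thesis unfolding model_braid_def using i(1) by blast
      next
        case far: False
        then have "1 / 4 \<le> \<bar>s - 1 / 2\<bar>" using near[of s] unfolding diff[OF u] by linarith
        from zc[unfolded ends[OF this]] obtain j where j: "j = i \<or> j = i + 1" "z = of_nat j" by blast
        moreover have "\<forall>i'\<in>{1..N}. \<forall>k'::int. j = i' \<or> j = i' + 1 \<longrightarrow> ?d \<le> \<bar>u - ?m i' - of_int k'\<bar>"
          using sep far by (metis less_imp_le not_less)
        moreover have "j \<in> {1..N + 1}" using j i by auto
        ultimately show ?thesis unfolding model_braid_def by blast
      qed
    qed
  next
    fix z u assume "(z, u) \<in> model_braid N ?m ?d"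
    then consider (column) j where "j \<in> {1..N + 1}" "z = of_nat j"
        "\<forall>i\<in>{1..N}. \<forall>k::int. j = i \<or> j = i + 1 \<longrightarrow> ?d \<le> \<bar>u - ?m i - of_int k\<bar>"
      | (crossing) i and k :: int where "i \<in> {1..N}" "\<bar>u - ?m i - of_int k\<bar> \<le> ?d"
        "z \<in> crossing i (smooth_step ((u - ?m i - of_int k) / (2 * ?d) + 1 / 2))"
      unfolding model_braid_def by blast
    then show "(z, u) \<in> slab_braid N (\<lambda>s. smooth_step (2 * s - 1 / 2))"
    proof cases
      case column
      obtain i s and k :: int where i: "i \<in> {1..N}" "s \<in> {0..1}"
        and u: "u = (real i - 1 + s) / real N + of_int k"
        by (rule exists_slab[OF N])
      have "z \<in> of_nat ` ({1..N + 1} - {i, i + 1}) \<union> crossing i (smooth_step (2 * s - 1 / 2))"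
      proof (cases "j = i \<or> j = i + 1")
        case True
        then have "?d \<le> \<bar>u - ?m i - of_int k\<bar>" using column(3) i(1) by blast
        then have "1 / 4 \<le> \<bar>s - 1 / 2\<bar>" unfolding diff[OF u] near .
        then show ?thesis using True column(2) ends by auto
      qed (use column in auto)
      then show ?thesis unfolding slab_braid_def using i u by blast
    next
      case crossing
      define s where "s = real N * (u - ?m i - of_int k) + 1 / 2"
      have u: "u = (real i - 1 + s) / real N + of_int k"
        using Np by (simp add: s_def field_simps)
      have "\<bar>s - 1 / 2\<bar> \<le> 1 / 4"
        using crossing(2) Np unfolding diff[OF u] by (simp add: abs_div_pos[symmetric] field_simps)
      then have "s \<in> {0..1}" by (auto simp: abs_if split: if_splits)
      then show ?thesis unfolding slab_braid_def using crossing(1,3) u unfolding arg[OF u] by blast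
    qed
  qed
qed

section \<open>Compressing the crossings by twists\<close>

text \<open>The correction that turns the profile \<open>smooth_step\<close> of slab
  \<open>i\<close> into the compressed one, as a function of the time within a period. It vanishes
  at both ends of the slab.\<close>

definition slab_delay :: "nat \<Rightarrow> nat \<Rightarrow> real \<Rightarrow> real" where
  "slab_delay N i s = smooth_step (2 * (real N * s - (real i - 1)) - 1 / 2) - smooth_step (real N * s - (real i - 1))"

text \<open>At a time in slab \<open>i\<close> only the \<open>i\<close>-th summand is non-trivial, and it rotates the disc around
  the midpoint of the crossing strands.\<close>

definition twist :: "nat \<Rightarrow> nat \<Rightarrow> real \<Rightarrow> complex \<times> real \<Rightarrow> complex \<times> real" where
  "twist N q a w = (fst w + (\<Sum>i\<in>{1..N}. (fst w - (of_nat i + 1 / 2)) *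
     (cis (a * (pi * (- 1) ^ (i - 1) * (smooth_step (2 - (cmod (fst w - (of_nat i + 1 / 2)))\<^sup>2) *
        staircase (slab_delay N i) (real q * snd w)))) - 1)), snd w)"

lemma slab_delay_eq_0:
  assumes "i \<in> {1..N}"
  shows "s \<le> 0 \<Longrightarrow> slab_delay N i s = 0" "s \<ge> 1 \<Longrightarrow> slab_delay N i s = 0"
proof -
  assume "s \<le> 0"
  then have "real N * s \<le> 0" by (simp add: mult_nonneg_nonpos)
  then show "slab_delay N i s = 0" using assms by (simp add: slab_delay_def smooth_step_eq_0)
next
  assume "s \<ge> 1"
  then have "real N * s \<ge> real N" using mult_left_mono[of 1 s "real N"] by simp
  define y where "y = real N * s - (real i - 1)"
  have "real i \<le> real N" using assms by simp
  with \<open>real N * s \<ge> real N\<close> have "y \<ge> 1" unfolding y_def by linarith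
  then have "smooth_step (2 * y - 1 / 2) = 1" "smooth_step y = 1"
    by (intro smooth_step_eq_1; linarith)+
  then show "slab_delay N i s = 0" unfolding slab_delay_def y_def[symmetric] by simp
qed

lemma Cinf_on_staircase_slab_delay:
  assumes i: "i \<in> {1..N}" shows "Cinf_on (staircase (slab_delay N i)) UNIV"
proof (rule Cinf_on_staircase)
  show "Cinf_on (slab_delay N i) UNIV"
    unfolding slab_delay_def[abs_def] by (intro Cinf_on_intros) auto
qed (use slab_delay_eq_0[OF i] in auto)

text \<open>For \<open>j\<close> different from \<open>i\<close> the local time of slab
  \<open>j\<close> is at most 0 or at least 1, where both smooth steps have the same value.\<close>

lemma staircase_slab_delay:
  assumes i: "i \<in> {1..N}" and j: "j \<in> {1..N}" and s: "s \<in> {0..1}"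
    and u: "u = (real i - 1 + s) / real N + of_int k"
  shows "staircase (slab_delay N j) u =
    (if j = i then smooth_step (2 * s - 1 / 2) - smooth_step s else 0)"
proof -
  have N: "real N > 0" using i by auto
  let ?x = "(real i - 1 + s) / real N"
  have "?x \<ge> 0" "?x \<le> 1" using i s N by (auto simp: field_simps)
  then have "staircase (slab_delay N j) u = slab_delay N j ?x"
    unfolding u by (simp add: staircase_unit slab_delay_eq_0[OF j])
  also have "\<dots> = smooth_step (2 * (real i - real j + s) - 1 / 2) - smooth_step (real i - real j + s)"
  proof -
    have "real N * ?x - (real j - 1) = real i - real j + s" using N by simp
    then show ?thesis by (simp only: slab_delay_def)
  qed
  also have "\<dots> = (if j = i then smooth_step (2 * s - 1 / 2) - smooth_step s else 0)"
  proof -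
    consider "j = i" | "j < i" | "j > i" by linarith
    then show ?thesis
    proof cases
      case 2
      then have "real i - real j + s \<ge> 1" using s by auto
      then show ?thesis using 2 by (simp add: smooth_step_eq_1)
    next
      case 3
      then have "real i - real j + s \<le> 0" using s by auto
      then show ?thesis using 3 by (simp add: smooth_step_eq_0)
    qed auto
  qed
  finally show ?thesis .
qed

lemma twist_in_slab:
  assumes i: "i \<in> {1..N}" and s: "s \<in> {0..1}" and u: "real q * \<theta> = (real i - 1 + s) / real N + of_int k"
  shows "twist N q a (z, \<theta>) = ((of_nat i + 1 / 2) + (z - (of_nat i + 1 / 2)) *
     cis (a * (pi * (- 1) ^ (i - 1) * (smooth_step (2 - (cmod (z - (of_nat i + 1 / 2)))\<^sup>2) *
       (smooth_step (2 * s - 1 / 2) - smooth_step s)))), \<theta>)"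
proof -
  have "(\<Sum>j\<in>{1..N}. (z - (of_nat j + 1 / 2)) *
     (cis (a * (pi * (- 1) ^ (j - 1) * (smooth_step (2 - (cmod (z - (of_nat j + 1 / 2)))\<^sup>2) *
        staircase (slab_delay N j) (real q * \<theta>)))) - 1)) =
     (\<Sum>j\<in>{1..N}. if j = i then (z - (of_nat i + 1 / 2)) *
     (cis (a * (pi * (- 1) ^ (i - 1) * (smooth_step (2 - (cmod (z - (of_nat i + 1 / 2)))\<^sup>2) *
        (smooth_step (2 * s - 1 / 2) - smooth_step s)))) - 1) else 0)"
    by (rule sum.cong[OF refl]) (simp add: staircase_slab_delay[OF i _ s u])
  also have "\<dots> = (z - (of_nat i + 1 / 2)) *
     (cis (a * (pi * (- 1) ^ (i - 1) * (smooth_step (2 - (cmod (z - (of_nat i + 1 / 2)))\<^sup>2) *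
        (smooth_step (2 * s - 1 / 2) - smooth_step s)))) - 1)"
    using i by simp
  finally show ?thesis unfolding twist_def fst_conv snd_conv by (simp add: algebra_simps)
qed

text \<open>The angle of rotation depends only on the time and on the distance from the centre of
  the rotation, and the rotation preserves both; so the opposite sign of \<open>a\<close> undoes
  it.\<close>

lemma torus_diffeo_twist:
  assumes N: "N \<ge> 1"
  shows "torus_diffeo (twist N q 1) (twist N q (- 1))"
proof -
  have inv: "twist N q (- a) (twist N q a w) = w" if "\<bar>a\<bar> = 1" for a w
  proof -
    obtain z \<theta> where w: "w = (z, \<theta>)" by fastforce
    obtain i s and k :: int where i: "i \<in> {1..N}" "s \<in> {0..1}"
      and u: "real q * \<theta> = (real i - 1 + s) / real N + of_int k"
      by (rule exists_slab[OF N])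
    let ?m = "of_nat i + 1 / 2 :: complex"
    define c where "c = pi * (- 1) ^ (i - 1) * (smooth_step (2 - (cmod (z - ?m))\<^sup>2) *
       (smooth_step (2 * s - 1 / 2) - smooth_step s))"
    define z' where "z' = ?m + (z - ?m) * cis (a * c)"
    have 1: "twist N q a (z, \<theta>) = (z', \<theta>)"
      unfolding z'_def c_def by (rule twist_in_slab[OF i u])
    have "cmod (z' - ?m) = cmod (z - ?m)" by (simp add: z'_def norm_mult)
    then have "twist N q (- a) (z', \<theta>) = (?m + (z' - ?m) * cis (- a * c), \<theta>)"
      using twist_in_slab[OF i u, of "- a" z'] unfolding c_def by simp
    also have "(z' - ?m) * cis (- a * c) = z - ?m"
      by (simp add: z'_def mult.assoc cis_mult)
    finally show ?thesis unfolding w 1 by simp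
  qed
  have smooth: "Cinf_on (twist N q a) UNIV" for a
  proof -
    have st: "Cinf_on (\<lambda>w::complex \<times> real. staircase (slab_delay N i) (real q * snd w)) UNIV"
      if "i \<in> {1..N}" for i
      by (rule Cinf_on_compose[OF _ Cinf_on_staircase_slab_delay[OF that]]) (auto intro!: Cinf_on_intros)
    have sq: "Cinf_on (\<lambda>w::complex \<times> real. (cmod (fst w - (of_nat i + 1 / 2)))\<^sup>2) UNIV" for i
      unfolding cmod_power2 by (intro Cinf_on_intros) auto
    show ?thesis
      unfolding twist_def[abs_def]
      by (intro Cinf_on_Pair Cinf_on_add Cinf_on_sum Cinf_on_mult Cinf_on_diff Cinf_on_cis Cinf_on_smooth_step
          Cinf_on_fst Cinf_on_snd Cinf_on_ident Cinf_on_const st sq open_UNIV)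
  qed
  have per: "twist N q 1 (z, t + 1) = twist N q 1 (z, t) + (0, 1)" for z t
  proof -
    have "staircase (slab_delay N i) (real q * (t + 1)) = staircase (slab_delay N i) (real q * t)"
      if "i \<in> {1..N}" for i
      using staircase_add_int[of "slab_delay N i" "real q * t" "int q"] slab_delay_eq_0[OF that]
      by (simp add: algebra_simps)
    then show ?thesis unfolding twist_def by simp
  qed
  have triv: "twist N q 1 (z, t) = (z, t)" if "cmod z \<ge> real N + 3" for z t
  proof -
    have "smooth_step (2 - (cmod (z - (of_nat i + 1 / 2)))\<^sup>2) = 0" if "i \<in> {1..N}" for i
    proof -
      have "cmod (of_nat i + 1 / 2) \<le> real i + 1 / 2"
        using norm_triangle_ineq[of "of_nat i :: complex" "1 / 2"] by simp
      then have "2 \<le> cmod (z - (of_nat i + 1 / 2))"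
        using norm_triangle_ineq2[of z "of_nat i + 1 / 2"] \<open>cmod z \<ge> real N + 3\<close> that by auto
      then have "2\<^sup>2 \<le> (cmod (z - (of_nat i + 1 / 2)))\<^sup>2" by (rule power_mono) simp
      then show ?thesis by (simp add: smooth_step_eq_0)
    qed
    then show ?thesis unfolding twist_def by simp
  qed
  show ?thesis
    unfolding torus_diffeo_def
    using inv[of 1] inv[of "- 1"] smooth per triv
    by (intro conjI exI[of _ "real N + 3"]) auto
qed

text \<open>The cut-off of the squared distance is 1 up to distance 1 and 0 from distance
  \<open>sqrt 2\<close> on. The crossing strands, at distance 1/2, turn by the full angle; the other
  integer positions, at distance at least 3/2, stay put.\<close>

lemma twist_positions:
  assumes i: "i \<in> {1..N}" and s: "s \<in> {0..1}" and u: "real q * \<theta> = (real i - 1 + s) / real N + of_int k"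
    and z: "z \<in> of_nat ` ({1..N + 1} - {i, i + 1}) \<union> crossing i \<sigma>"
  shows "fst (twist N q a (z, \<theta>)) \<in> of_nat ` ({1..N + 1} - {i, i + 1}) \<union>
    crossing i (\<sigma> + a * (smooth_step (2 * s - 1 / 2) - smooth_step s))"
proof -
  let ?m = "of_nat i + 1 / 2 :: complex"
  let ?e = "pi * (- 1) ^ (i - 1) :: real" and ?b = "smooth_step (2 * s - 1 / 2) - smooth_step s"
  have tw: "fst (twist N q a (z, \<theta>)) = ?m + (z - ?m) * cis (a * (?e * (smooth_step (2 - (cmod (z - ?m))\<^sup>2) * ?b)))"
    using twist_in_slab[OF i s u, of a z] by simp
  show ?thesis
  proof (cases "z \<in> crossing i \<sigma>")
    case True
    then obtain c where c: "c = 1 \<or> c = - 1" "z = ?m + c * cis (?e * \<sigma>) / 2"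
      unfolding crossing_def by (elim insertE emptyE; fastforce)
    have half: "cmod (z - ?m) = 1 / 2" using c by (auto simp: norm_mult norm_divide)
    have "smooth_step (2 - (cmod (z - ?m))\<^sup>2) = 1"
      unfolding half by (intro smooth_step_eq_1) (simp add: power2_eq_square)
    then have "fst (twist N q a (z, \<theta>)) = ?m + c * (cis (?e * \<sigma>) * cis (a * (?e * ?b))) / 2"
      unfolding tw by (simp add: c(2))
    also have "cis (?e * \<sigma>) * cis (a * (?e * ?b)) = cis (?e * (\<sigma> + a * ?b))"
      by (simp add: cis_mult algebra_simps)
    finally show ?thesis using c(1) by (auto simp: crossing_def)
  next
    case False
    then obtain j where "j \<in> {1..N + 1} - {i, i + 1}" and zj: "z = of_nat j" using z by blast
    then have "j < i \<or> j > i + 1" by auto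
    then have "3 / 2 \<le> \<bar>real j - (real i + 1 / 2)\<bar>" by auto
    moreover have "z - ?m = of_real (real j - (real i + 1 / 2))" by (simp add: zj)
    then have "cmod (z - ?m) = \<bar>real j - (real i + 1 / 2)\<bar>" by (simp only: norm_of_real)
    ultimately have "(3 / 2)\<^sup>2 \<le> (cmod (z - ?m))\<^sup>2" by (intro power_mono) auto
    then have "smooth_step (2 - (cmod (z - ?m))\<^sup>2) = 0"
      by (intro smooth_step_eq_0) (simp add: power2_eq_square)
    then have "fst (twist N q a (z, \<theta>)) = z" unfolding tw by simp
    then show ?thesis using z False by auto
  qed
qed

lemma twist_image:
  assumes N: "N \<ge> 1"
  shows "twist N q 1 ` {(z, \<theta>). (z, real q * \<theta>) \<in> slab_braid N smooth_step} =
    {(z, \<theta>). (z, real q * \<theta>) \<in> slab_braid N (\<lambda>s. smooth_step (2 * s - 1 / 2))}"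
proof (intro equalityI subsetI)
  fix x assume "x \<in> twist N q 1 ` {(z, \<theta>). (z, real q * \<theta>) \<in> slab_braid N smooth_step}"
  then obtain z \<theta> i s and k :: int where x: "x = twist N q 1 (z, \<theta>)" and i: "i \<in> {1..N}" "s \<in> {0..1}"
    and u: "real q * \<theta> = (real i - 1 + s) / real N + of_int k"
    and z: "z \<in> of_nat ` ({1..N + 1} - {i, i + 1}) \<union> crossing i (smooth_step s)"
    unfolding slab_braid_def by blast
  have "x = (fst x, \<theta>)" unfolding x by (simp add: twist_def)
  moreover have "fst x \<in> of_nat ` ({1..N + 1} - {i, i + 1}) \<union> crossing i (smooth_step (2 * s - 1 / 2))"
    using twist_positions[OF i u z, of 1] unfolding x by simp
  ultimately show "x \<in> {(z, \<theta>). (z, real q * \<theta>) \<in> slab_braid N (\<lambda>s. smooth_step (2 * s - 1 / 2))}"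
    unfolding slab_braid_def using i u by (metis (mono_tags, lifting) case_prodI mem_Collect_eq)
next
  fix x assume "x \<in> {(z, \<theta>). (z, real q * \<theta>) \<in> slab_braid N (\<lambda>s. smooth_step (2 * s - 1 / 2))}"
  then obtain z \<theta> i s and k :: int where x: "x = (z, \<theta>)" and i: "i \<in> {1..N}" "s \<in> {0..1}"
    and u: "real q * \<theta> = (real i - 1 + s) / real N + of_int k"
    and z: "z \<in> of_nat ` ({1..N + 1} - {i, i + 1}) \<union> crossing i (smooth_step (2 * s - 1 / 2))"
    unfolding slab_braid_def by blast
  define y where "y = twist N q (- 1) (z, \<theta>)"
  have "fst y \<in> of_nat ` ({1..N + 1} - {i, i + 1}) \<union> crossing i (smooth_step s)"
    using twist_positions[OF i u z, of "- 1"] unfolding y_def by simp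
  then have "(fst y, real q * \<theta>) \<in> slab_braid N smooth_step"
    unfolding slab_braid_def using i u by blast
  moreover have "y = (fst y, \<theta>)" unfolding y_def by (simp add: twist_def)
  moreover have "x = twist N q 1 y" unfolding x y_def torus_diffeoD(4)[OF torus_diffeo_twist[OF N]] ..
  ultimately show "x \<in> twist N q 1 ` {(z, \<theta>). (z, real q * \<theta>) \<in> slab_braid N smooth_step}"
    by (metis (mono_tags, lifting) case_prodI image_eqI mem_Collect_eq)
qed

section \<open>Synchronising the crossings by shears\<close>

text \<open>Serves for the time direction and for the direction of \<open>Re z\<close>. The constant
  \<open>c\<close> is a positive lower bound for the rate at which the shear advances along
  \<open>e\<close>, so it cannot fold.\<close>

lemma torus_diffeo_shear:
  fixes \<phi> :: "complex \<times> real \<Rightarrow> real"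
  assumes \<phi>: "Cinf_on \<phi> UNIV" and c: "c > 0"
    and slope: "\<And>w s. s \<ge> 0 \<Longrightarrow> \<phi> (w + s *\<^sub>R e) - \<phi> w \<ge> (c - 1) * s"
    and per: "\<And>z t. \<phi> (z, t + 1) = \<phi> (z, t)"
    and triv: "\<And>z t. cmod z \<ge> R \<Longrightarrow> \<phi> (z, t) = 0"
  shows "\<exists>G. torus_diffeo (\<lambda>w. w + \<phi> w *\<^sub>R e) G"
proof -
  obtain \<psi> where \<psi>: "Cinf_on \<psi> UNIV"
    "\<And>w. (w + \<psi> w *\<^sub>R e) + \<phi> (w + \<psi> w *\<^sub>R e) *\<^sub>R e = w"
    "\<And>w. (w + \<phi> w *\<^sub>R e) + \<psi> (w + \<phi> w *\<^sub>R e) *\<^sub>R e = w"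
    using shear_inverse[OF \<phi> c slope] by metis
  have s: "Cinf_on (\<lambda>w. w + \<phi> w *\<^sub>R e) UNIV" "Cinf_on (\<lambda>w. w + \<psi> w *\<^sub>R e) UNIV"
    by (intro Cinf_on_add Cinf_on_scaleR Cinf_on_ident Cinf_on_const \<phi> \<psi>(1) open_UNIV)+
  have "(z, t + 1) + \<phi> (z, t + 1) *\<^sub>R e = ((z, t) + \<phi> (z, t) *\<^sub>R e) + (0, 1)" for z t
    unfolding per by (simp add: prod_eq_iff)
  moreover have "(z, t) + \<phi> (z, t) *\<^sub>R e = (z, t)" if "cmod z \<ge> R" for z t
    using triv[OF that] by simp
  ultimately show ?thesis
    unfolding torus_diffeo_def using s \<psi>(2,3)
    by (intro exI[of _ "\<lambda>w. w + \<psi> w *\<^sub>R e"] conjI exI[of _ R]) auto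
qed

section \<open>A partition of unity across the strands\<close>

definition bump :: "real \<Rightarrow> real" where
  "bump x = smooth_step (x + 1) - smooth_step x"

definition plateau :: "real \<Rightarrow> real" where
  "plateau y = smooth_step (2 * y + 2) * smooth_step (2 - 2 * y)"

lemma bump_nonneg: "0 \<le> bump x"
  using smooth_step_mono[of x "x + 1"] by (simp add: bump_def)

lemma bump_eq_0: "\<bar>x\<bar> \<ge> 1 \<Longrightarrow> bump x = 0"
  by (cases "x \<ge> 1") (auto simp: bump_def smooth_step_eq_0 smooth_step_eq_1 abs_if split: if_splits)

text \<open>The bumps are consecutive differences of one smooth step and telescope; for
  \<open>x\<close> between 1 and \<open>n\<close> they add up to 1.\<close>

lemma sum_bump: "(\<Sum>j\<in>{1..n}. bump (x - real j)) = smooth_step x - smooth_step (x - real n)"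
proof (induction n)
  case (Suc n)
  have "(\<Sum>j\<in>{1..Suc n}. bump (x - real j)) = (\<Sum>j\<in>{1..n}. bump (x - real j)) + bump (x - real (Suc n))"
    by simp
  then show ?case unfolding Suc by (simp add: bump_def algebra_simps)
qed simp

lemma plateau_bounds: "0 \<le> plateau y" "plateau y \<le> 1"
  unfolding plateau_def
  by (auto intro!: mult_nonneg_nonneg mult_le_one smooth_step_nonneg smooth_step_le_1)

lemma plateau_eq_1: "\<bar>y\<bar> \<le> 1 / 2 \<Longrightarrow> plateau y = 1"
  by (simp add: plateau_def smooth_step_eq_1 abs_le_iff)

lemma plateau_eq_0: "\<bar>y\<bar> \<ge> 1 \<Longrightarrow> plateau y = 0"
  by (cases "y \<ge> 1") (auto simp: plateau_def smooth_step_eq_0 abs_if split: if_splits)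

definition weight :: "nat \<Rightarrow> complex \<Rightarrow> real" where
  "weight j z = bump (Re z - real j) * plateau (Im z)"

lemma weight_nonneg: "0 \<le> weight j z"
  by (simp add: weight_def bump_nonneg plateau_bounds)

lemma sum_weight: "(\<Sum>j\<in>{1..n}. weight j z) = (smooth_step (Re z) - smooth_step (Re z - real n)) * plateau (Im z)"
  unfolding weight_def sum_bump[symmetric] by (simp add: sum_distrib_right)

lemma sum_weight_le_1: "(\<Sum>j\<in>{1..n}. weight j z) \<le> 1"
proof -
  have "0 \<le> smooth_step (Re z) - smooth_step (Re z - real n)"
    using smooth_step_mono[of "Re z - real n" "Re z"] by simp
  moreover have "smooth_step (Re z) - smooth_step (Re z - real n) \<le> 1"
    using smooth_step_le_1[of "Re z"] smooth_step_nonneg[of "Re z - real n"] by linarith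
  ultimately show ?thesis unfolding sum_weight using plateau_bounds[of "Im z"] by (simp add: mult_le_one)
qed

section \<open>Clocks of the strands and their interpolation\<close>

text \<open>The slope \<open>N / (2 N - 2)\<close> is chosen such that windows of the crossings \<open>i\<close> and
  \<open>i + 1\<close>, which are \<open>1 / N\<close> and \<open>1 - 1 / N\<close> apart modulo \<open>1\<close>, end up \<open>1 / 2\<close> apart when
  the clock of strand \<open>i + 1\<close> jumps by \<open>1 - N / (2 N - 2)\<close> between the former and the latter.\<close>

definition clock_slope :: "nat \<Rightarrow> real" where
  "clock_slope N = real N / (2 * real N - 2)"

definition clock_jump :: "nat \<Rightarrow> real \<Rightarrow> real" where
  "clock_jump N s = smooth_step (2 * real N * (s - 1 / 2) + 1 / 2)"

text \<open>The staircase jumps around \<open>(j - 1) / N\<close>, halfway between the windows of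
  the crossings \<open>j - 1\<close> and \<open>j\<close>, and needs only \<open>1 / (4 * N)\<close>
  on either side, so it keeps clear of both windows. The constant term sets the clock to
  \<open>(j - 1) / 2\<close> at the centre of window \<open>j\<close>.\<close>

definition clock :: "nat \<Rightarrow> nat \<Rightarrow> real \<Rightarrow> real" where
  "clock N j u = clock_slope N * u +
     (1 - clock_slope N) * staircase (clock_jump N) (u - (real j - 1) / real N + 1 / 2) +
     ((real j - 1) / 2 - (1 - clock_slope N) - clock_slope N * ((real j - 1 / 2) / real N))"

text \<open>The weights interpolate between the clocks of neighbouring strands, and with the true
  time away from the braid.\<close>

definition retime :: "nat \<Rightarrow> complex \<Rightarrow> real \<Rightarrow> real" where
  "retime N z u = u + (\<Sum>j\<in>{1..N + 1}. weight j z * (clock N j u - u))"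

lemma clock_slope_bounds:
  assumes "N \<ge> 2" shows "0 < clock_slope N" "clock_slope N \<le> 1"
  using assms by (auto simp: clock_slope_def field_simps)

lemma clock_jump_values:
  assumes "N \<ge> 1"
  shows "s \<le> 1 / 2 - 1 / (4 * real N) \<Longrightarrow> clock_jump N s = 0"
    and "s \<ge> 1 / 2 + 1 / (4 * real N) \<Longrightarrow> clock_jump N s = 1"
proof -
  have N: "real N > 0" using assms by simp
  assume "s \<le> 1 / 2 - 1 / (4 * real N)"
  then have "2 * real N * (s - 1 / 2) \<le> 2 * real N * (- 1 / (4 * real N))"
    using N by (intro mult_left_mono) auto
  then show "clock_jump N s = 0" unfolding clock_jump_def using N by (intro smooth_step_eq_0) simp
next
  have N: "real N > 0" using assms by simp
  assume "s \<ge> 1 / 2 + 1 / (4 * real N)"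
  then have "2 * real N * (s - 1 / 2) \<ge> 2 * real N * (1 / (4 * real N))"
    using N by (intro mult_left_mono) auto
  then show "clock_jump N s = 1" unfolding clock_jump_def using N by (intro smooth_step_eq_1) simp
qed

lemma clock_jump_ends:
  assumes "N \<ge> 1" shows "s \<le> 0 \<Longrightarrow> clock_jump N s = 0" "s \<ge> 1 \<Longrightarrow> clock_jump N s = 1"
proof -
  have "1 / (4 * real N) \<le> 1 / 4" using assms by (simp add: field_simps)
  then show "s \<le> 0 \<Longrightarrow> clock_jump N s = 0" "s \<ge> 1 \<Longrightarrow> clock_jump N s = 1"
    using clock_jump_values[OF assms, of s] by auto
qed

lemma clock_add_int:
  assumes "N \<ge> 1" shows "clock N j (u + of_int k) = clock N j u + of_int k"
proof -
  have "staircase (clock_jump N) (u + of_int k - (real j - 1) / real N + 1 / 2) =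
      staircase (clock_jump N) (u - (real j - 1) / real N + 1 / 2) + of_int k"
    using staircase_add_int[of "clock_jump N" "u - (real j - 1) / real N + 1 / 2" k]
      clock_jump_ends[OF assms, of 0] clock_jump_ends[OF assms, of 1]
    by (simp add: algebra_simps)
  then show ?thesis unfolding clock_def by (simp add: algebra_simps)
qed

lemma clock_mono:
  assumes N: "N \<ge> 2" and h: "h \<ge> 0"
  shows "clock N j (u + h) - clock N j u \<ge> clock_slope N * h"
proof -
  have "mono (clock_jump N)"
    by (auto intro!: monoI smooth_step_mono mult_left_mono simp: clock_jump_def)
  then have "staircase (clock_jump N) (u - (real j - 1) / real N + 1 / 2) \<le>
      staircase (clock_jump N) (u + h - (real j - 1) / real N + 1 / 2)"
    by (rule staircase_mono) (use h in simp)
  then have "(1 - clock_slope N) * staircase (clock_jump N) (u - (real j - 1) / real N + 1 / 2) \<le>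
      (1 - clock_slope N) * staircase (clock_jump N) (u + h - (real j - 1) / real N + 1 / 2)"
    using clock_slope_bounds[OF N] by (intro mult_left_mono) auto
  then show ?thesis unfolding clock_def by (simp add: algebra_simps)
qed

text \<open>During window \<open>i\<close> both strands involved run at the constant rate
  \<open>clock_slope N\<close>: strand \<open>i\<close> has already jumped, strand
  \<open>i + 1\<close> has not yet. Their readings agree, so the crossing is moved in time without
  being torn.\<close>

lemma clock_window:
  assumes N: "N \<ge> 2" and x: "\<bar>x\<bar> \<le> 1 / (4 * real N)" and j: "j = i \<or> j = i + 1"
  shows "clock N j ((real i - 1 / 2) / real N + of_int k + x) =
    (real i - 1) / 2 + of_int k + clock_slope N * x"
proof -
  have Np: "real N > 0" "real N \<ge> 2" using N by auto
  have N1: "N \<ge> 1" using N by simp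
  have q: "1 / (2 * real N) = 2 * (1 / (4 * real N))" "4 * (1 / (4 * real N)) \<le> 1 / 2"
    using Np by (auto simp: field_simps)
  have xb: "- (1 / (4 * real N)) \<le> x" "x \<le> 1 / (4 * real N)" using x by (auto simp: abs_le_iff)
  define \<epsilon> where "\<epsilon> = clock_slope N"
  \<comment> \<open>The equation that fixes the slope: a distance \<open>1 / N\<close> at rate
    \<open>\<epsilon>\<close> together with the jump \<open>1 - \<epsilon>\<close> amounts to
    1/2.\<close>
  have \<epsilon>: "\<epsilon> / real N = \<epsilon> - 1 / 2"
    using Np by (simp add: \<epsilon>_def clock_slope_def field_simps)
  define m where "m = (real i - 1 / 2) / real N"
  have step: "staircase (clock_jump N) (v + of_int k) = of_int k + clock_jump N v" if "0 \<le> v" "v \<le> 1" for v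
    unfolding staircase_unit[OF that] using clock_jump_ends[OF N1, of 0] clock_jump_ends[OF N1, of 1] by simp
  show ?thesis
  proof (cases "j = i")
    case True
    let ?v = "1 / 2 + 1 / (2 * real N) + x"
    have e: "m + of_int k + x - (real j - 1) / real N + 1 / 2 = ?v + of_int k"
      using Np by (simp add: True m_def field_simps)
    have "staircase (clock_jump N) (?v + of_int k) = of_int k + clock_jump N ?v"
      by (rule step) (use xb q in linarith)+
    moreover have "clock_jump N ?v = 1"
      by (rule clock_jump_values(2)[OF N1]) (use xb q in linarith)
    ultimately have st: "staircase (clock_jump N) (?v + of_int k) = of_int k + 1" by (simp only:)
    show ?thesis
      unfolding clock_def \<epsilon>_def[symmetric] m_def[symmetric] e st unfolding True m_def[symmetric]
      by (simp add: algebra_simps)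
  next
    case False
    then have ji: "real j = real i + 1" using j by auto
    let ?v = "1 / 2 - 1 / (2 * real N) + x"
    have e: "m + of_int k + x - (real j - 1) / real N + 1 / 2 = ?v + of_int k"
      using Np by (simp add: ji m_def field_simps)
    have "staircase (clock_jump N) (?v + of_int k) = of_int k + clock_jump N ?v"
      by (rule step) (use xb q in linarith)+
    moreover have "clock_jump N ?v = 0"
      by (rule clock_jump_values(1)[OF N1]) (use xb q in linarith)
    ultimately have st: "staircase (clock_jump N) (?v + of_int k) = of_int k" by simp
    have "(real j - 1 / 2) / real N = m + 1 / real N"
      by (simp add: ji m_def add_divide_distrib diff_divide_distrib)
    then have m: "\<epsilon> * ((real j - 1 / 2) / real N) = \<epsilon> * m + (\<epsilon> - 1 / 2)"
      using \<epsilon> by (simp add: distrib_left)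
    show ?thesis
      unfolding clock_def \<epsilon>_def[symmetric] m_def[symmetric] e st m unfolding ji
      by (simp add: field_simps)
  qed
qed

lemma retime_add_int:
  assumes "N \<ge> 1" shows "retime N z (u + of_int k) = retime N z u + of_int k"
  unfolding retime_def by (simp add: clock_add_int[OF assms])

text \<open>All clocks and the true time advance at rate at least \<open>clock_slope N\<close>, and
  for fixed \<open>z\<close> the retiming is a convex combination of them: the weights are
  nonnegative with sum at most 1.\<close>

lemma retime_mono:
  assumes N: "N \<ge> 2" and h: "h \<ge> 0"
  shows "retime N z (u + h) - retime N z u \<ge> clock_slope N * h"
proof -
  have "retime N z (u + h) - retime N z u =
      h + (\<Sum>j\<in>{1..N + 1}. weight j z * (clock N j (u + h) - clock N j u - h))"
    unfolding retime_def by (simp add: sum_subtractf[symmetric] algebra_simps del: sum.cl_ivl_Suc)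
  also have "\<dots> \<ge> h + (\<Sum>j\<in>{1..N + 1}. weight j z * ((clock_slope N - 1) * h))"
  proof (intro add_left_mono sum_mono mult_left_mono weight_nonneg)
    show "(clock_slope N - 1) * h \<le> clock N j (u + h) - clock N j u - h" for j
      using clock_mono[OF N h, of j u] by (simp add: algebra_simps)
  qed
  also have "h + (\<Sum>j\<in>{1..N + 1}. weight j z * ((clock_slope N - 1) * h)) =
      h - (\<Sum>j\<in>{1..N + 1}. weight j z) * ((1 - clock_slope N) * h)"
    unfolding sum_distrib_right[symmetric] by (simp add: algebra_simps del: sum.cl_ivl_Suc)
  also have "\<dots> \<ge> h - 1 * ((1 - clock_slope N) * h)"
    using sum_weight_le_1[of z "N + 1"] clock_slope_bounds[OF N] h
    by (intro diff_left_mono mult_right_mono) auto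
  finally show ?thesis by (simp add: algebra_simps)
qed

text \<open>Between the columns \<open>i\<close> and \<open>i + 1\<close> only their two clocks have
  weight, with total 1, and on the window these clocks agree.\<close>

lemma retime_window:
  assumes N: "N \<ge> 2" and i: "i \<in> {1..N}" and z: "real i \<le> Re z" "Re z \<le> real i + 1" "\<bar>Im z\<bar> \<le> 1 / 2"
    and x: "\<bar>x\<bar> \<le> 1 / (4 * real N)"
  shows "retime N z ((real i - 1 / 2) / real N + of_int k + x) =
    (real i - 1) / 2 + of_int k + clock_slope N * x"
proof -
  define u where "u = (real i - 1 / 2) / real N + of_int k + x"
  define v where "v = (real i - 1) / 2 + of_int k + clock_slope N * x"
  have "weight j z * (clock N j u - u) = weight j z * (v - u)" for j
  proof (cases "j = i \<or> j = i + 1")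
    case True
    then show ?thesis using clock_window[OF N x] unfolding u_def v_def by simp
  next
    case False
    then have "j < i \<or> j > i + 1" by auto
    then have "\<bar>Re z - real j\<bar> \<ge> 1" using z by auto
    then show ?thesis by (simp add: weight_def bump_eq_0)
  qed
  then have "retime N z u = u + (\<Sum>j\<in>{1..N + 1}. weight j z) * (v - u)"
    unfolding retime_def sum_distrib_right by (simp only:)
  also have "(\<Sum>j\<in>{1..N + 1}. weight j z) = 1"
  proof -
    have "smooth_step (Re z) = 1" "smooth_step (Re z - real (N + 1)) = 0"
      using i z by (auto intro!: smooth_step_eq_0 smooth_step_eq_1)
    then show ?thesis unfolding sum_weight using plateau_eq_1[OF z(3)] by simp
  qed
  finally show ?thesis by (simp add: u_def v_def)
qed

text \<open>Times outside the window stay outside, by comparison with its end points through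
  \<open>retime_mono\<close>.\<close>

lemma retime_window_iff:
  fixes u :: real and k :: int
  assumes N: "N \<ge> 2" and i: "i \<in> {1..N}" and z: "real i \<le> Re z" "Re z \<le> real i + 1" "\<bar>Im z\<bar> \<le> 1 / 2"
  defines "d \<equiv> 1 / (4 * real N)"
  defines "x \<equiv> u - (real i - 1 / 2) / real N - of_int k"
    and "y \<equiv> retime N z u - (real i - 1) / 2 - of_int k"
  shows "\<bar>x\<bar> \<le> d \<and> y = clock_slope N * x \<or> \<bar>x\<bar> > d \<and> \<bar>y\<bar> > clock_slope N * d"
proof -
  have e: "clock_slope N > 0" using clock_slope_bounds[OF N] by simp
  have d: "d > 0" using N by (simp add: d_def)
  let ?m = "(real i - 1 / 2) / real N + of_int k" and ?c = "(real i - 1) / 2 + of_int k :: real"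
  have w: "retime N z (?m + t) = ?c + clock_slope N * t" if "\<bar>t\<bar> \<le> d" for t
    using retime_window[OF N i z, of t k] that by (simp add: d_def)
  consider "\<bar>x\<bar> \<le> d" | "x > d" | "x < - d" by linarith
  then show ?thesis
  proof cases
    case 1
    have "y = clock_slope N * x" using w[OF 1] by (simp add: x_def y_def)
    then show ?thesis using 1 by simp
  next
    case 2
    have "retime N z (?m + d + (x - d)) - retime N z (?m + d) \<ge> clock_slope N * (x - d)"
      using 2 by (intro retime_mono[OF N]) simp
    moreover have "retime N z (?m + d) = ?c + clock_slope N * d" using d by (intro w) simp
    moreover have "?m + d + (x - d) = u" by (simp add: x_def)
    moreover have "clock_slope N * (x - d) > 0" using 2 e by simp
    ultimately have "y > clock_slope N * d" by (simp add: y_def)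
    then show ?thesis using 2 by auto
  next
    case 3
    have "retime N z (u + (- d - x)) - retime N z u \<ge> clock_slope N * (- d - x)"
      using 3 by (intro retime_mono[OF N]) simp
    moreover have "retime N z (?m + - d) = ?c + clock_slope N * (- d)" using d by (intro w) simp
    moreover have "u + (- d - x) = ?m + - d" by (simp add: x_def)
    moreover have "clock_slope N * (- d - x) > 0" using 3 e by simp
    ultimately have "- y > clock_slope N * d" by (simp add: y_def)
    then show ?thesis using 3 by auto
  qed
qed

lemma crossing_bounds:
  assumes "z \<in> crossing i \<sigma>"
  shows "real i \<le> Re z" "Re z \<le> real i + 1" "\<bar>Im z\<bar> \<le> 1 / 2"
proof -
  define a where "a = pi * (- 1) ^ (i - 1) * \<sigma>"
  have "z = of_nat i + 1 / 2 + cis a / 2 \<or> z = of_nat i + 1 / 2 - cis a / 2"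
    using assms by (simp add: crossing_def a_def)
  then have "\<exists>c\<in>{1, - 1}. Re z = real i + 1 / 2 + c * cos a / 2 \<and> Im z = c * sin a / 2" by auto
  then obtain c where c: "c \<in> {1, - 1}" "Re z = real i + 1 / 2 + c * cos a / 2" "Im z = c * sin a / 2"
    by blast
  have "\<bar>cos a\<bar> \<le> 1" "\<bar>sin a\<bar> \<le> 1" by simp_all
  then have "\<bar>c * cos a\<bar> \<le> 1" "\<bar>c * sin a\<bar> \<le> 1" using c(1) by auto
  then show "real i \<le> Re z" "Re z \<le> real i + 1" "\<bar>Im z\<bar> \<le> 1 / 2"
    unfolding c(2,3) by (auto simp: abs_le_iff)
qed

text \<open>Both braids depend on the time only through the windows. The retiming carries window to
  window, and the profiles agree because the half-width is scaled by the same factor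
  \<open>clock_slope N\<close> as the time inside.\<close>

lemma model_braid_retime:
  assumes N: "N \<ge> 2"
  shows "(z, retime N z u) \<in> model_braid N (\<lambda>i. (real i - 1) / 2) (clock_slope N / (4 * real N)) \<longleftrightarrow>
    (z, u) \<in> model_braid N (\<lambda>i. (real i - 1 / 2) / real N) (1 / (4 * real N))"
proof -
  let ?v = "retime N z u" and ?d = "1 / (4 * real N)" and ?e = "clock_slope N"
  have e: "?e > 0" using clock_slope_bounds[OF N] by simp
  have d: "?d > 0" using N by simp
  have le: "\<bar>?v - (real i - 1) / 2 - of_int k\<bar> \<le> ?e * ?d \<longleftrightarrow> \<bar>u - (real i - 1 / 2) / real N - of_int k\<bar> \<le> ?d"
    and ge: "?e * ?d \<le> \<bar>?v - (real i - 1) / 2 - of_int k\<bar> \<longleftrightarrow> ?d \<le> \<bar>u - (real i - 1 / 2) / real N - of_int k\<bar>"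
    and arg: "\<bar>u - (real i - 1 / 2) / real N - of_int k\<bar> \<le> ?d \<Longrightarrow>
      (?v - (real i - 1) / 2 - of_int k) / (2 * (?e * ?d)) = (u - (real i - 1 / 2) / real N - of_int k) / (2 * ?d)"
    if "i \<in> {1..N}" "real i \<le> Re z" "Re z \<le> real i + 1" "\<bar>Im z\<bar> \<le> 1 / 2" for i and k :: int
  proof -
    note * = retime_window_iff[OF N that, of u k]
    show "\<bar>?v - (real i - 1) / 2 - of_int k\<bar> \<le> ?e * ?d \<longleftrightarrow> \<bar>u - (real i - 1 / 2) / real N - of_int k\<bar> \<le> ?d"
      "?e * ?d \<le> \<bar>?v - (real i - 1) / 2 - of_int k\<bar> \<longleftrightarrow> ?d \<le> \<bar>u - (real i - 1 / 2) / real N - of_int k\<bar>"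
      using * e by (auto simp: abs_mult mult_le_cancel_left_pos simp del: times_divide_eq_right)
    show "(?v - (real i - 1) / 2 - of_int k) / (2 * (?e * ?d)) = (u - (real i - 1 / 2) / real N - of_int k) / (2 * ?d)"
      if "\<bar>u - (real i - 1 / 2) / real N - of_int k\<bar> \<le> ?d"
      using * e that by auto
  qed
  have column: "(\<forall>i\<in>{1..N}. \<forall>k::int. j = i \<or> j = i + 1 \<longrightarrow> ?e * ?d \<le> \<bar>?v - (real i - 1) / 2 - of_int k\<bar>) \<longleftrightarrow>
     (\<forall>i\<in>{1..N}. \<forall>k::int. j = i \<or> j = i + 1 \<longrightarrow> ?d \<le> \<bar>u - (real i - 1 / 2) / real N - of_int k\<bar>)"
    if "z = of_nat j" for j
  proof (intro ball_cong all_cong1 imp_cong refl)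
    fix i and k :: int assume "i \<in> {1..N}" "j = i \<or> j = i + 1"
    then show "?e * ?d \<le> \<bar>?v - (real i - 1) / 2 - of_int k\<bar> \<longleftrightarrow> ?d \<le> \<bar>u - (real i - 1 / 2) / real N - of_int k\<bar>"
      using that by (intro ge) auto
  qed
  have cross: "\<bar>?v - (real i - 1) / 2 - of_int k\<bar> \<le> ?e * ?d \<and>
      z \<in> crossing i (smooth_step ((?v - (real i - 1) / 2 - of_int k) / (2 * (?e * ?d)) + 1 / 2)) \<longleftrightarrow>
     \<bar>u - (real i - 1 / 2) / real N - of_int k\<bar> \<le> ?d \<and>
      z \<in> crossing i (smooth_step ((u - (real i - 1 / 2) / real N - of_int k) / (2 * ?d) + 1 / 2))"
    if "i \<in> {1..N}" for i and k :: int
  proof (intro iffI; elim conjE)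
    assume near: "\<bar>?v - (real i - 1) / 2 - of_int k\<bar> \<le> ?e * ?d"
      and z: "z \<in> crossing i (smooth_step ((?v - (real i - 1) / 2 - of_int k) / (2 * (?e * ?d)) + 1 / 2))"
    have near': "\<bar>u - (real i - 1 / 2) / real N - of_int k\<bar> \<le> ?d"
      using near unfolding le[OF that crossing_bounds[OF z]] .
    with z show "\<bar>u - (real i - 1 / 2) / real N - of_int k\<bar> \<le> ?d \<and>
        z \<in> crossing i (smooth_step ((u - (real i - 1 / 2) / real N - of_int k) / (2 * ?d) + 1 / 2))"
      unfolding arg[OF that crossing_bounds[OF z] near'] by blast
  next
    assume near: "\<bar>u - (real i - 1 / 2) / real N - of_int k\<bar> \<le> ?d"
      and z: "z \<in> crossing i (smooth_step ((u - (real i - 1 / 2) / real N - of_int k) / (2 * ?d) + 1 / 2))"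
    then show "\<bar>?v - (real i - 1) / 2 - of_int k\<bar> \<le> ?e * ?d \<and>
        z \<in> crossing i (smooth_step ((?v - (real i - 1) / 2 - of_int k) / (2 * (?e * ?d)) + 1 / 2))"
      unfolding arg[OF that crossing_bounds[OF z] near] le[OF that crossing_bounds[OF z]] by blast
  qed
  have ed: "clock_slope N / (4 * real N) = ?e * ?d" by simp
  show ?thesis
    unfolding model_braid_def mem_Collect_eq case_prod_conv ed
    by (intro arg_cong2[of _ _ _ _ "(\<or>)"] bex_cong ex_cong1 conj_cong refl column cross)
qed

section \<open>The retiming as a diffeomorphism of the solid torus\<close>

definition time_shear :: "nat \<Rightarrow> nat \<Rightarrow> complex \<times> real \<Rightarrow> complex \<times> real" where
  "time_shear N q w = w + (retime N (fst w) (real q * snd w) / real q - snd w) *\<^sub>R (0, 1)"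

lemma time_shear_eq: "q \<ge> 1 \<Longrightarrow> time_shear N q (z, \<theta>) = (z, retime N z (real q * \<theta>) / real q)"
  by (simp add: time_shear_def)

lemma Cinf_on_weight: "Cinf_on f U \<Longrightarrow> Cinf_on (\<lambda>w. weight j (f w)) U"
  unfolding weight_def bump_def plateau_def
  by (intro Cinf_on_mult Cinf_on_add Cinf_on_diff Cinf_on_smooth_step Cinf_on_Re Cinf_on_Im Cinf_on_const)
    (auto intro: Cinf_on_open)

lemma Cinf_on_clock:
  assumes N: "N \<ge> 1" and f: "Cinf_on f U" shows "Cinf_on (\<lambda>w. clock N j (f w)) U"
proof -
  have U: "open U" by (rule Cinf_on_open[OF f])
  have "Cinf_on (staircase (clock_jump N)) UNIV"
  proof (rule Cinf_on_staircase)
    show "Cinf_on (clock_jump N) UNIV"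
      unfolding clock_jump_def[abs_def] by (intro Cinf_on_intros) auto
  qed (use clock_jump_ends[OF N] in auto)
  then have "Cinf_on (\<lambda>w. staircase (clock_jump N) (f w - (real j - 1) / real N + 1 / 2)) U"
    by (rule Cinf_on_compose[rotated]) (auto intro!: Cinf_on_add Cinf_on_diff Cinf_on_const f U)
  then show ?thesis
    unfolding clock_def by (intro Cinf_on_add Cinf_on_mult Cinf_on_const f U)
qed

lemma weight_far:
  assumes "cmod z \<ge> real N + 4" "j \<in> {1..N + 1}" shows "weight j z = 0"
proof (cases "\<bar>Im z\<bar> \<ge> 1")
  case True
  then show ?thesis by (simp add: weight_def plateau_eq_0)
next
  case False
  then have "\<bar>Re z\<bar> \<ge> real N + 3" using assms(1) cmod_le[of z] by linarith
  then have "\<bar>Re z - real j\<bar> \<ge> 1" using assms(2) by auto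
  then show ?thesis by (simp add: weight_def bump_eq_0)
qed

lemma torus_diffeo_time_shear:
  assumes N: "N \<ge> 2" and q: "q \<ge> 1"
  shows "\<exists>G. torus_diffeo (time_shear N q) G"
  unfolding time_shear_def[abs_def]
proof (rule torus_diffeo_shear)
  have qp: "real q > 0" using q by simp
  have N1: "N \<ge> 1" using N by simp
  show "Cinf_on (\<lambda>w. retime N (fst w) (real q * snd w) / real q - snd w) UNIV"
    unfolding retime_def
    by (intro Cinf_on_diff Cinf_on_divide Cinf_on_add Cinf_on_sum Cinf_on_mult Cinf_on_weight
        Cinf_on_clock[OF N1] Cinf_on_fst Cinf_on_snd Cinf_on_ident Cinf_on_const open_UNIV) (use q in auto)
  show "clock_slope N > 0" by (rule clock_slope_bounds(1)[OF N])
  show "(clock_slope N - 1) * s \<le> (retime N (fst (w + s *\<^sub>R (0, 1))) (real q * snd (w + s *\<^sub>R (0, 1))) / real q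
      - snd (w + s *\<^sub>R (0, 1))) - (retime N (fst w) (real q * snd w) / real q - snd w)" if "s \<ge> 0" for w s
  proof -
    have "clock_slope N * (real q * s) \<le>
        retime N (fst w) (real q * snd w + real q * s) - retime N (fst w) (real q * snd w)"
      by (rule retime_mono[OF N]) (use that in simp)
    then have "clock_slope N * (real q * s) / real q \<le>
        (retime N (fst w) (real q * snd w + real q * s) - retime N (fst w) (real q * snd w)) / real q"
      using qp by (intro divide_right_mono) auto
    then show ?thesis using qp by (simp add: diff_divide_distrib algebra_simps)
  qed
  show "retime N (fst (z, t + 1)) (real q * snd (z, t + 1)) / real q - snd (z, t + 1) =
      retime N (fst (z, t)) (real q * snd (z, t)) / real q - snd (z, t)" for z t
    using retime_add_int[OF N1, of z "real q * t" "int q"] qp by (simp add: field_simps)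
  show "retime N (fst (z, t)) (real q * snd (z, t)) / real q - snd (z, t) = 0"
    if "cmod z \<ge> real N + 4" for z t
    using weight_far[OF that] qp by (simp add: retime_def)
qed

definition synchronous_braid :: "nat \<Rightarrow> (complex \<times> real) set" where
  "synchronous_braid N = model_braid N (\<lambda>i. (real i - 1) / 2) (clock_slope N / (4 * real N))"

lemma time_shear_image:
  assumes N: "N \<ge> 2" and q: "q \<ge> 1"
  shows "time_shear N q ` {(z, \<theta>). (z, real q * \<theta>) \<in> slab_braid N (\<lambda>s. smooth_step (2 * s - 1 / 2))} =
    {(z, \<theta>). (z, real q * \<theta>) \<in> synchronous_braid N}"
proof -
  have qp: "real q > 0" using q by simp
  have slab: "slab_braid N (\<lambda>s. smooth_step (2 * s - 1 / 2)) =
      model_braid N (\<lambda>i. (real i - 1 / 2) / real N) (1 / (4 * real N))"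
    by (rule slab_braid_eq_model_braid) (use N in simp)
  obtain G where G: "torus_diffeo (time_shear N q) G" using torus_diffeo_time_shear[OF N q] by blast
  have iff: "time_shear N q (z, \<theta>) \<in> {(z, \<theta>). (z, real q * \<theta>) \<in> synchronous_braid N} \<longleftrightarrow>
      (z, real q * \<theta>) \<in> slab_braid N (\<lambda>s. smooth_step (2 * s - 1 / 2))" for z \<theta>
    using model_braid_retime[OF N, of z "real q * \<theta>"] qp
    unfolding time_shear_eq[OF q] slab synchronous_braid_def by simp
  show ?thesis
  proof (intro equalityI subsetI)
    fix x assume x: "x \<in> {(z, \<theta>). (z, real q * \<theta>) \<in> synchronous_braid N}"
    obtain z \<theta> where y: "G x = (z, \<theta>)" by fastforce
    have xe: "x = time_shear N q (z, \<theta>)" using torus_diffeoD(4)[OF G, of x] y by simp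
    have "(z, real q * \<theta>) \<in> slab_braid N (\<lambda>s. smooth_step (2 * s - 1 / 2))"
      using x unfolding xe iff .
    then show "x \<in> time_shear N q ` {(z, \<theta>). (z, real q * \<theta>) \<in> slab_braid N (\<lambda>s. smooth_step (2 * s - 1 / 2))}"
      unfolding xe by blast
  next
    fix x assume "x \<in> time_shear N q ` {(z, \<theta>). (z, real q * \<theta>) \<in> slab_braid N (\<lambda>s. smooth_step (2 * s - 1 / 2))}"
    then obtain z \<theta> where y: "x = time_shear N q (z, \<theta>)"
      "(z, real q * \<theta>) \<in> slab_braid N (\<lambda>s. smooth_step (2 * s - 1 / 2))" by blast
    show "x \<in> {(z, \<theta>). (z, real q * \<theta>) \<in> synchronous_braid N}"
      unfolding y(1) iff by (rule y(2))
  qed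
qed

section \<open>Centring the strands by a shear along the real axis\<close>

definition centre :: "nat \<Rightarrow> real" where
  "centre N = (real N + 2) / 2"

definition cutoff :: "nat \<Rightarrow> real \<Rightarrow> real" where
  "cutoff N x = smooth_step (x + 2) * smooth_step (real N + 3 - x)"

text \<open>Shifting the strands \<open>1, \<dots>, N + 1\<close> by a cut-off translation need not be injective; after
  scaling by the factor \<open>1 / (centre N + 1)\<close> it is.\<close>

definition recentre :: "nat \<Rightarrow> real \<Rightarrow> real" where
  "recentre N x = (x - centre N) / (centre N + 1)"

definition space_shear :: "nat \<Rightarrow> complex \<times> real \<Rightarrow> complex \<times> real" where
  "space_shear N w = w + (cutoff N (Re (fst w)) * plateau (Im (fst w)) * (recentre N (Re (fst w)) - Re (fst w))) *\<^sub>R (1, 0)"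

lemma cutoff_bounds: "0 \<le> cutoff N x" "cutoff N x \<le> 1"
  unfolding cutoff_def
  by (auto intro!: mult_nonneg_nonneg mult_le_one smooth_step_nonneg smooth_step_le_1)

text \<open>The displacement \<open>D\<close> has constant positive slope and, thanks to the factor
  in \<open>recentre\<close>, its zero at \<open>- 1\<close>. The cut-off rises only to the left of
  \<open>- 1\<close>, where \<open>D\<close> is negative, and falls only to the right of
  \<open>N + 2\<close>, where \<open>D\<close> is positive. In both places it slows the growth of
  the displacement down.\<close>

lemma cutoff_recentre:
  assumes h: "x \<le> x'"
  shows "cutoff N x' * (x' - recentre N x') - cutoff N x * (x - recentre N x) \<le>
    (1 - 1 / (centre N + 1)) * (x' - x)"
proof -
  define D where "D x = x - recentre N x" for x
  have a: "centre N > 0" by (simp add: centre_def)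
  have D: "D x' - D x = (1 - 1 / (centre N + 1)) * (x' - x)"
    by (simp add: D_def recentre_def diff_divide_distrib left_diff_distrib)
  have DD: "0 \<le> D x' - D x" unfolding D using a h by simp
  consider (rise) "cutoff N x < cutoff N x'" | (flat) "cutoff N x = cutoff N x'" | (fall) "cutoff N x' < cutoff N x"
    by linarith
  then have "cutoff N x' * D x' - cutoff N x * D x \<le> D x' - D x"
  proof cases
    case rise
    have "x < - 1"
    proof (rule ccontr)
      assume "\<not> x < - 1"
      then have "cutoff N x = smooth_step (real N + 3 - x)" by (simp add: cutoff_def smooth_step_eq_1)
      also have "\<dots> \<ge> 1 * smooth_step (real N + 3 - x')" using h by (simp add: smooth_step_mono)
      also have "1 * smooth_step (real N + 3 - x') \<ge> cutoff N x'"
        unfolding cutoff_def by (intro mult_right_mono smooth_step_le_1 smooth_step_nonneg)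
      finally show False using rise by simp
    qed
    then have "centre N * x \<le> centre N * (- 1)" using a by (intro mult_left_mono) auto
    then have "D x \<le> 0" using a by (simp add: D_def recentre_def field_simps)
    then have "(cutoff N x' - cutoff N x) * D x \<le> 0" using rise by (simp add: mult_nonneg_nonpos)
    moreover have "cutoff N x' * (D x' - D x) \<le> 1 * (D x' - D x)"
      by (rule mult_right_mono[OF cutoff_bounds(2) DD])
    ultimately show ?thesis by (simp add: algebra_simps)
  next
    case flat
    have "cutoff N x' * (D x' - D x) \<le> 1 * (D x' - D x)"
      by (rule mult_right_mono[OF cutoff_bounds(2) DD])
    then show ?thesis unfolding flat by (simp add: algebra_simps)
  next
    case fall
    have "x' > real N + 2"
    proof (rule ccontr)
      assume "\<not> x' > real N + 2"
      then have "cutoff N x' = smooth_step (x' + 2)" by (simp add: cutoff_def smooth_step_eq_1)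
      also have "\<dots> \<ge> smooth_step (x + 2) * 1" using h by (simp add: smooth_step_mono)
      also have "smooth_step (x + 2) * 1 \<ge> cutoff N x"
        unfolding cutoff_def by (intro mult_left_mono smooth_step_le_1 smooth_step_nonneg)
      finally show False using fall by simp
    qed
    then have "0 \<le> centre N * x'" using a by simp
    then have "0 \<le> D x'" using a by (simp add: D_def recentre_def field_simps)
    then have "(cutoff N x' - cutoff N x) * D x' \<le> 0" using fall by (simp add: mult_nonpos_nonneg)
    moreover have "cutoff N x * (D x' - D x) \<le> 1 * (D x' - D x)"
      by (rule mult_right_mono[OF cutoff_bounds(2) DD])
    ultimately show ?thesis by (simp add: algebra_simps)
  qed
  then show ?thesis unfolding D[symmetric] by (simp only: D_def)
qed

lemma torus_diffeo_space_shear: "\<exists>G. torus_diffeo (space_shear N) G"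
  unfolding space_shear_def[abs_def]
proof (rule torus_diffeo_shear)
  have a: "centre N > 0" by (simp add: centre_def)
  show "Cinf_on (\<lambda>w::complex \<times> real. cutoff N (Re (fst w)) * plateau (Im (fst w)) * (recentre N (Re (fst w)) - Re (fst w))) UNIV"
    unfolding cutoff_def plateau_def recentre_def
    by (intro Cinf_on_intros open_UNIV) (use a in auto)
  show "1 / (centre N + 1) > 0" using a by simp
  show "(1 / (centre N + 1) - 1) * s \<le>
      cutoff N (Re (fst (w + s *\<^sub>R (1, 0)))) * plateau (Im (fst (w + s *\<^sub>R (1, 0)))) *
        (recentre N (Re (fst (w + s *\<^sub>R (1, 0)))) - Re (fst (w + s *\<^sub>R (1, 0)))) -
      cutoff N (Re (fst w)) * plateau (Im (fst w)) * (recentre N (Re (fst w)) - Re (fst w))"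
    if "s \<ge> 0" for s and w :: "complex \<times> real"
  proof -
    define x y where "x = Re (fst w)" and "y = Im (fst w)"
    define \<Delta> where "\<Delta> = cutoff N (x + s) * (x + s - recentre N (x + s)) - cutoff N x * (x - recentre N x)"
    have "\<Delta> \<le> (1 - 1 / (centre N + 1)) * (x + s - x)"
      unfolding \<Delta>_def by (rule cutoff_recentre) (use that in simp)
    then have "plateau y * \<Delta> \<le> plateau y * ((1 - 1 / (centre N + 1)) * s)"
      by (intro mult_left_mono plateau_bounds) simp
    also have "\<dots> \<le> 1 * ((1 - 1 / (centre N + 1)) * s)"
      using that a by (intro mult_right_mono plateau_bounds mult_nonneg_nonneg) auto
    finally have "(1 / (centre N + 1) - 1) * s \<le> - (plateau y * \<Delta>)" by (simp add: algebra_simps)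
    also have "- (plateau y * \<Delta>) = cutoff N (x + s) * plateau y * (recentre N (x + s) - (x + s)) -
        cutoff N x * plateau y * (recentre N x - x)"
      by (simp add: \<Delta>_def algebra_simps)
    finally show ?thesis by (simp add: x_def y_def)
  qed
  show "cutoff N (Re (fst (z, t))) * plateau (Im (fst (z, t))) * (recentre N (Re (fst (z, t))) - Re (fst (z, t))) = 0"
    if "cmod z \<ge> real N + 4" for z t
  proof (cases "\<bar>Im z\<bar> \<ge> 1")
    case True
    then show ?thesis by (simp add: plateau_eq_0)
  next
    case False
    then have "\<bar>Re z\<bar> \<ge> real N + 3" using that cmod_le[of z] by linarith
    then have "Re z \<le> - 2 \<or> Re z \<ge> real N + 3" by (auto simp: abs_if split: if_splits)
    then have "cutoff N (Re z) = 0" by (auto simp: cutoff_def smooth_step_eq_0)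
    then show ?thesis by simp
  qed
qed simp

lemma model_braid_bounds:
  assumes "(z, u) \<in> model_braid N c d"
  shows "1 \<le> Re z" "Re z \<le> real N + 1" "\<bar>Im z\<bar> \<le> 1 / 2"
proof -
  from assms consider j where "j \<in> {1..N + 1}" "z = of_nat j" | i \<sigma> where "i \<in> {1..N}" "z \<in> crossing i \<sigma>"
    unfolding model_braid_def by blast
  then have "1 \<le> Re z \<and> Re z \<le> real N + 1 \<and> \<bar>Im z\<bar> \<le> 1 / 2"
  proof cases
    case 2
    then show ?thesis using crossing_bounds[OF 2(2)] by auto
  qed auto
  then show "1 \<le> Re z" "Re z \<le> real N + 1" "\<bar>Im z\<bar> \<le> 1 / 2" by auto
qed

lemma space_shear_synchronous:
  assumes "(z, u) \<in> synchronous_braid N"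
  shows "space_shear N (z, \<theta>) = (Complex (recentre N (Re z)) (Im z), \<theta>)"
proof -
  note b = model_braid_bounds[OF assms[unfolded synchronous_braid_def]]
  have "cutoff N (Re z) = 1" using b by (simp add: cutoff_def smooth_step_eq_1)
  moreover have "plateau (Im z) = 1" by (rule plateau_eq_1[OF b(3)])
  ultimately show ?thesis by (simp add: space_shear_def complex_eq_iff)
qed

definition symmetric_curve :: "nat \<Rightarrow> nat \<Rightarrow> (real^4) set" where
  "symmetric_curve N q = {solid_torus (Complex (recentre N (Re z)) (Im z), \<theta>) | z \<theta>.
     (z, real q * \<theta>) \<in> synchronous_braid N}"

lemma turks_head_symmetric_position:
  assumes N: "N \<ge> 2" and q: "q \<ge> 1"
  obtains h where "S3_diffeo h"
    "h ` braid_closure (geometric_braid (N + 1) (braid_power (turks_head_braid (N + 1)) q)) = symmetric_curve N q"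
proof -
  have N1: "N \<ge> 1" using N by simp
  obtain G2 where G2: "torus_diffeo (time_shear N q) G2" using torus_diffeo_time_shear[OF N q] by blast
  obtain G3 where G3: "torus_diffeo (space_shear N) G3" using torus_diffeo_space_shear by blast
  obtain G where G: "torus_diffeo (space_shear N \<circ> (time_shear N q \<circ> twist N q 1)) G"
    using torus_diffeo_compose[OF torus_diffeo_compose[OF torus_diffeo_twist[OF N1] G2] G3] by blast
  let ?F = "space_shear N \<circ> (time_shear N q \<circ> twist N q 1)"
  have "?F ` {(z, \<theta>). (z, real q * \<theta>) \<in> slab_braid N smooth_step} =
      space_shear N ` {(z, \<theta>). (z, real q * \<theta>) \<in> synchronous_braid N}"
    unfolding image_comp[symmetric] twist_image[OF N1] time_shear_image[OF N q] ..
  moreover have "torus_lift ?F ` solid_torus ` A = solid_torus ` ?F ` A" for A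
    unfolding image_image torus_lift_solid_torus[OF G] ..
  ultimately have "torus_lift ?F ` braid_closure (geometric_braid (N + 1) (braid_power (turks_head_braid (N + 1)) q)) =
      solid_torus ` space_shear N ` {(z, \<theta>). (z, real q * \<theta>) \<in> synchronous_braid N}"
    unfolding braid_closure_turks_head[OF N1 q] by simp
  also have "\<dots> = symmetric_curve N q"
  proof (intro equalityI subsetI)
    fix x assume "x \<in> solid_torus ` space_shear N ` {(z, \<theta>). (z, real q * \<theta>) \<in> synchronous_braid N}"
    then obtain z \<theta> where z: "(z, real q * \<theta>) \<in> synchronous_braid N" "x = solid_torus (space_shear N (z, \<theta>))"
      by blast
    then show "x \<in> symmetric_curve N q"
      unfolding symmetric_curve_def using space_shear_synchronous[OF z(1), of \<theta>] by auto
  next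
    fix x assume "x \<in> symmetric_curve N q"
    then obtain z \<theta> where z: "(z, real q * \<theta>) \<in> synchronous_braid N"
      "x = solid_torus (Complex (recentre N (Re z)) (Im z), \<theta>)"
      unfolding symmetric_curve_def by blast
    then have "x = solid_torus (space_shear N (z, \<theta>))" using space_shear_synchronous[OF z(1), of \<theta>] by simp
    then show "x \<in> solid_torus ` space_shear N ` {(z, \<theta>). (z, real q * \<theta>) \<in> synchronous_braid N}"
      using z(1) by blast
  qed
  finally show ?thesis using that S3_diffeo_torus_lift[OF G] by blast
qed

section \<open>Symmetries of the synchronous braid\<close>

text \<open>Conjugation and time reversal each reverse the sense of a half turn and together
  preserve it; the remaining factor \<open>- 1\<close> only exchanges the two members of the
  pair.\<close>

lemma crossing_cnj:
  assumes "z \<in> crossing i \<sigma>" shows "cnj z \<in> crossing i (1 - \<sigma>)"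
proof -
  let ?e = "pi * (- 1) ^ (i - 1) :: real"
  have "cis (?e * (1 - \<sigma>)) = cis ?e * cis (- (?e * \<sigma>))" by (simp add: cis_mult right_diff_distrib)
  also have "\<dots> = - cnj (cis (?e * \<sigma>))" by (simp add: cis_sign_pi cis_cnj)
  finally show ?thesis using assms unfolding crossing_def by auto
qed

text \<open>The rotation of the plane keeps the sense of a half turn, and time reversal changes it.
  As \<open>N\<close> is even, \<open>i\<close> and \<open>N + 1 - i\<close> have opposite parity,
  and the sign of the generator compensates.\<close>

lemma crossing_rotate:
  assumes i: "i \<in> {1..N}" and N: "even N" and z: "z \<in> crossing i \<sigma>"
  shows "of_nat (N + 2) - z \<in> crossing (N + 1 - i) (1 - \<sigma>)"
proof -
  let ?e = "pi * (- 1) ^ (i - 1) :: real"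
  have "(- 1 :: real) ^ (N + 1 - i - 1) = - ((- 1) ^ (i - 1))"
  proof -
    have "(- 1 :: real) ^ (N + 1 - i - 1) * (- 1) ^ (i - 1) = (- 1) ^ (N - 1)"
      using i by (simp flip: power_add)
    also have "\<dots> = - 1" using i N by simp
    finally show ?thesis by (cases "even (i - 1)") auto
  qed
  then have "cis (pi * (- 1) ^ (N + 1 - i - 1) * (1 - \<sigma>)) = cis (- ?e) * cis (?e * \<sigma>)"
    by (simp only: cis_mult) (simp add: algebra_simps)
  also have "cis (- ?e) = - 1" using arg_cong[OF cis_sign_pi[of "i - 1"], of cnj] by (simp add: cis_cnj)
  finally have c: "cis (pi * (- 1) ^ (N + 1 - i - 1) * (1 - \<sigma>)) = - cis (?e * \<sigma>)" by simp
  have "of_nat (N + 1 - i) = (of_nat (N + 1) - of_nat i :: complex)" using i by (intro of_nat_diff) simp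
  then show ?thesis using z unfolding crossing_def c by auto
qed

lemma smooth_step_half_reflect: "smooth_step (- x / c + 1 / 2) = 1 - smooth_step (x / c + 1 / 2)"
  using smooth_step_reflect[of "x / c + 1 / 2"] by simp

lemma synchronous_braid_cnj:
  assumes "(z, u) \<in> synchronous_braid N"
  shows "(cnj z, - u) \<in> synchronous_braid N"
proof -
  let ?d = "clock_slope N / (4 * real N)" and ?c = "\<lambda>i::nat. (real i - 1) / 2"
  \<comment> \<open>Solves \<open>- (i - 1) / 2 - k = (i - 1) / 2 + k'\<close>: the centres for a
    given \<open>i\<close> are half-integers of one class modulo 1, which negation
    preserves.\<close>
  define k' where "k' i k = 1 - int i - k" for i :: nat and k
  have flip: "- u - ?c i - of_int (k' i k) = - (u - ?c i - of_int k)" for i k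
    by (simp add: k'_def field_simps)
  have inv: "k' i (k' i k) = k" for i k by (simp add: k'_def)
  from assms consider (column) j where "j \<in> {1..N + 1}" "z = of_nat j"
      "\<And>i k. i \<in> {1..N} \<Longrightarrow> j = i \<or> j = i + 1 \<Longrightarrow> ?d \<le> \<bar>u - ?c i - of_int k\<bar>"
    | (cross) i and k :: int where "i \<in> {1..N}" "\<bar>u - ?c i - of_int k\<bar> \<le> ?d"
      "z \<in> crossing i (smooth_step ((u - ?c i - of_int k) / (2 * ?d) + 1 / 2))"
    unfolding synchronous_braid_def model_braid_def by blast
  then show ?thesis
  proof cases
    case column
    have "?d \<le> \<bar>- u - ?c i - of_int k\<bar>" if "i \<in> {1..N}" "j = i \<or> j = i + 1" for i k
      unfolding flip[of i "k' i k", unfolded inv] abs_minus_cancel by (rule column(3)[OF that])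
    moreover have "cnj z = of_nat j" using column(2) by simp
    ultimately show ?thesis
      unfolding synchronous_braid_def model_braid_def using column(1) by blast
  next
    case cross
    have "smooth_step ((- u - ?c i - of_int (k' i k)) / (2 * ?d) + 1 / 2) =
        1 - smooth_step ((u - ?c i - of_int k) / (2 * ?d) + 1 / 2)"
      unfolding flip by (rule smooth_step_half_reflect)
    then have "cnj z \<in> crossing i (smooth_step ((- u - ?c i - of_int (k' i k)) / (2 * ?d) + 1 / 2))"
      using crossing_cnj[OF cross(3)] by simp
    moreover have "\<bar>- u - ?c i - of_int (k' i k)\<bar> \<le> ?d" unfolding flip using cross(2) by simp
    ultimately show ?thesis
      unfolding synchronous_braid_def model_braid_def using cross(1) by blast
  qed
qed

lemma synchronous_braid_rotate:
  assumes N: "even N" and q: "odd q" and zu: "(z, u) \<in> synchronous_braid N"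
  shows "(of_nat (N + 2) - z, real q / 2 - u) \<in> synchronous_braid N"
proof -
  let ?d = "clock_slope N / (4 * real N)" and ?c = "\<lambda>i::nat. (real i - 1) / 2"
  let ?u = "real q / 2 - u"
  \<comment> \<open>\<open>m\<close> is the excess of \<open>q / 2 - (i - 1) / 2\<close> over
    \<open>(N - i) / 2\<close>, the centre for crossing \<open>N + 1 - i\<close>. It is an integer
    because \<open>q\<close> is odd and \<open>N\<close> even.\<close>
  have "even (int q + 1 - int N)" using N q by simp
  then obtain m where m: "int q + 1 - int N = 2 * m" by (rule dvdE)
  then have m': "real q + 1 - real N = 2 * of_int m" by linarith
  have flip: "?u - ?c (N + 1 - i) - of_int (m - k) = - (u - ?c i - of_int k)" if "i \<in> {1..N}" for i k
  proof -
    have "real (N + 1 - i) = real N + 1 - real i" using that by (simp add: of_nat_diff)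
    then show ?thesis using m' by (simp add: field_simps)
  qed
  from zu consider (column) j where "j \<in> {1..N + 1}" "z = of_nat j"
      "\<And>i k. i \<in> {1..N} \<Longrightarrow> j = i \<or> j = i + 1 \<Longrightarrow> ?d \<le> \<bar>u - ?c i - of_int k\<bar>"
    | (cross) i and k :: int where "i \<in> {1..N}" "\<bar>u - ?c i - of_int k\<bar> \<le> ?d"
      "z \<in> crossing i (smooth_step ((u - ?c i - of_int k) / (2 * ?d) + 1 / 2))"
    unfolding synchronous_braid_def model_braid_def by blast
  then show ?thesis
  proof cases
    case column
    have "?d \<le> \<bar>?u - ?c i - of_int k\<bar>" if i: "i \<in> {1..N}" and j: "N + 2 - j = i \<or> N + 2 - j = i + 1" for i k
    proof -
      have i': "N + 1 - i \<in> {1..N}" "N + 1 - (N + 1 - i) = i" using i by auto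
      have "j = N + 1 - i \<or> j = N + 1 - i + 1" using i j column(1) by auto
      from column(3)[OF i'(1) this, of "m - k"] flip[OF i'(1), of "m - k"] i'(2)
      show ?thesis by simp
    qed
    moreover have "of_nat (N + 2) - z = of_nat (N + 2 - j)"
      using column(1,2) by (simp add: of_nat_diff)
    moreover have "N + 2 - j \<in> {1..N + 1}" using column(1) by auto
    ultimately show ?thesis
      unfolding synchronous_braid_def model_braid_def by blast
  next
    case cross
    have "smooth_step ((?u - ?c (N + 1 - i) - of_int (m - k)) / (2 * ?d) + 1 / 2) =
        1 - smooth_step ((u - ?c i - of_int k) / (2 * ?d) + 1 / 2)"
      unfolding flip[OF cross(1)] by (rule smooth_step_half_reflect)
    then have "of_nat (N + 2) - z \<in>
        crossing (N + 1 - i) (smooth_step ((?u - ?c (N + 1 - i) - of_int (m - k)) / (2 * ?d) + 1 / 2))"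
      using crossing_rotate[OF cross(1) N cross(3)] by simp
    moreover have "\<bar>?u - ?c (N + 1 - i) - of_int (m - k)\<bar> \<le> ?d"
      unfolding flip[OF cross(1)] using cross(2) by simp
    moreover have "N + 1 - i \<in> {1..N}" using cross(1) by auto
    ultimately show ?thesis
      unfolding synchronous_braid_def model_braid_def by blast
  qed
qed

section \<open>Positions at the half-integral and at the odd quarter times\<close>

lemma half_width_bounds:
  assumes "N \<ge> 2" shows "0 < clock_slope N / (4 * real N)" "clock_slope N / (4 * real N) \<le> 1 / 8"
proof -
  have "real N \<ge> 2" using assms by simp
  then show "0 < clock_slope N / (4 * real N)" "clock_slope N / (4 * real N) \<le> 1 / 8"
    by (auto simp: clock_slope_def field_simps)
qed

lemma half_odd_int_bound:
  assumes "odd (m::int)" shows "1 / 2 \<le> \<bar>of_int m / 2 - of_int k :: real\<bar>"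
proof -
  have "m - 2 * k \<noteq> 0" using assms by auto
  then have "1 \<le> \<bar>of_int (m - 2 * k) :: real\<bar>" by linarith
  moreover have "of_int m / 2 - of_int k = (of_int (m - 2 * k) / 2 :: real)" by simp
  ultimately show ?thesis by (simp only: abs_divide)
qed

text \<open>At the half-integral times every second crossing is half way through, so that its strands
  are off the real axis, and only one of the outermost strands is straight.\<close>

lemma synchronous_braid_real_half_integral:
  assumes N: "N \<ge> 2" "even N" and q: "odd q"
  shows "(z, real q * (of_int k / 2)) \<in> synchronous_braid N \<and> Im z = 0 \<longleftrightarrow>
    (if even k then z = of_nat (N + 1) else z = 1)"
proof -
  let ?d = "clock_slope N / (4 * real N)" and ?c = "\<lambda>i::nat. (real i - 1) / 2"
  let ?u = "real q * (of_int k / 2)"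
  note d = half_width_bounds[OF N(1)]
  have uc: "?u - ?c i - of_int k' = of_int (int q * k - int i + 1) / 2 - of_int k'" for i k'
    by (simp add: field_simps)
  have parity: "(\<forall>k'::int. ?d \<le> \<bar>?u - ?c i - of_int k'\<bar>) \<longleftrightarrow> even (k - int i)" for i
  proof
    assume far: "\<forall>k'::int. ?d \<le> \<bar>?u - ?c i - of_int k'\<bar>"
    show "even (k - int i)"
    proof (rule ccontr)
      assume "odd (k - int i)"
      then have "even (int q * k - int i + 1)" using q by auto
      then obtain k' where "int q * k - int i + 1 = 2 * k'" by blast
      then have "?u - ?c i - of_int k' = 0" unfolding uc by simp
      then show False using far[rule_format, of k'] d by simp
    qed
  next
    assume "even (k - int i)"
    then have "odd (int q * k - int i + 1)" using q by auto
    then have "1 / 2 \<le> \<bar>?u - ?c i - of_int k'\<bar>" for k'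
      unfolding uc by (rule half_odd_int_bound)
    moreover have "?d \<le> 1 / 2" using d by linarith
    ultimately show "\<forall>k'::int. ?d \<le> \<bar>?u - ?c i - of_int k'\<bar>"
      using order_trans by blast
  qed
  have nocross: "Im z \<noteq> 0" if i: "\<bar>?u - ?c i - of_int k'\<bar> \<le> ?d"
    "z \<in> crossing i (smooth_step ((?u - ?c i - of_int k') / (2 * ?d) + 1 / 2))" for i and k' :: int
  proof -
    \<comment> \<open>The offset from a window centre is \<open>M / 2\<close>, and the half-width is
      at most 1/8, so inside a window \<open>M = 0\<close>: the crossing is exactly half way and its
      strands are at \<open>i + 1 / 2\<close> plus or minus \<open>\<i> / 2\<close>.\<close>
    define M where "M = int q * k - int i + 1 - 2 * k'"
    have M: "?u - ?c i - of_int k' = of_int M / 2" unfolding uc M_def by simp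
    then have "\<bar>of_int M :: real\<bar> < 1" using i(1)[unfolded M] d by linarith
    then have "M = 0" by linarith
    then have "?u - ?c i - of_int k' = 0" unfolding M by simp
    moreover have "smooth_step (1 / 2) = 1 / 2" using smooth_step_reflect[of "1 / 2"] by simp
    ultimately have "z \<in> crossing i (1 / 2)" using i(2) by (simp only: div_0 add_0)
    then show ?thesis by (cases "even (i - 1)") (auto simp: crossing_def)
  qed
  have "(z, ?u) \<in> synchronous_braid N \<and> Im z = 0 \<longleftrightarrow>
      (\<exists>j\<in>{1..N + 1}. z = of_nat j \<and> (\<forall>i\<in>{1..N}. j = i \<or> j = i + 1 \<longrightarrow> even (k - int i)))"
  proof
    assume zu: "(z, ?u) \<in> synchronous_braid N \<and> Im z = 0"
    then obtain j where j: "j \<in> {1..N + 1}" "z = of_nat j"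
      "\<forall>i\<in>{1..N}. \<forall>k'::int. j = i \<or> j = i + 1 \<longrightarrow> ?d \<le> \<bar>?u - ?c i - of_int k'\<bar>"
      unfolding synchronous_braid_def model_braid_def using nocross by blast
    then have "\<forall>i\<in>{1..N}. j = i \<or> j = i + 1 \<longrightarrow> even (k - int i)"
      unfolding parity[symmetric] by blast
    then show "\<exists>j\<in>{1..N + 1}. z = of_nat j \<and> (\<forall>i\<in>{1..N}. j = i \<or> j = i + 1 \<longrightarrow> even (k - int i))"
      using j by blast
  next
    assume "\<exists>j\<in>{1..N + 1}. z = of_nat j \<and> (\<forall>i\<in>{1..N}. j = i \<or> j = i + 1 \<longrightarrow> even (k - int i))"
    then obtain j where j: "j \<in> {1..N + 1}" "z = of_nat j"
      "\<forall>i\<in>{1..N}. j = i \<or> j = i + 1 \<longrightarrow> even (k - int i)" by blast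
    then have "\<forall>i\<in>{1..N}. \<forall>k'::int. j = i \<or> j = i + 1 \<longrightarrow> ?d \<le> \<bar>?u - ?c i - of_int k'\<bar>"
      unfolding parity[symmetric] by blast
    then show "(z, ?u) \<in> synchronous_braid N \<and> Im z = 0"
      unfolding synchronous_braid_def model_braid_def using j(1,2) by auto
  qed
  also have "\<dots> \<longleftrightarrow> (if even k then z = of_nat (N + 1) else z = 1)"
  proof -
    have "(\<forall>i\<in>{1..N}. j = i \<or> j = i + 1 \<longrightarrow> even (k - int i)) \<longleftrightarrow> (if even k then j = N + 1 else j = 1)"
      if j: "j \<in> {1..N + 1}" for j
    proof -
      have "j = 1 \<or> j = N + 1 \<or> 2 \<le> j \<and> j \<le> N" using j by (simp, linarith)
      then consider "j = 1" | "j = N + 1" | "2 \<le> j" "j \<le> N" by blast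
      then show ?thesis
      proof cases
        case 1
        have "i \<in> {1..N} \<and> (j = i \<or> j = i + 1) \<longleftrightarrow> i = 1" for i using N(1) 1 by auto
        then have "(\<forall>i. i \<in> {1..N} \<and> (j = i \<or> j = i + 1) \<longrightarrow> even (k - int i)) \<longleftrightarrow> even (k - int 1)"
          by (simp only: simp_thms)
        then have "(\<forall>i\<in>{1..N}. j = i \<or> j = i + 1 \<longrightarrow> even (k - int i)) \<longleftrightarrow> even (k - int 1)"
          unfolding Ball_def by (simp only: imp_conjL)
        then show ?thesis using 1 N by auto
      next
        case 2
        have "i \<in> {1..N} \<and> (j = i \<or> j = i + 1) \<longleftrightarrow> i = N" for i using N(1) 2 by auto
        then have "(\<forall>i. i \<in> {1..N} \<and> (j = i \<or> j = i + 1) \<longrightarrow> even (k - int i)) \<longleftrightarrow> even (k - int N)"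
          by (simp only: simp_thms)
        then have "(\<forall>i\<in>{1..N}. j = i \<or> j = i + 1 \<longrightarrow> even (k - int i)) \<longleftrightarrow> even (k - int N)"
          unfolding Ball_def by (simp only: imp_conjL)
        then show ?thesis using 2 N by auto
      next
        case 3
        \<comment> \<open>An inner strand takes part in two crossings of opposite parity, one of
          which is under way at every half-integral time.\<close>
        have "\<not> (\<forall>i\<in>{1..N}. j = i \<or> j = i + 1 \<longrightarrow> even (k - int i))"
        proof
          assume *: "\<forall>i\<in>{1..N}. j = i \<or> j = i + 1 \<longrightarrow> even (k - int i)"
          have "even (k - int j)" "even (k - int (j - 1))"
          proof -
            have "j \<in> {1..N}" "j - 1 \<in> {1..N}" "j = j - 1 + 1" using 3 by auto
            then show "even (k - int j)" "even (k - int (j - 1))" using * by blast+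
          qed
          then show False using 3 by (simp add: of_nat_diff)
        qed
        then show ?thesis using 3 by auto
      qed
    qed
    then show ?thesis by (auto simp: Bex_def)
  qed
  finally show ?thesis .
qed

text \<open>The windows are centred at multiples of 1/2 with half-width at most 1/8, so at an odd
  multiple of 1/4 no crossing is under way. The strand \<open>N div 2 + 1\<close> is the one at
  \<open>centre N\<close>.\<close>

lemma synchronous_braid_centre:
  assumes N: "N \<ge> 2" "even N" and q: "odd (m::int)"
  shows "(of_nat (N div 2 + 1), of_int m / 4) \<in> synchronous_braid N"
proof -
  note d = half_width_bounds[OF N(1)]
  have "clock_slope N / (4 * real N) \<le> \<bar>of_int m / 4 - (real i - 1) / 2 - of_int k\<bar>" for i and k :: int
  proof -
    have "m - 2 * (int i - 1) - 4 * k \<noteq> 0"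
    proof
      assume "m - 2 * (int i - 1) - 4 * k = 0"
      then have "m = 2 * (int i - 1 + 2 * k)" by simp
      then show False using q by simp
    qed
    then have "1 \<le> \<bar>of_int (m - 2 * (int i - 1) - 4 * k) :: real\<bar>" by linarith
    moreover have "of_int m / 4 - (real i - 1) / 2 - of_int k = of_int (m - 2 * (int i - 1) - 4 * k) / 4"
      by (simp add: field_simps)
    ultimately have "1 / 4 \<le> \<bar>of_int m / 4 - (real i - 1) / 2 - of_int k\<bar>"
      by (simp only: abs_divide) simp
    then show ?thesis using d by linarith
  qed
  moreover have "N div 2 + 1 \<in> {1..N + 1}" by auto
  ultimately show ?thesis unfolding synchronous_braid_def model_braid_def by blast
qed

section \<open>The two linear involutions\<close>

definition flip :: "4 set \<Rightarrow> real^4 \<Rightarrow> real^4" where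
  "flip S x = (\<chi> i. if i \<in> S then - x $ i else x $ i)"

lemma flip_flip: "flip S (flip S x) = x"
  by (simp add: flip_def vec_eq_iff)

lemma flip_commute: "flip S (flip T x) = flip T (flip S x)"
  by (simp add: flip_def vec_eq_iff)

lemma linear_flip: "linear (flip S)"
  by (rule linearI) (auto simp: flip_def vec_eq_iff)

lemma norm_flip: "norm (flip S x) = norm x"
  by (auto simp: norm_vec_def L2_set_def flip_def intro!: sum.cong arg_cong[of _ _ sqrt])

lemma det_flip: "det (matrix (flip S)) = (\<Prod>i\<in>UNIV. if i \<in> S then - 1 else 1)"
  by (subst det_diagonal) (auto simp: matrix_def flip_def axis_def intro!: prod.cong)

lemma flip_fixed: "flip S x = x \<longleftrightarrow> (\<forall>i\<in>S. x $ i = 0)"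
  by (auto simp: flip_def vec_eq_iff)

lemma flip_24_solid_torus: "flip {2, 4} (solid_torus (z, t)) = solid_torus (cnj z, - t)"
  by (simp add: flip_def vec_eq_iff forall_4 solid_torus_def vector_4)

lemma flip_123_solid_torus: "flip {1, 2, 3} (solid_torus (z, t)) = solid_torus (- z, 1 / 2 - t)"
proof -
  have "cos (2 * pi * (1 / 2 - t)) = - cos (2 * pi * t)" "sin (2 * pi * (1 / 2 - t)) = sin (2 * pi * t)"
    by (simp_all add: right_diff_distrib cos_diff sin_diff)
  then show ?thesis
    by (simp add: flip_def vec_eq_iff forall_4 solid_torus_def vector_4)
qed

lemma symmetric_curve_flip_24: "x \<in> symmetric_curve N q \<Longrightarrow> flip {2, 4} x \<in> symmetric_curve N q"
proof -
  assume "x \<in> symmetric_curve N q"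
  then obtain z \<theta> where x: "x = solid_torus (Complex (recentre N (Re z)) (Im z), \<theta>)"
    and z: "(z, real q * \<theta>) \<in> synchronous_braid N" unfolding symmetric_curve_def by blast
  have "flip {2, 4} x = solid_torus (Complex (recentre N (Re (cnj z))) (Im (cnj z)), - \<theta>)"
    unfolding x flip_24_solid_torus by (simp add: complex_cnj)
  moreover have "(cnj z, real q * (- \<theta>)) \<in> synchronous_braid N"
    using synchronous_braid_cnj[OF z] by simp
  ultimately show ?thesis unfolding symmetric_curve_def by blast
qed

lemma symmetric_curve_flip_123:
  assumes "even N" "odd q" "x \<in> symmetric_curve N q" shows "flip {1, 2, 3} x \<in> symmetric_curve N q"
proof -
  obtain z \<theta> where x: "x = solid_torus (Complex (recentre N (Re z)) (Im z), \<theta>)"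
    and z: "(z, real q * \<theta>) \<in> synchronous_braid N" using assms(3) unfolding symmetric_curve_def by blast
  let ?z = "of_nat (N + 2) - z"
  have "recentre N (Re ?z) = - recentre N (Re z)"
    by (simp add: recentre_def centre_def field_simps)
  then have "- Complex (recentre N (Re z)) (Im z) = Complex (recentre N (Re ?z)) (Im ?z)"
    by (simp add: complex_eq_iff)
  then have "flip {1, 2, 3} x = solid_torus (Complex (recentre N (Re ?z)) (Im ?z), 1 / 2 - \<theta>)"
    unfolding x flip_123_solid_torus by (simp only:)
  moreover have "(?z, real q * (1 / 2 - \<theta>)) \<in> synchronous_braid N"
    using synchronous_braid_rotate[OF assms(1,2) z] by (simp add: right_diff_distrib)
  ultimately show ?thesis unfolding symmetric_curve_def by blast
qed

lemma symmetric_curve_subset_S3: "symmetric_curve N q \<subseteq> S3"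
  unfolding symmetric_curve_def using solid_torus_in_S3 by blast

text \<open>Fixed points have real \<open>z\<close> and a time that is a multiple of 1/2. Modulo 1
  there are two such times, each with exactly one strand on the real axis.\<close>

lemma symmetric_curve_fixed_24:
  assumes N: "N \<ge> 2" "even N" and q: "odd q"
  shows "symmetric_curve N q \<inter> fixed_set (flip {2, 4}) =
    {solid_torus (Complex (recentre N (real (N + 1))) 0, 0), solid_torus (Complex (recentre N 1) 0, 1 / 2)}"
    (is "?A = {?P, ?Q}")
proof (intro equalityI subsetI)
  fix x assume x: "x \<in> ?A"
  then obtain z \<theta> where xe: "x = solid_torus (Complex (recentre N (Re z)) (Im z), \<theta>)"
    and z: "(z, real q * \<theta>) \<in> synchronous_braid N" unfolding symmetric_curve_def by blast
  have "flip {2, 4} x = x" using x by (simp add: fixed_set_def)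
  then have eq: "cnj (Complex (recentre N (Re z)) (Im z)) = Complex (recentre N (Re z)) (Im z)"
    "\<exists>k::int. \<theta> = - \<theta> + of_int k"
    unfolding xe flip_24_solid_torus solid_torus_eq_iff by auto
  from eq(1) have Im0: "Im z = 0" by (simp add: complex_eq_iff)
  obtain k :: int where k: "\<theta> = of_int k / 2" using eq(2) by (auto simp: field_simps)
  have zz: "if even k then z = of_nat (N + 1) else z = 1"
    using synchronous_braid_real_half_integral[OF N q, of z k] z Im0 unfolding k by blast
  show "x \<in> {?P, ?Q}"
  proof (cases "even k")
    case True
    then obtain m where "k = 2 * m" by blast
    then have "x = ?P" unfolding xe solid_torus_eq_iff using zz True
      by (intro conjI exI[of _ "- m"]) (auto simp: k)
    then show ?thesis by simp
  next
    case False
    then obtain m where "k = 2 * m + 1" by (metis oddE)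
    then have "x = ?Q" unfolding xe solid_torus_eq_iff using zz False
      by (intro conjI exI[of _ "- m"]) (auto simp: k field_simps)
    then show ?thesis by simp
  qed
next
  fix x assume "x \<in> {?P, ?Q}"
  then consider "x = ?P" | "x = ?Q" by blast
  then show "x \<in> ?A"
  proof cases
    case 1
    have "(of_nat (N + 1), real q * (of_int 0 / 2)) \<in> synchronous_braid N"
      using synchronous_braid_real_half_integral[OF N q, of "of_nat (N + 1)" 0] by simp
    then have "?P \<in> symmetric_curve N q"
      unfolding symmetric_curve_def by (intro CollectI exI[of _ "of_nat (N + 1)"] exI[of _ 0]) simp
    moreover have "flip {2, 4} ?P = ?P" unfolding flip_24_solid_torus by (simp add: complex_cnj)
    ultimately show ?thesis unfolding 1 fixed_set_def using solid_torus_in_S3 by blast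
  next
    case 2
    have "(1, real q * (of_int 1 / 2)) \<in> synchronous_braid N"
      using synchronous_braid_real_half_integral[OF N q, of 1 1] by simp
    then have "?Q \<in> symmetric_curve N q"
      unfolding symmetric_curve_def by (intro CollectI exI[of _ 1] exI[of _ "1 / 2"]) simp
    moreover have "flip {2, 4} ?Q = ?Q"
      unfolding flip_24_solid_torus solid_torus_eq_iff by (intro conjI exI[of _ 1]) (simp_all add: complex_cnj)
    ultimately show ?thesis unfolding 2 fixed_set_def using solid_torus_in_S3 by blast
  qed
qed

lemma card_symmetric_curve_fixed_24:
  assumes "N \<ge> 2" "even N" "odd q"
  shows "card (symmetric_curve N q \<inter> fixed_set (flip {2, 4})) = 2"
proof -
  have "centre N > 0" by (simp add: centre_def)
  then have "real N + 1 \<noteq> 1" "centre N + 1 \<noteq> 0" using assms(1) by auto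
  then have "recentre N (real (N + 1)) \<noteq> recentre N 1"
    by (simp add: recentre_def)
  then show ?thesis
    unfolding symmetric_curve_fixed_24[OF assms] by (simp add: solid_torus_eq_iff)
qed

lemma fixed_set_flip_123: "fixed_set (flip {1, 2, 3}) = {vector [0, 0, 0, 1], vector [0, 0, 0, - 1]}"
proof -
  have n: "norm x = \<bar>x $ 4\<bar>" if "x $ 1 = 0" "x $ 2 = 0" "x $ 3 = 0" for x :: "real^4"
    using that by (simp add: norm_vec_def L2_set_def sum_4)
  have v: "x = vector [0, 0, 0, s] \<longleftrightarrow> x $ 1 = 0 \<and> x $ 2 = 0 \<and> x $ 3 = 0 \<and> x $ 4 = s" for x :: "real^4" and s
    by (simp add: vec_eq_iff forall_4 vector_4)
  have "x \<in> fixed_set (flip {1, 2, 3}) \<longleftrightarrow> x $ 1 = 0 \<and> x $ 2 = 0 \<and> x $ 3 = 0 \<and> \<bar>x $ 4\<bar> = 1" for x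
    using n[of x] by (auto simp: fixed_set_def flip_fixed)
  moreover have "\<bar>t\<bar> = 1 \<longleftrightarrow> t = 1 \<or> t = - 1" for t :: real by auto
  ultimately show ?thesis using v by blast
qed

text \<open>The two fixed points have \<open>z = 0\<close> and times 1/4 and -1/4. For odd
  \<open>q\<close> the rescaled times are again odd multiples of 1/4, at which the middle strand is
  in the centre.\<close>

lemma fixed_set_flip_123_subset:
  assumes N: "N \<ge> 2" "even N" and q: "odd q"
  shows "fixed_set (flip {1, 2, 3}) \<subseteq> symmetric_curve N q"
proof -
  have rc: "Complex (recentre N (Re (of_nat (N div 2 + 1)))) (Im (of_nat (N div 2 + 1))) = 0"
  proof -
    have "real (N div 2) = real N / 2" using N(2) by (simp add: real_of_nat_div)
    then show ?thesis by (simp add: recentre_def centre_def complex_eq_iff)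
  qed
  have "solid_torus (0, s / 4) \<in> symmetric_curve N q" if "s = of_int m" "odd m" for s and m :: int
  proof -
    have "(of_nat (N div 2 + 1), of_int (int q * m) / 4) \<in> synchronous_braid N"
      by (rule synchronous_braid_centre[OF N]) (use q that in simp)
    then have "(of_nat (N div 2 + 1), real q * (s / 4)) \<in> synchronous_braid N" by (simp add: that)
    then have "solid_torus (Complex (recentre N (Re (of_nat (N div 2 + 1)))) (Im (of_nat (N div 2 + 1))), s / 4)
        \<in> symmetric_curve N q" unfolding symmetric_curve_def by blast
    then show ?thesis unfolding rc .
  qed
  from this[of 1 1] this[of "- 1" "- 1"]
  have "solid_torus (0, 1 / 4) \<in> symmetric_curve N q" "solid_torus (0, - 1 / 4) \<in> symmetric_curve N q" by auto
  moreover have "2 * pi * (1 / 4) = pi / 2" "2 * pi * (- 1 / 4) = - (pi / 2)" by simp_all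
  then have "solid_torus (0, 1 / 4) = vector [0, 0, 0, 1]" "solid_torus (0, - 1 / 4) = vector [0, 0, 0, - 1]"
    unfolding solid_torus_def case_prod_conv by (simp_all only:) simp_all
  ultimately show ?thesis unfolding fixed_set_flip_123 by simp
qed

lemma fixed_set_flip_24_homeomorphic: "fixed_set (flip {2, 4}) homeomorphic sphere (0::complex) 1"
proof -
  have n: "norm x = cmod (Complex (x $ 1) (x $ 3))" if "x $ 2 = 0" "x $ 4 = 0" for x :: "real^4"
    using that by (simp add: norm_vec_def L2_set_def sum_4 cmod_def)
  have "homeomorphism (fixed_set (flip {2, 4})) (sphere (0::complex) 1)
      (\<lambda>x. Complex (x $ 1) (x $ 3)) (\<lambda>z. \<chi> i. if i = 1 then Re z else if i = 3 then Im z else 0)"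
  proof (rule homeomorphismI)
    have "Cinf_on (\<lambda>x::real^4. Complex (x $ 1) (x $ 3)) UNIV"
      by (intro Cinf_on_intros open_UNIV)
    then show "continuous_on (fixed_set (flip {2, 4})) (\<lambda>x. Complex (x $ 1) (x $ 3))"
      using Cinf_on_imp_continuous_on continuous_on_subset by blast
    have "continuous_on (sphere 0 1) (\<lambda>z. if i = 1 then Re z else if i = 3 then Im z else 0)" for i :: 4
      by (cases "i = 1"; cases "i = 3") (auto intro!: continuous_intros)
    then show "continuous_on (sphere 0 1) (\<lambda>z. \<chi> i::4. if i = 1 then Re z else if i = 3 then Im z else 0)"
      by (rule continuous_on_vec_lambda)
    show "(\<lambda>x. Complex (x $ 1) (x $ 3)) ` fixed_set (flip {2, 4}) \<subseteq> sphere 0 1"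
      using n by (auto simp: fixed_set_def flip_fixed)
    show "(\<lambda>z. \<chi> i::4. if i = 1 then Re z else if i = 3 then Im z else 0) ` sphere 0 1 \<subseteq> fixed_set (flip {2, 4})"
      by (auto simp: fixed_set_def flip_fixed n)
    show "(\<chi> i::4. if i = 1 then Re (Complex (x $ 1) (x $ 3)) else if i = 3 then Im (Complex (x $ 1) (x $ 3)) else 0) = x"
      if "x \<in> fixed_set (flip {2, 4})" for x :: "real^4"
      using that unfolding fixed_set_def flip_fixed by (simp add: vec_eq_iff forall_4)
  qed auto
  then show ?thesis unfolding homeomorphic_def by blast
qed

lemma fixed_set_flip_123_homeomorphic: "fixed_set (flip {1, 2, 3}) homeomorphic sphere (0::real) 1"
proof -
  have "homeomorphism (fixed_set (flip {1, 2, 3})) (sphere (0::real) 1)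
      (\<lambda>x. x $ 4) (\<lambda>t. \<chi> i. if i = 4 then t else 0)"
  proof (rule homeomorphismI)
    show "continuous_on (fixed_set (flip {1, 2, 3})) (\<lambda>x. x $ 4)" by (intro continuous_intros)
    have "continuous_on (sphere 0 1) (\<lambda>t::real. if i = 4 then t else 0)" for i :: 4
      by (cases "i = 4") (auto intro!: continuous_intros)
    then show "continuous_on (sphere 0 1) (\<lambda>t::real. \<chi> i::4. if i = 4 then t else 0)"
      by (rule continuous_on_vec_lambda)
    show "(\<lambda>t::real. \<chi> i::4. if i = 4 then t else 0) ` sphere 0 1 \<subseteq> fixed_set (flip {1, 2, 3})"
      unfolding fixed_set_flip_123 by (auto simp: vec_eq_iff forall_4 vector_4)
  qed (auto simp: fixed_set_flip_123 vec_eq_iff forall_4 vector_4)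
  then show ?thesis unfolding homeomorphic_def by blast
qed

section \<open>Klein four-groups\<close>

lemma (in group) subgroup_generated_Klein_four:
  assumes ab: "a \<in> carrier G" "b \<in> carrier G" and sq: "a \<otimes> a = \<one>" "b \<otimes> b = \<one>"
    and comm: "a \<otimes> b = b \<otimes> a" and ne: "a \<noteq> \<one>" "b \<noteq> \<one>" "a \<noteq> b"
  shows "subgroup_generated G {a, b} \<cong> integer_mod_group 2 \<times>\<times> integer_mod_group 2"
proof -
  let ?S = "{\<one>, a, b, a \<otimes> b}"
  have aab: "a \<otimes> (a \<otimes> b) = b" using ab sq by (simp add: m_assoc[symmetric])
  have bab: "b \<otimes> (a \<otimes> b) = a" unfolding comm using ab sq by (simp add: m_assoc[symmetric])
  have aba: "a \<otimes> b \<otimes> a = b" unfolding comm using ab sq by (simp add: m_assoc)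
  have abb: "a \<otimes> b \<otimes> b = a" using ab sq by (simp add: m_assoc)
  have abab: "a \<otimes> b \<otimes> (a \<otimes> b) = \<one>" using bab ab sq by (simp add: m_assoc)
  have mult: "x \<otimes> y \<in> ?S" if "x \<in> ?S" "y \<in> ?S" for x y
    using that ab sq comm aab bab aba abb abab by auto
  have sub: "subgroup ?S G"
  proof (rule subgroupI)
    fix x assume x: "x \<in> ?S"
    then have "x \<otimes> x = \<one>" using ab sq abab by auto
    then have "inv x = x" using x ab by (intro inv_equality) auto
    then show "inv x \<in> ?S" using x by simp
  qed (use ab mult in auto)
  have gen: "generate G {a, b} = ?S"
  proof
    show "generate G {a, b} \<subseteq> ?S" by (rule generate_subgroup_incl[OF _ sub]) auto
    show "?S \<subseteq> generate G {a, b}" by (auto intro: generate.intros)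
  qed
  have carr: "carrier (subgroup_generated G {a, b}) = ?S"
    using ab gen by (simp add: carrier_subgroup_generated)
  have ab_ne: "a \<otimes> b \<noteq> \<one>" "a \<otimes> b \<noteq> a" "a \<otimes> b \<noteq> b"
  proof -
    show "a \<otimes> b \<noteq> \<one>" using aab ab ne by auto
    show "a \<otimes> b \<noteq> a" using aab sq ne by auto
    show "a \<otimes> b \<noteq> b" using abb sq ne by auto
  qed
  define f where "f = (\<lambda>(m, n). (if m = (0::int) then \<one> else a) \<otimes> (if n = (0::int) then \<one> else b))"
  have Z: "carrier (integer_mod_group 2) = {0, 1}" by (auto simp: carrier_integer_mod_group)
  have "f \<in> iso (integer_mod_group 2 \<times>\<times> integer_mod_group 2) (subgroup_generated G {a, b})"
  proof (rule isoI)
    show "f \<in> hom (integer_mod_group 2 \<times>\<times> integer_mod_group 2) (subgroup_generated G {a, b})"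
      unfolding hom_def carr DirProd_def
      using ab sq comm aab bab aba abb abab by (auto simp: Z f_def)
    show "bij_betw f (carrier (integer_mod_group 2 \<times>\<times> integer_mod_group 2)) (carrier (subgroup_generated G {a, b}))"
      unfolding carr bij_betw_def DirProd_def inj_on_def
      using ab ne ab_ne by (auto simp: Z f_def image_iff)
  qed
  then show ?thesis
    using group.iso_sym[OF DirProd_group[OF group_integer_mod_group group_integer_mod_group]] is_isoI by blast
qed

text \<open>The fixed sets tell the maps and the identity apart as elements of the group, where only
  their restrictions to \<open>S3\<close> count.\<close>

lemma S3_group_generated_Klein_four:
  assumes \<rho>: "S3_involution \<rho>" and \<tau>: "S3_involution \<tau>" and comm: "\<And>x. x \<in> S3 \<Longrightarrow> \<rho> (\<tau> x) = \<tau> (\<rho> x)"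
    and ne: "fixed_set \<rho> \<noteq> S3" "fixed_set \<tau> \<noteq> S3" "fixed_set \<rho> \<noteq> fixed_set \<tau>"
  shows "S3_group_generated {\<rho>, \<tau>} \<cong> integer_mod_group 2 \<times>\<times> integer_mod_group 2"
proof -
  have inv: "f x \<in> S3" "f (f x) = x" if "S3_involution f" "x \<in> S3" for f x
    using that unfolding S3_involution_def by blast+
  have Bij: "restrict f S3 \<in> Bij S3" if f: "S3_involution f" for f
  proof -
    have "bij_betw f S3 S3" by (rule bij_betw_byWitness[where f'=f]) (use inv[OF f] in auto)
    then have "bij_betw (restrict f S3) S3 S3" by (rule bij_betw_cong[THEN iffD1, rotated]) auto
    then show ?thesis by (auto simp: Bij_def)
  qed
  let ?r = "restrict \<rho> S3" and ?t = "restrict \<tau> S3"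
  have mult: "restrict f S3 \<otimes>\<^bsub>BijGroup S3\<^esub> restrict g S3 = (\<lambda>x\<in>S3. f (g x))"
    if "S3_involution f" "S3_involution g" for f g
    using Bij[OF that(1)] Bij[OF that(2)] inv[OF that(2)]
    by (simp add: BijGroup_def compose_def restrict_def fun_eq_iff)
  have one: "\<one>\<^bsub>BijGroup S3\<^esub> = (\<lambda>x\<in>S3. x)" by (simp add: BijGroup_def)
  have fixed: "fixed_set f = {x \<in> S3. restrict f S3 x = x}" for f
    unfolding fixed_set_def by auto
  have "subgroup_generated (BijGroup S3) {?r, ?t} \<cong> integer_mod_group 2 \<times>\<times> integer_mod_group 2"
  proof (rule group.subgroup_generated_Klein_four[OF group_BijGroup])
    show "?r \<in> carrier (BijGroup S3)" "?t \<in> carrier (BijGroup S3)"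
      using Bij \<rho> \<tau> by (auto simp: BijGroup_def)
    show "?r \<otimes>\<^bsub>BijGroup S3\<^esub> ?r = \<one>\<^bsub>BijGroup S3\<^esub>" "?t \<otimes>\<^bsub>BijGroup S3\<^esub> ?t = \<one>\<^bsub>BijGroup S3\<^esub>"
      unfolding mult[OF \<rho> \<rho>] mult[OF \<tau> \<tau>] one using inv[OF \<rho>] inv[OF \<tau>] by (auto intro!: restrict_ext)
    show "?r \<otimes>\<^bsub>BijGroup S3\<^esub> ?t = ?t \<otimes>\<^bsub>BijGroup S3\<^esub> ?r"
      unfolding mult[OF \<rho> \<tau>] mult[OF \<tau> \<rho>] using comm by (auto intro!: restrict_ext)
    have id: "fixed_set f = S3" if "restrict f S3 = (\<lambda>x\<in>S3. x)" for f
      unfolding fixed[of f] that by auto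
    show "?r \<noteq> \<one>\<^bsub>BijGroup S3\<^esub>" using ne(1) id[of \<rho>] unfolding one by argo
    show "?t \<noteq> \<one>\<^bsub>BijGroup S3\<^esub>" using ne(2) id[of \<tau>] unfolding one by argo
    show "?r \<noteq> ?t"
    proof
      assume "?r = ?t"
      then have "fixed_set \<rho> = fixed_set \<tau>" unfolding fixed[of \<rho>] fixed[of \<tau>] by (simp only:)
      then show False using ne(3) by contradiction
    qed
  qed
  then show ?thesis by (simp add: S3_group_generated_def)
qed

section \<open>The symmetries of the Turk's head knots\<close>

text \<open>The reparametrization commutes with the unit shift, so it is unbounded in both
  directions and onto by continuity.\<close>

lemma same_oriented_knot_range:
  assumes "same_oriented_knot K L" shows "range L = range K"
proof -
  obtain h :: "real \<Rightarrow> real" where h: "smooth_on UNIV h" "\<And>t. h (t + 1) = h t + 1" "\<And>t. L t = K (h t)"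
    using assms unfolding same_oriented_knot_def by blast
  have ch: "continuous_on UNIV h" by (rule smooth_on_imp_continuous_on[OF h(1)])
  have per: "h (of_int k) = h 0 + of_int k" for k
    using periodic_int[of "\<lambda>t. h t - t" 0 k] h(2) by simp
  have "\<exists>t. h t = y" for y
  proof -
    define n where "n = \<lceil>\<bar>y - h 0\<bar>\<rceil>"
    have n: "\<bar>y - h 0\<bar> \<le> of_int n" by (simp add: n_def)
    have "h (of_int (- n)) \<le> y" "y \<le> h (of_int n)" unfolding per using n by auto
    moreover have "of_int (- n) \<le> (of_int n :: real)" using n by linarith
    ultimately show ?thesis
      using IVT'[of h "of_int (- n)" y "of_int n"] continuous_on_subset[OF ch] by blast
  qed
  then have "surj h" by (metis surjI)
  then show ?thesis using h(3) by (metis (no_types, lifting) UNIV_I image_cong image_image)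
qed

lemma oriented_knot_infinite_range:
  assumes "oriented_knot K" shows "infinite (range K)"
proof -
  have "inj_on K {0..<1}" using assms by (simp add: oriented_knot_def)
  then have "infinite (K ` {0..<1})" using infinite_Ico[of "0::real" 1] by (simp add: finite_image_iff)
  then show ?thesis using finite_subset[of "K ` {0..<1}" "range K"] by blast
qed

text \<open>Undoing the symmetric positioning and then applying the end of the isotopy gives the one
  diffeomorphism by which both involutions are conjugated.\<close>

lemma turks_head_knot_range:
  assumes N: "N \<ge> 2" and q: "q \<ge> 1" and K: "turks_head_knot (N + 1) q K"
  obtains f where "S3_diffeo f" "range K = f ` symmetric_curve N q"
proof -
  let ?B = "braid_closure (geometric_braid (N + 1) (braid_power (turks_head_braid (N + 1)) q))"
  obtain K0 where K0: "range K0 = ?B" "range K0 \<subseteq> S3" "isotopic_knots K0 K"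
    using K unfolding turks_head_knot_def closure_knot_def oriented_knot_def by blast
  obtain H :: "real \<Rightarrow> real^4 \<Rightarrow> real^4" where H: "\<forall>s\<in>{0..1}. S3_diffeo (H s)" "same_oriented_knot (H 1 \<circ> K0) K"
    using K0(3) unfolding isotopic_knots_def by blast
  have H1: "S3_diffeo (H 1)" using H(1) by simp
  obtain g where g: "S3_diffeo g" "g ` ?B = symmetric_curve N q"
    by (rule turks_head_symmetric_position[OF N q])
  note gD = S3_diffeoD[OF g(1)]
  have "inv_into S3 g ` symmetric_curve N q = ?B"
    unfolding g(2)[symmetric] image_image using gD(6) K0(1,2) by force
  then have "(H 1 \<circ> inv_into S3 g) ` symmetric_curve N q = H 1 ` range K0"
    unfolding K0(1) image_comp[symmetric] by simp
  also have "\<dots> = range K" unfolding same_oriented_knot_range[OF H(2)] by (simp add: image_comp)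
  finally show ?thesis
    using that S3_diffeo_compose[OF S3_diffeo_inv_into[OF g(1)] H1] by metis
qed

lemma flip_S3: "x \<in> S3 \<Longrightarrow> flip S x \<in> S3"
  by (simp add: norm_flip)

lemma det_flip_values: "det (matrix (flip {2, 4})) = 1" "det (matrix (flip {1, 2, 3})) = - 1"
  unfolding det_flip UNIV_4 by simp_all

text \<open>The finite non-empty intersection supplies what \<open>involution_reverses_knot\<close>
  asks for: a fixed point on the knot and, since the knot is infinite, a point of it that
  moves.\<close>

lemma conjugate_flip_reverses_knot:
  assumes K: "oriented_knot K" and f: "S3_diffeo f" and r: "range K = f ` C" "C \<subseteq> S3"
    and C: "\<And>x. x \<in> C \<Longrightarrow> flip S x \<in> C" and fin: "finite (C \<inter> fixed_set (flip S))" and ne: "C \<inter> fixed_set (flip S) \<noteq> {}"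
  shows "reverses_knot (f \<circ> flip S \<circ> inv_into S3 f) K"
    and "range K \<inter> fixed_set (f \<circ> flip S \<circ> inv_into S3 f) = f ` (C \<inter> fixed_set (flip S))"
proof -
  note fD = S3_diffeoD[OF f]
  let ?g = "f \<circ> flip S \<circ> inv_into S3 f"
  have fixed: "fixed_set ?g = f ` fixed_set (flip S)"
    by (rule fixed_set_conjugate[OF f flip_S3])
  have inj: "inj_on f S3" using fD(1) by (simp add: bij_betw_def)
  have F: "fixed_set (flip S) \<subseteq> S3" by (auto simp: fixed_set_def)
  show int: "range K \<inter> fixed_set ?g = f ` (C \<inter> fixed_set (flip S))"
    unfolding fixed r(1) by (rule inj_on_image_Int[OF inj r(2) F, symmetric])
  have "?g x \<in> range K" if x: "x \<in> range K" for x
  proof -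
    obtain y where y: "y \<in> C" "x = f y" using x unfolding r(1) by blast
    then have "inv_into S3 f x = y" using fD(6) r(2) by blast
    then show ?thesis unfolding r(1) using C[OF y(1)] by simp
  qed
  then have inv: "?g ` range K \<subseteq> range K" by blast
  have "range K \<inter> fixed_set ?g \<noteq> {}" unfolding int using ne by (simp add: image_is_empty)
  then obtain a where a: "K a \<in> fixed_set ?g" by blast
  have "finite (range K \<inter> fixed_set ?g)" unfolding int using fin by simp
  then have "\<not> range K \<subseteq> fixed_set ?g"
    using oriented_knot_infinite_range[OF K] by (metis inf.absorb1)
  then obtain b where b: "K b \<notin> fixed_set ?g" by blast
  have "S3_involution ?g"
    by (rule conjugate_involution[OF f linear_flip flip_S3 flip_flip])
  then show "reverses_knot ?g K" by (rule involution_reverses_knot[OF K _ inv a b])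
qed

theorem theorem1p3:
  fixes p q :: nat and K :: "real \<Rightarrow> real^4"
  assumes "p \<ge> 3" and "q \<ge> 3" and "odd p" and "odd q" and "gcd p q = 1"
    and "turks_head_knot p q K"
  shows "klein_amphichiral K \<and>
    (\<exists>\<rho> \<tau> :: real^4 \<Rightarrow> real^4.
       S3_involution \<rho> \<and> S3_involution \<tau> \<and>
       S3_group_generated {\<rho>, \<tau>} \<cong> integer_mod_group 2 \<times>\<times> integer_mod_group 2 \<and>
       (orientation_preserving \<rho> \<and> reverses_knot \<rho> K \<and>
        fixed_set \<rho> homeomorphic sphere (0::complex) 1 \<and>
        card (range K \<inter> fixed_set \<rho>) = 2) \<and>
       (orientation_reversing \<tau> \<and> reverses_knot \<tau> K \<and>
        fixed_set \<tau> homeomorphic sphere (0::real) 1 \<and>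
        range K \<inter> fixed_set \<tau> = fixed_set \<tau>) \<and>
       (\<forall>x\<in>S3. \<rho> (\<tau> x) = \<tau> (\<rho> x)))"
proof -
  define N where "N = p - 1"
  have N: "N \<ge> 2" "even N" "p = N + 1" using assms(1,3) by (auto simp: N_def)
  have q: "q \<ge> 1" using assms(2) by simp
  have K: "oriented_knot K" using assms(6) by (simp add: turks_head_knot_def)
  let ?C = "symmetric_curve N q"
  obtain f where f: "S3_diffeo f" "range K = f ` ?C"
    using turks_head_knot_range[OF N(1) q] assms(6) unfolding N(3) by blast
  note fD = S3_diffeoD[OF f(1)]
  have inj: "inj_on f S3" using fD(1) by (simp add: bij_betw_def)
  let ?k = "inv_into S3 f"
  define \<rho> where "\<rho> = f \<circ> flip {2, 4} \<circ> ?k"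
  define \<tau> where "\<tau> = f \<circ> flip {1, 2, 3} \<circ> ?k"
  have fixed: "fixed_set \<rho> = f ` fixed_set (flip {2, 4})" "fixed_set \<tau> = f ` fixed_set (flip {1, 2, 3})"
    unfolding \<rho>_def \<tau>_def by (rule fixed_set_conjugate[OF f(1) flip_S3], assumption)+
  have F: "fixed_set (flip S) \<subseteq> S3" for S by (auto simp: fixed_set_def)
  have involutions: "S3_involution \<rho>" "S3_involution \<tau>"
    unfolding \<rho>_def \<tau>_def by (rule conjugate_involution[OF f(1) linear_flip flip_S3 flip_flip], assumption)+
  have preserving: "orientation_preserving \<rho>"
    unfolding \<rho>_def
    by (rule conjugate_orientation(1)[OF f(1) linear_flip flip_S3]) (simp_all only: det_flip_values)
  have reversing: "orientation_reversing \<tau>"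
    unfolding \<tau>_def
    by (rule conjugate_orientation(2)[OF f(1) linear_flip flip_S3]) (simp_all only: det_flip_values)
  have commute: "\<rho> (\<tau> x) = \<tau> (\<rho> x)" if "x \<in> S3" for x
    using fD(5)[OF that] fD(6) flip_S3 flip_commute[of "{2, 4}" "{1, 2, 3}"] by (simp add: \<rho>_def \<tau>_def)
  have card_\<rho>: "card (?C \<inter> fixed_set (flip {2, 4})) = 2"
    by (rule card_symmetric_curve_fixed_24[OF N(1,2) assms(4)])
  then have \<rho>_fin: "finite (?C \<inter> fixed_set (flip {2, 4}))" "?C \<inter> fixed_set (flip {2, 4}) \<noteq> {}"
    by (auto intro: card_ge_0_finite)
  have \<tau>_int: "?C \<inter> fixed_set (flip {1, 2, 3}) = fixed_set (flip {1, 2, 3})"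
    using fixed_set_flip_123_subset[OF N(1,2) assms(4)] by blast
  have \<tau>_fin: "finite (?C \<inter> fixed_set (flip {1, 2, 3}))" "?C \<inter> fixed_set (flip {1, 2, 3}) \<noteq> {}"
    unfolding \<tau>_int by (simp_all add: fixed_set_flip_123)
  note rev_\<rho> = conjugate_flip_reverses_knot[OF K f symmetric_curve_subset_S3 symmetric_curve_flip_24 \<rho>_fin]
  note rev_\<tau> = conjugate_flip_reverses_knot[OF K f symmetric_curve_subset_S3
      symmetric_curve_flip_123[OF N(2) assms(4)] \<tau>_fin]
  have reverses: "reverses_knot \<rho> K" "reverses_knot \<tau> K"
    unfolding \<rho>_def \<tau>_def using rev_\<rho>(1) rev_\<tau>(1) by blast+
  have card: "card (range K \<inter> fixed_set \<rho>) = 2"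
  proof -
    have "range K \<inter> fixed_set \<rho> = f ` (?C \<inter> fixed_set (flip {2, 4}))"
      unfolding \<rho>_def by (rule rev_\<rho>(2))
    moreover have "inj_on f (?C \<inter> fixed_set (flip {2, 4}))" by (rule inj_on_subset[OF inj]) (use F in blast)
    ultimately show ?thesis using card_\<rho> by (simp add: card_image)
  qed
  have incl: "range K \<inter> fixed_set \<tau> = fixed_set \<tau>"
    unfolding fixed(2) using rev_\<tau>(2) unfolding \<tau>_def[symmetric] fixed(2) \<tau>_int .
  have homeo: "fixed_set \<rho> homeomorphic sphere (0::complex) 1" "fixed_set \<tau> homeomorphic sphere (0::real) 1"
    unfolding fixed
    by (rule homeomorphic_trans[OF S3_diffeo_image_homeomorphic[OF f(1) F]]
        fixed_set_flip_24_homeomorphic fixed_set_flip_123_homeomorphic)+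
  have "S3_group_generated {\<rho>, \<tau>} \<cong> integer_mod_group 2 \<times>\<times> integer_mod_group 2"
  proof (rule S3_group_generated_Klein_four[OF involutions commute])
    have "range K \<subseteq> S3" using oriented_knotD(2)[OF K] by blast
    \<comment> \<open>Otherwise the fixed set would contain the whole infinite knot instead of two
      of its points.\<close>
    then have "fixed_set \<rho> \<noteq> S3"
      using card oriented_knot_infinite_range[OF K] by (metis card.infinite inf.absorb1 zero_neq_numeral)
    moreover have "finite (fixed_set \<tau>)" unfolding fixed fixed_set_flip_123 by simp
    then have "fixed_set \<tau> \<noteq> S3"
      using oriented_knot_infinite_range[OF K] \<open>range K \<subseteq> S3\<close> finite_subset by metis
    moreover have "axis 1 1 \<in> fixed_set (flip {2, 4})" "axis 1 1 \<notin> fixed_set (flip {1, 2, 3})"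
      by (auto simp: fixed_set_def flip_fixed axis_def norm_vec_def L2_set_def sum_4)
    then have "fixed_set \<rho> \<noteq> fixed_set \<tau>"
      unfolding fixed inj_on_image_eq_iff[OF inj F F] by blast
    ultimately show "fixed_set \<rho> \<noteq> S3" "fixed_set \<tau> \<noteq> S3" "fixed_set \<rho> \<noteq> fixed_set \<tau>" by auto
  qed
  moreover have "klein_amphichiral K"
    unfolding klein_amphichiral_def strong_inversion_def strongly_negative_amphichiral_def
    by (intro exI[of _ \<rho>] exI[of _ \<tau>] conjI ballI involutions preserving reversing reverses commute)
  ultimately show ?thesis
    by (intro conjI exI[of _ \<rho>] exI[of _ \<tau>] ballI involutions preserving reversing reverses commute
        card incl homeo)
qed

end
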